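(* Let $P$ be a Polish monothetic group which is Hilbert-representable and let $K\subset P$ be a compact subgroup. Then the quotient group $P/K$ is Hilbert-representable.
   Context: A topological group is monothetic if it contains a dense cyclic subgroup (in particular, being Hausdorff, it is abelian). A Polish group $P$ is Hilbert-representable if there is a topological group isomorphism of $P$ onto a subgroup of the unitary group $\mathcal{U}(\mathcal{H})$ of some Hilbert space $\mathcal{H}$, where $\mathcal{U}(\mathcal{H})$ carries the strong operator topology. *)

theory Defs
  imports "HOL-Analysis.Analysis" "HOL-Algebra.Algebra" "HOL-Algebra.Algebraic_Closure_Type"
begin

section \<open>Topological groups\<close>

locale topological_group = group G for G :: "('a, 'm) monoid_scheme" (structure) +
  fixes T :: "'a topology"
  assumes topspace_eq: "topspace T = carrier G"
    and continuous_mult: "continuous_map (prod_topology T T) T (\<lambda>(x, y). x \<otimes> y)"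
    and continuous_inv: "continuous_map T T (\<lambda>x. inv x)"

definition polish_group :: "('a, 'm) monoid_scheme \<Rightarrow> 'a topology \<Rightarrow> bool" where
  "polish_group G T \<longleftrightarrow>
     topological_group G T \<and> completely_metrizable_space T \<and> separable_space T"

definition monothetic :: "('a, 'm) monoid_scheme \<Rightarrow> 'a topology \<Rightarrow> bool" where
  "monothetic G T \<longleftrightarrow> (\<exists>a \<in> carrier G. Abstract_Topology.closure_of T (generate G {a}) = topspace T)"

definition quotient_topology :: "'a topology \<Rightarrow> ('a \<Rightarrow> 'b) \<Rightarrow> 'b topology" where
  "quotient_topology S f =
     topology (\<lambda>U. U \<subseteq> f ` topspace S \<and> openin S {x \<in> topspace S. f x \<in> U})"

lemma openin_quotient_topology:
  "openin (quotient_topology S f) U \<longleftrightarrow>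
     U \<subseteq> f ` topspace S \<and> openin S {x \<in> topspace S. f x \<in> U}"
proof -
  have int: "{x \<in> topspace S. f x \<in> V \<inter> W} = {x \<in> topspace S. f x \<in> V} \<inter> {x \<in> topspace S. f x \<in> W}"
    for V W by auto
  have Un: "{x \<in> topspace S. f x \<in> \<Union>\<K>} = (\<Union>V\<in>\<K>. {x \<in> topspace S. f x \<in> V})" for \<K>
    by auto
  have "istopology (\<lambda>U. U \<subseteq> f ` topspace S \<and> openin S {x \<in> topspace S. f x \<in> U})"
    unfolding istopology_def int Un by (blast intro: openin_Int openin_Union)
  then show ?thesis
    by (simp add: quotient_topology_def topology_inverse')
qed

lemma topspace_quotient_topology [simp]: "topspace (quotient_topology S f) = f ` topspace S"
proof -
  have "openin (quotient_topology S f) (f ` topspace S)"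
  proof -
    have "{x \<in> topspace S. f x \<in> f ` topspace S} = topspace S" by auto
    then show ?thesis by (simp add: openin_quotient_topology)
  qed
  then show ?thesis
    by (metis openin_quotient_topology openin_subset openin_topspace subset_antisym)
qed

lemma quotient_map_quotient_topology: "quotient_map S (quotient_topology S f) f"
  by (simp add: quotient_map_def openin_quotient_topology)

text \<open>The topology on the carrier of \<open>G Mod K\<close>, the set of cosets of \<open>K\<close>.\<close>

definition quotient_group_topology ::
    "('a, 'm) monoid_scheme \<Rightarrow> 'a topology \<Rightarrow> 'a set \<Rightarrow> 'a set topology" where
  "quotient_group_topology G T K = quotient_topology T (\<lambda>x. K #>\<^bsub>G\<^esub> x)"


section \<open>Complex Hilbert spaces with explicit carrier\<close>

text \<open>
  Carriers, rather than a type class, let one quantify existentially over Hilbert spaces: over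
  all those whose underlying set is a subset of a given type.
\<close>

record 'h inner_module = "(complex, 'h) module" +
  cinner :: "'h \<Rightarrow> 'h \<Rightarrow> complex"

text \<open>Inner products are linear in the first argument.\<close>

locale complex_inner_space =
  module "ring_of_type_algebra :: complex ring" H for H :: "'h inner_module" (structure) +
  assumes cinner_add: "\<lbrakk>x \<in> carrier H; y \<in> carrier H; z \<in> carrier H\<rbrakk> \<Longrightarrow>
      cinner H (x \<oplus> y) z = cinner H x z + cinner H y z"
    and cinner_smult: "\<lbrakk>x \<in> carrier H; y \<in> carrier H\<rbrakk> \<Longrightarrow>
      cinner H (c \<odot> x) y = c * cinner H x y"
    and cinner_commute: "\<lbrakk>x \<in> carrier H; y \<in> carrier H\<rbrakk> \<Longrightarrow>
      cinner H x y = cnj (cinner H y x)"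
    and cinner_nonneg: "x \<in> carrier H \<Longrightarrow> 0 \<le> Re (cinner H x x)"
    and cinner_definite: "\<lbrakk>x \<in> carrier H; cinner H x x = 0\<rbrakk> \<Longrightarrow> x = \<zero>"

definition hnorm :: "'h inner_module \<Rightarrow> 'h \<Rightarrow> real" where
  "hnorm H x = sqrt (Re (cinner H x x))"

text \<open>
  The value \<open>0\<close> outside the carrier is irrelevant; it is there because \<^locale>\<open>Metric_space\<close> requires
  nonnegativity and symmetry on the whole type.
\<close>

definition hdist :: "'h inner_module \<Rightarrow> 'h \<Rightarrow> 'h \<Rightarrow> real" where
  "hdist H x y =
     (if x \<in> carrier H \<and> y \<in> carrier H then hnorm H (x \<ominus>\<^bsub>H\<^esub> y) else 0)"

context complex_inner_space
begin

lemma cinner_add_right: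
  "\<lbrakk>x \<in> carrier H; y \<in> carrier H; z \<in> carrier H\<rbrakk> \<Longrightarrow>
     cinner H z (x \<oplus> y) = cinner H z x + cinner H z y"
  by (metis M.add.m_closed cinner_add cinner_commute complex_cnj_add)

lemma smult_in_carrier: "x \<in> carrier H \<Longrightarrow> c \<odot> x \<in> carrier H"
  by (rule smult_closed) (auto simp: ring_of_type_algebra_def)

lemma cinner_smult_right:
  "\<lbrakk>x \<in> carrier H; y \<in> carrier H\<rbrakk> \<Longrightarrow> cinner H y (c \<odot> x) = cnj c * cinner H y x"
  by (metis smult_in_carrier cinner_smult cinner_commute complex_cnj_mult)

lemma cinner_self: "x \<in> carrier H \<Longrightarrow> cinner H x x = of_real ((hnorm H x)\<^sup>2)"
  using cinner_nonneg[of x] cinner_commute[of x x]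
  by (auto simp: hnorm_def complex_eq_iff)

lemma hnorm_nonneg: "x \<in> carrier H \<Longrightarrow> 0 \<le> hnorm H x"
  by (simp add: hnorm_def cinner_nonneg)

lemma cinner_zero_left: "x \<in> carrier H \<Longrightarrow> cinner H \<zero> x = 0"
  using cinner_add[of \<zero> \<zero> x] by simp

lemma hnorm_eq_0_iff: "x \<in> carrier H \<Longrightarrow> hnorm H x = 0 \<longleftrightarrow> x = \<zero>"
  using cinner_self[of x] cinner_definite[of x] cinner_zero_left[of x] by auto

lemma hnorm_add_smult:
  assumes "x \<in> carrier H" "y \<in> carrier H"
  shows "(hnorm H (x \<oplus> c \<odot> y))\<^sup>2 =
    (hnorm H x)\<^sup>2 + 2 * Re (c * cinner H y x) + (cmod c)\<^sup>2 * (hnorm H y)\<^sup>2"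
proof -
  have "complex_of_real ((hnorm H (x \<oplus> c \<odot> y))\<^sup>2) = cinner H (x \<oplus> c \<odot> y) (x \<oplus> c \<odot> y)"
    using assms by (simp add: cinner_self smult_in_carrier)
  also have "\<dots> = cinner H x x + (c * cinner H y x + cnj c * cinner H x y)
      + (c * cnj c) * cinner H y y"
    using assms by (simp add: cinner_add cinner_add_right cinner_smult cinner_smult_right
        smult_in_carrier algebra_simps)
  also have "cnj c * cinner H x y = cnj (c * cinner H y x)"
    using assms cinner_commute[of x y] by simp
  also have "c * cinner H y x + cnj (c * cinner H y x) = of_real (2 * Re (c * cinner H y x))"
    by (rule complex_add_cnj)
  also have "c * cnj c = of_real ((cmod c)\<^sup>2)"
    by (rule complex_norm_square[symmetric])
  finally have "complex_of_real ((hnorm H (x \<oplus> c \<odot> y))\<^sup>2) =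
      of_real ((hnorm H x)\<^sup>2 + 2 * Re (c * cinner H y x) + (cmod c)\<^sup>2 * (hnorm H y)\<^sup>2)"
    using assms by (simp only: cinner_self of_real_add of_real_mult)
  then show ?thesis
    using of_real_eq_iff by blast
qed

lemma Cauchy_Schwarz:
  assumes x: "x \<in> carrier H" and y: "y \<in> carrier H"
  shows "cmod (cinner H y x) \<le> hnorm H x * hnorm H y"
proof (cases "y = \<zero>")
  case True
  then show ?thesis using x y by (simp add: cinner_zero_left hnorm_nonneg)
next
  case False
  define n where "n = (hnorm H y)\<^sup>2"
  define c where "c = - cnj (cinner H y x) / of_real n"
  have n: "n > 0" using False y by (simp add: n_def hnorm_eq_0_iff)
  have "c * cinner H y x = - of_real ((cmod (cinner H y x))\<^sup>2 / n)"
    unfolding c_def of_real_divide complex_norm_square by (simp add: mult.commute)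
  then have re: "Re (c * cinner H y x) = - ((cmod (cinner H y x))\<^sup>2 / n)"
    by simp
  have c2: "(cmod c)\<^sup>2 * n = (cmod (cinner H y x))\<^sup>2 / n"
    using n by (simp add: c_def norm_divide power_divide power2_eq_square)
  have "0 \<le> (hnorm H x)\<^sup>2 - (cmod (cinner H y x))\<^sup>2 / n"
    using hnorm_add_smult[OF x y, of c, unfolded re n_def[symmetric] c2]
      zero_le_power2[of "hnorm H (x \<oplus> c \<odot> y)"] by linarith
  then have "(cmod (cinner H y x))\<^sup>2 \<le> (hnorm H x * hnorm H y)\<^sup>2"
    using n by (simp add: field_simps n_def)
  then show ?thesis
    using x y by (meson hnorm_nonneg mult_nonneg_nonneg power2_le_imp_le)
qed

lemma smult_1: "x \<in> carrier H \<Longrightarrow> 1 \<odot> x = x"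
  using smult_one[of x] by (simp add: ring_of_type_algebra_def)

lemma smult_minus_1: "x \<in> carrier H \<Longrightarrow> (-1) \<odot> x = \<ominus> x"
proof -
  assume x: "x \<in> carrier H"
  have *: "(a + b) \<odot> x = a \<odot> x \<oplus> b \<odot> x" for a b
    using smult_l_distr[of a b x] x by (simp add: ring_of_type_algebra_def)
  have "0 \<odot> x \<oplus> 0 \<odot> x = 0 \<odot> x" using *[of 0 0] by simp
  then have "0 \<odot> x = \<zero>" using x by (simp add: smult_in_carrier)
  then have "(-1) \<odot> x \<oplus> x = \<zero>" using *[of "-1" 1] x by (simp add: smult_1)
  then show ?thesis using x by (simp add: M.minus_equality smult_in_carrier)
qed

lemma hnorm_triangle:
  assumes x: "x \<in> carrier H" and y: "y \<in> carrier H"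
  shows "hnorm H (x \<oplus> y) \<le> hnorm H x + hnorm H y"
proof -
  have "(hnorm H (x \<oplus> y))\<^sup>2 = (hnorm H x)\<^sup>2 + 2 * Re (cinner H y x) + (hnorm H y)\<^sup>2"
    using hnorm_add_smult[OF x y, of 1] y by (simp add: smult_1)
  moreover have "Re (cinner H y x) \<le> hnorm H x * hnorm H y"
    using Cauchy_Schwarz[OF x y] complex_Re_le_cmod order_trans by blast
  ultimately have "(hnorm H (x \<oplus> y))\<^sup>2 \<le> (hnorm H x + hnorm H y)\<^sup>2"
    by (simp add: power2_sum)
  then show ?thesis
    using x y by (meson add_nonneg_nonneg hnorm_nonneg power2_le_imp_le)
qed

lemma hnorm_minus: "x \<in> carrier H \<Longrightarrow> hnorm H (\<ominus> x) = hnorm H x"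
  by (simp add: hnorm_def smult_in_carrier cinner_smult cinner_smult_right
      flip: smult_minus_1)

sublocale Metric_space "carrier H" "hdist H"
proof
  fix x y
  show "0 \<le> hdist H x y" by (simp add: hdist_def hnorm_nonneg)
  show "hdist H x y = hdist H y x"
  proof (cases "x \<in> carrier H \<and> y \<in> carrier H")
    case True
    then have "y \<ominus> x = \<ominus> (x \<ominus> y)"
      by (simp add: M.minus_eq M.minus_add M.minus_minus M.a_comm)
    then show ?thesis using True by (simp add: hdist_def hnorm_minus)
  qed (auto simp: hdist_def)
next
  fix x y assume "x \<in> carrier H" "y \<in> carrier H"
  then show "hdist H x y = 0 \<longleftrightarrow> x = y"
    by (auto simp: hdist_def hnorm_eq_0_iff M.minus_eq M.r_neg
        dest: M.minus_equality M.minus_equality[of x "\<ominus> y"])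
next
  fix x y z assume xyz: "x \<in> carrier H" "y \<in> carrier H" "z \<in> carrier H"
  have "x \<ominus> z = (x \<ominus> y) \<oplus> (y \<ominus> z)"
    using xyz by (simp add: M.minus_eq M.a_assoc M.r_neg1)
  then show "hdist H x z \<le> hdist H x y + hdist H y z"
    using xyz hnorm_triangle[of "x \<ominus> y" "y \<ominus> z"] by (simp add: hdist_def)
qed

end

locale complex_hilbert_space = complex_inner_space +
  assumes complete: "mcomplete"


section \<open>The unitary group with the strong operator topology\<close>

text \<open>
  As in \<^const>\<open>BijGroup\<close>, operators are extensional functions on the carrier, so that distinct
  functions are distinct operators. A surjective linear isometry is a unitary operator.
\<close>

definition unitary_ops :: "'h inner_module \<Rightarrow> ('h \<Rightarrow> 'h) set" where
  "unitary_ops H = {U \<in> Bij (carrier H).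
     (\<forall>x \<in> carrier H. \<forall>y \<in> carrier H. U (x \<oplus>\<^bsub>H\<^esub> y) = U x \<oplus>\<^bsub>H\<^esub> U y) \<and>
     (\<forall>c. \<forall>x \<in> carrier H. U (c \<odot>\<^bsub>H\<^esub> x) = c \<odot>\<^bsub>H\<^esub> U x) \<and>
     (\<forall>x \<in> carrier H. \<forall>y \<in> carrier H. cinner H (U x) (U y) = cinner H x y)}"

definition unitary_group :: "'h inner_module \<Rightarrow> ('h \<Rightarrow> 'h) monoid" where
  "unitary_group H = BijGroup (carrier H) \<lparr>carrier := unitary_ops H\<rparr>"

text \<open>The strong operator topology is pointwise convergence in the norm of \<open>H\<close>.\<close>

definition strong_operator_topology :: "'h inner_module \<Rightarrow> ('h \<Rightarrow> 'h) topology" where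
  "strong_operator_topology H =
     subtopology
       (product_topology (\<lambda>_. Metric_space.mtopology (carrier H) (hdist H)) (carrier H))
       (unitary_ops H)"


section \<open>Hilbert-representable groups\<close>

text \<open>
  HOL cannot quantify over types inside a formula, so the type \<open>'h\<close> containing the underlying set
  of the Hilbert space is a parameter. As a hypothesis, with \<open>'h\<close> a type variable, this is
  representability on an arbitrary Hilbert space. For a conclusion, \<open>'h = nat \<Rightarrow> complex\<close> is large
  enough to lose nothing: a separable subgroup of a unitary group acts faithfully, with the same
  topology, on a separable closed invariant subspace, and this is isometric to some
  \<open>\<ell>\<^sup>2(I)\<close> with \<open>I\<close> a set of natural numbers.
\<close>

definition hilbert_representable ::
    "'h itself \<Rightarrow> ('a, 'm) monoid_scheme \<Rightarrow> 'a topology \<Rightarrow> bool" where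
  "hilbert_representable (_ :: 'h itself) G T \<longleftrightarrow>
     polish_group G T \<and>
     (\<exists>(H :: 'h inner_module) S \<phi>.
        complex_hilbert_space H \<and>
        subgroup S (unitary_group H) \<and>
        \<phi> \<in> iso G (unitary_group H \<lparr>carrier := S\<rparr>) \<and>
        homeomorphic_map T (subtopology (strong_operator_topology H) S) \<phi>)"

end

theory Submission
  imports Defs
begin

text \<open>
  A Polish group is Hilbert-representable iff its topology is detected by continuous positive
  definite functions. Given a neighbourhood \<open>V\<close> of \<open>\<one>\<close>, a representation provides such a function
  \<open>b\<close> with \<open>b \<le> b \<one> - \<delta>\<close> off \<open>V\<close>. The average of the power \<open>b\<^sup>n\<close> (positive definite by Schur's product
  theorem) over translates by \<open>K\<close> is \<open>K\<close>-invariant; at \<open>\<one>\<close> it is at least a fixed multiple of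
  \<open>(b \<one> - \<delta>/2)\<^sup>n\<close>, since finitely many translates of a small neighbourhood cover \<open>K\<close>, but off \<open>V K\<close>
  it is at most \<open>(b \<one> - \<delta>)\<^sup>n\<close>. For large \<open>n\<close> it therefore separates \<open>\<one>\<close> from the complement of
  \<open>V K\<close>. A convergent sum over a countable neighbourhood base is a single invariant positive definite
  function, and its Gelfand--Naimark--Segal representation is the required one of the quotient.
  Monotheticity serves only to make the group abelian and thus \<open>K\<close> normal.
\<close>

section \<open>Positive semidefinite kernels\<close>

text \<open>Averaging \<open>b\<close> alone over \<open>K\<close> can destroy the separation:
  \<open>b\<close> may drop inside \<open>K\<close> as much as it does off \<open>V\<close>, so the
  average at \<open>\<one>\<close> may fall below the bound valid off \<open>V K\<close>. Powers
  help because the gap between the two \<open>n\<close>-th powers grows exponentially, while the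
  loss at \<open>\<one>\<close> is a factor independent of \<open>n\<close>: of \<open>m\<close>
  pieces covering \<open>K\<close>, one has mass at least \<open>1/m\<close>, which leaves
  \<open>1/m^2\<close> in a double average. The comparison needs \<open>0 \<le> b\<close>, so
  constants are added to the matrix coefficients. Only real parts of matrix coefficients occur.
  Hence kernels are real and symmetric and are tested with real coefficients; complex ones split
  into real and imaginary parts. Integration is avoided: averages are limits of finite convex
  combinations inside the space that the positive definite function defines. With a single detecting
  function, one vector controls the topology of the quotient, and the point masses at a countable
  dense set are total, so coefficient sequences indexed by \<open>nat\<close> encode the whole
  Hilbert space.\<close>

definition psd_kernel :: "('a \<Rightarrow> 'a \<Rightarrow> real) \<Rightarrow> bool" where
  "psd_kernel \<kappa> \<longleftrightarrow> (\<forall>x y. \<kappa> x y = \<kappa> y x) \<and>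
     (\<forall>A c. finite A \<longrightarrow> 0 \<le> (\<Sum>x\<in>A. \<Sum>y\<in>A. c x * c y * \<kappa> x y))"

lemma psd_kernelI:
  assumes "\<And>x y. \<kappa> x y = \<kappa> y x"
    and "\<And>A c. finite A \<Longrightarrow> 0 \<le> (\<Sum>x\<in>A. \<Sum>y\<in>A. c x * c y * \<kappa> x y)"
  shows "psd_kernel \<kappa>"
  using assms unfolding psd_kernel_def by blast

lemma psd_kernel_sym: "psd_kernel \<kappa> \<Longrightarrow> \<kappa> x y = \<kappa> y x"
  unfolding psd_kernel_def by blast

lemma psd_kernel_sum_nonneg:
  "psd_kernel \<kappa> \<Longrightarrow> finite A \<Longrightarrow> 0 \<le> (\<Sum>x\<in>A. \<Sum>y\<in>A. c x * c y * \<kappa> x y)"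
  unfolding psd_kernel_def by blast

lemma psd_kernel_diag: "psd_kernel \<kappa> \<Longrightarrow> 0 \<le> \<kappa> x x"
  using psd_kernel_sum_nonneg[of \<kappa> "{x}" "\<lambda>_. 1"] by simp

text \<open>Restricting to \<open>Y\<close> amounts to setting the coefficients to zero off
  \<open>Y\<close>. This passes from kernels on a carrier to kernels on the whole type.\<close>

lemma psd_kernel_restrict:
  assumes \<kappa>: "psd_kernel \<kappa>"
  shows "psd_kernel (\<lambda>x y. if x \<in> Y \<and> y \<in> Y then \<kappa> x y else 0)"
proof (rule psd_kernelI)
  fix A :: "'a set" and c :: "'a \<Rightarrow> real"
  assume A: "finite A"
  have "(\<Sum>x\<in>A. \<Sum>y\<in>A. c x * c y * (if x \<in> Y \<and> y \<in> Y then \<kappa> x y else 0)) =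
     (\<Sum>x\<in>A. \<Sum>y\<in>A. (if x \<in> Y then c x else 0) * (if y \<in> Y then c y else 0) * \<kappa> x y)"
    by (intro sum.cong refl) auto
  then show "0 \<le> (\<Sum>x\<in>A. \<Sum>y\<in>A. c x * c y * (if x \<in> Y \<and> y \<in> Y then \<kappa> x y else 0))"
    using psd_kernel_sum_nonneg[OF \<kappa> A] by simp
qed (use psd_kernel_sym[OF \<kappa>] in auto)

lemma psd_kernel_const: "0 \<le> a \<Longrightarrow> psd_kernel (\<lambda>x y. a)"
proof (rule psd_kernelI)
  fix A :: "'a set" and c :: "'a \<Rightarrow> real" assume "0 \<le> a"
  have "(\<Sum>x\<in>A. \<Sum>y\<in>A. c x * c y * a) = (sum c A)\<^sup>2 * a"
    by (simp add: power2_eq_square flip: sum_distrib_left sum_distrib_right)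
  then show "0 \<le> (\<Sum>x\<in>A. \<Sum>y\<in>A. c x * c y * a)" using \<open>0 \<le> a\<close> by simp
qed simp

lemma psd_kernel_add:
  assumes "psd_kernel \<kappa>" "psd_kernel \<eta>"
  shows "psd_kernel (\<lambda>x y. \<kappa> x y + \<eta> x y)"
proof (rule psd_kernelI)
  fix A :: "'a set" and c :: "'a \<Rightarrow> real" assume A: "finite A"
  show "0 \<le> (\<Sum>x\<in>A. \<Sum>y\<in>A. c x * c y * (\<kappa> x y + \<eta> x y))"
    using psd_kernel_sum_nonneg[OF assms(1) A, of c] psd_kernel_sum_nonneg[OF assms(2) A, of c]
    by (simp add: distrib_left sum.distrib)
qed (metis assms psd_kernel_sym)

lemma psd_kernel_limit:
  assumes "\<And>n. psd_kernel (\<kappa> n)" and lim: "\<And>x y. (\<lambda>n. \<kappa> n x y) \<longlonglongrightarrow> \<eta> x y"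
  shows "psd_kernel \<eta>"
proof (rule psd_kernelI)
  fix x y show "\<eta> x y = \<eta> y x"
    using LIMSEQ_unique[OF lim[of x y]] lim[of y x] psd_kernel_sym[OF assms(1)] by simp
next
  fix A :: "'a set" and c :: "'a \<Rightarrow> real" assume A: "finite A"
  have "(\<lambda>n. \<Sum>x\<in>A. \<Sum>y\<in>A. c x * c y * \<kappa> n x y) \<longlonglongrightarrow> (\<Sum>x\<in>A. \<Sum>y\<in>A. c x * c y * \<eta> x y)"
    by (intro tendsto_intros lim)
  then show "0 \<le> (\<Sum>x\<in>A. \<Sum>y\<in>A. c x * c y * \<eta> x y)"
    by (rule LIMSEQ_le_const) (use psd_kernel_sum_nonneg[OF assms(1) A] in blast)
qed

text \<open>The quadratic form at \<open>c\<close> plus \<open>t\<close> times the point mass at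
  \<open>a\<close>, expanded in \<open>t\<close>. The point \<open>a\<close> may already lie in
  \<open>A\<close>, so \<open>of_bool\<close> switches the two contributions to the coefficient
  \<open>d\<close> on separately.\<close>

lemma psd_kernel_insert:
  assumes \<kappa>: "psd_kernel \<kappa>" and A: "finite A"
  shows "0 \<le> (\<Sum>x\<in>A. \<Sum>y\<in>A. c x * c y * \<kappa> x y) + 2 * t * (\<Sum>x\<in>A. c x * \<kappa> x a) + t\<^sup>2 * \<kappa> a a"
proof -
  define d where "d = (\<lambda>x. c x * of_bool (x \<in> A) + t * of_bool (x = a))"
  let ?B = "insert a A"
  have B: "finite ?B" using A by simp
  have s: "(\<Sum>x\<in>?B. d x * f x) = (\<Sum>x\<in>A. c x * f x) + t * f a" for f
  proof -
    have "(\<Sum>x\<in>?B. d x * f x) = (\<Sum>x\<in>?B. if x \<in> A then c x * f x else 0) + (\<Sum>x\<in>?B. if x = a then t * f x else 0)"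
      unfolding d_def sum.distrib[symmetric] by (intro sum.cong) (auto simp: algebra_simps)
    also have "(\<Sum>x\<in>?B. if x \<in> A then c x * f x else 0) = (\<Sum>x\<in>A. c x * f x)"
      using B by (subst sum.inter_restrict[symmetric]) (auto intro: sum.cong)
    also have "(\<Sum>x\<in>?B. if x = a then t * f x else 0) = t * f a"
      using B by (simp add: sum.delta)
    finally show ?thesis .
  qed
  have "(\<Sum>x\<in>?B. \<Sum>y\<in>?B. d x * d y * \<kappa> x y) = (\<Sum>x\<in>?B. d x * (\<Sum>y\<in>?B. d y * \<kappa> x y))"
    by (simp only: sum_distrib_left mult.assoc)
  also have "\<dots> = (\<Sum>x\<in>A. c x * ((\<Sum>y\<in>A. c y * \<kappa> x y) + t * \<kappa> x a)) + t * ((\<Sum>y\<in>A. c y * \<kappa> a y) + t * \<kappa> a a)"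
    by (simp only: s)
  also have "(\<Sum>y\<in>A. c y * \<kappa> a y) = (\<Sum>x\<in>A. c x * \<kappa> x a)"
    using psd_kernel_sym[OF \<kappa>] by metis
  also have "(\<Sum>x\<in>A. c x * ((\<Sum>y\<in>A. c y * \<kappa> x y) + t * \<kappa> x a)) =
      (\<Sum>x\<in>A. \<Sum>y\<in>A. c x * c y * \<kappa> x y) + t * (\<Sum>x\<in>A. c x * \<kappa> x a)"
    by (simp only: distrib_left sum.distrib sum_distrib_left mult.assoc mult.left_commute[of _ t])
  finally have "(\<Sum>x\<in>?B. \<Sum>y\<in>?B. d x * d y * \<kappa> x y) =
     (\<Sum>x\<in>A. \<Sum>y\<in>A. c x * c y * \<kappa> x y) + 2 * t * (\<Sum>x\<in>A. c x * \<kappa> x a) + t\<^sup>2 * \<kappa> a a"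
    by (simp only: distrib_left power2_eq_square)
  then show ?thesis
    using psd_kernel_sum_nonneg[OF \<kappa> B, of d] by simp
qed

text \<open>A polynomial in \<open>t\<close> of degree at most one that is nonnegative everywhere is
  constant.\<close>

lemma psd_kernel_zero_diag:
  assumes \<kappa>: "psd_kernel \<kappa>" and a: "\<kappa> a a = 0"
  shows "\<kappa> x a = 0"
proof (rule ccontr)
  assume nz: "\<kappa> x a \<noteq> 0"
  have *: "0 \<le> \<kappa> x x + 2 * t * \<kappa> x a" for t
    using psd_kernel_insert[OF \<kappa>, of "{x}" "\<lambda>_. 1" t a] a by simp
  \<comment> \<open>For this \<open>t\<close> the right-hand side of \<open>*\<close> equals
    \<open>-1\<close>.\<close>
  from *[of "- (\<kappa> x x + 1) / (2 * \<kappa> x a)"] nz show False by (simp add: field_simps)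
qed

text \<open>Minimising the polynomial of \<open>psd_kernel_insert\<close> over \<open>t\<close>
  gives the form of the complement; the minimum is at \<open>t = - S / \<kappa> a a\<close>.\<close>

lemma psd_kernel_Schur_complement:
  assumes \<kappa>: "psd_kernel \<kappa>" and a: "0 < \<kappa> a a"
  shows "psd_kernel (\<lambda>x y. \<kappa> x y - \<kappa> x a * \<kappa> y a / \<kappa> a a)"
proof (rule psd_kernelI)
  fix A :: "'a set" and c :: "'a \<Rightarrow> real" assume A: "finite A"
  define S where "S = (\<Sum>x\<in>A. c x * \<kappa> x a)"
  have "(\<Sum>x\<in>A. \<Sum>y\<in>A. c x * c y * (\<kappa> x a * \<kappa> y a / \<kappa> a a)) = S * S / \<kappa> a a"
    unfolding S_def sum_product sum_divide_distrib by (intro sum.cong refl) simp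
  then have "(\<Sum>x\<in>A. \<Sum>y\<in>A. c x * c y * (\<kappa> x y - \<kappa> x a * \<kappa> y a / \<kappa> a a)) =
      (\<Sum>x\<in>A. \<Sum>y\<in>A. c x * c y * \<kappa> x y) - S * S / \<kappa> a a"
    by (simp add: right_diff_distrib sum_subtractf)
  also have "\<dots> = (\<Sum>x\<in>A. \<Sum>y\<in>A. c x * c y * \<kappa> x y) + 2 * (- S / \<kappa> a a) * S + (- S / \<kappa> a a)\<^sup>2 * \<kappa> a a"
    using a by (simp add: field_simps power2_eq_square)
  also have "\<dots> \<ge> 0" unfolding S_def by (rule psd_kernel_insert[OF \<kappa> A])
  finally show "0 \<le> (\<Sum>x\<in>A. \<Sum>y\<in>A. c x * c y * (\<kappa> x y - \<kappa> x a * \<kappa> y a / \<kappa> a a))" .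
qed (simp add: psd_kernel_sym[OF \<kappa>] mult.commute)

lemma sum_sum_insert_zero:
  fixes f :: "'a \<Rightarrow> 'a \<Rightarrow> real"
  assumes "finite A" "a \<notin> A" "\<And>x. f x a = 0" "\<And>x. f a x = 0"
  shows "(\<Sum>x\<in>insert a A. \<Sum>y\<in>insert a A. f x y) = (\<Sum>x\<in>A. \<Sum>y\<in>A. f x y)"
  using assms by simp

text \<open>Gaussian elimination of one point per step takes the place of a square root of
  \<open>\<kappa>\<close>. The kernel \<open>\<kappa>\<close> is its Schur complement at
  \<open>a\<close> plus a rank-one kernel. Multiplied by \<open>\<eta>\<close>, the rank-one part
  gives, up to a positive factor, the form of \<open>\<eta>\<close> with coefficients
  \<open>c x * \<kappa> x a\<close>. The complement vanishes in row and column \<open>a\<close> and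
  falls under the induction hypothesis for \<open>A\<close>, which is why \<open>\<kappa>\<close> is
  generalised.\<close>

lemma Schur_sum_nonneg:
  assumes "finite A" "psd_kernel \<kappa>" and \<eta>: "psd_kernel \<eta>"
  shows "0 \<le> (\<Sum>x\<in>A. \<Sum>y\<in>A. c x * c y * (\<kappa> x y * \<eta> x y))"
  using assms(1,2)
proof (induction A arbitrary: \<kappa> rule: finite_induct)
  case (insert a A)
  note \<kappa> = insert.prems
  let ?B = "insert a A"
  show ?case
  proof (cases "\<kappa> a a = 0")
    case True
    then have "\<kappa> x a = 0" "\<kappa> a x = 0" for x
      using psd_kernel_zero_diag[OF \<kappa>] psd_kernel_sym[OF \<kappa>] by metis+
    then show ?thesis
      using insert.IH[OF \<kappa>] insert.hyps by simp
  next
    case False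
    then have a: "0 < \<kappa> a a" using psd_kernel_diag[OF \<kappa>, of a] by simp
    let ?k = "\<lambda>x y. \<kappa> x y - \<kappa> x a * \<kappa> y a / \<kappa> a a"
    have "(\<Sum>x\<in>?B. \<Sum>y\<in>?B. c x * c y * (?k x y * \<eta> x y)) = (\<Sum>x\<in>A. \<Sum>y\<in>A. c x * c y * (?k x y * \<eta> x y))"
      proof (rule sum_sum_insert_zero)
      show "c x * c a * (?k x a * \<eta> x a) = 0" for x using a by simp
      then show "c a * c x * (?k a x * \<eta> a x) = 0" for x
        using psd_kernel_sym[OF \<kappa>, of a x] a by simp
    qed (use insert.hyps in simp_all)
    then have 1: "0 \<le> (\<Sum>x\<in>?B. \<Sum>y\<in>?B. c x * c y * (?k x y * \<eta> x y))"
      using insert.IH[OF psd_kernel_Schur_complement[OF \<kappa> a]] by simp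
    have 2: "0 \<le> (\<Sum>x\<in>?B. \<Sum>y\<in>?B. (c x * \<kappa> x a) * (c y * \<kappa> y a) * \<eta> x y)"
      by (rule psd_kernel_sum_nonneg[OF \<eta>]) (use insert.hyps in simp)
    have "(\<Sum>x\<in>?B. \<Sum>y\<in>?B. c x * c y * (\<kappa> x y * \<eta> x y)) =
       (\<Sum>x\<in>?B. \<Sum>y\<in>?B. c x * c y * (?k x y * \<eta> x y)) +
       (\<Sum>x\<in>?B. \<Sum>y\<in>?B. (c x * \<kappa> x a) * (c y * \<kappa> y a) * \<eta> x y) / \<kappa> a a"
      unfolding sum_divide_distrib sum.distrib[symmetric]
      by (intro sum.cong refl) (use a in \<open>simp add: field_simps\<close>)
    then show ?thesis using 1 2 a by simp
  qed
qed simp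

theorem psd_kernel_mult:
  assumes "psd_kernel \<kappa>" "psd_kernel \<eta>"
  shows "psd_kernel (\<lambda>x y. \<kappa> x y * \<eta> x y)"
  proof (rule psd_kernelI)
  show "\<kappa> x y * \<eta> x y = \<kappa> y x * \<eta> y x" for x y
    using psd_kernel_sym[OF assms(1)] psd_kernel_sym[OF assms(2)] by metis
qed (use assms Schur_sum_nonneg in blast)

section \<open>Semidefinite inner products\<close>

text \<open>Scalar multiplication is constrained only through \<open>B\<close>. The module laws then
  hold modulo vectors of seminorm zero, and the completion sees nothing finer.\<close>

locale semi_inner_product =
  fixes scl :: "complex \<Rightarrow> 'v \<Rightarrow> 'v::ab_group_add" and B :: "'v \<Rightarrow> 'v \<Rightarrow> complex"
  assumes B_add_left: "B (x + y) z = B x z + B y z"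
    and B_scl_left: "B (scl c x) y = c * B x y"
    and B_commute: "B x y = cnj (B y x)"
    and B_nonneg: "0 \<le> Re (B x x)"
begin

definition N :: "'v \<Rightarrow> real" where "N x = sqrt (Re (B x x))"

lemma B_add_right: "B z (x + y) = B z x + B z y"
  by (metis B_add_left B_commute complex_cnj_add)

lemma B_scl_right: "B y (scl c x) = cnj c * B y x"
  by (metis B_scl_left B_commute complex_cnj_mult)

lemma B_zero_left [simp]: "B 0 x = 0"
  using B_add_left[of 0 0 x] by simp

lemma B_zero_right [simp]: "B x 0 = 0"
  using B_commute[of x 0] by simp

lemma B_diff_left: "B (x - y) z = B x z - B y z"
  using B_add_left[of "x - y" y z] by simp

lemma B_diff_right: "B z (x - y) = B z x - B z y"
  using B_add_right[of z "x - y" y] by simp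

lemma B_sum_left: "B (\<Sum>i\<in>A. f i) y = (\<Sum>i\<in>A. B (f i) y)"
  by (induction A rule: infinite_finite_induct) (simp_all add: B_add_left)

lemma B_sum_right: "B y (\<Sum>i\<in>A. f i) = (\<Sum>i\<in>A. B y (f i))"
  by (induction A rule: infinite_finite_induct) (simp_all add: B_add_right)

lemma N_nonneg [simp]: "0 \<le> N x" by (simp add: N_def B_nonneg)

lemma N_power2: "(N x)\<^sup>2 = Re (B x x)" by (simp add: N_def B_nonneg)

lemma B_self: "B x x = of_real ((N x)\<^sup>2)"
  using B_commute[of x x] by (auto simp: N_power2 complex_eq_iff)

lemma N_zero [simp]: "N 0 = 0" by (simp add: N_def)

lemma Re_B_commute: "Re (B x y) = Re (B y x)"
  by (metis B_commute complex_cnj(1) complex.sel(1) cnj.sel(1))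

lemma N_add_power2: "(N (x + y))\<^sup>2 = (N x)\<^sup>2 + 2 * Re (B x y) + (N y)\<^sup>2"
  using Re_B_commute[of y x] by (simp add: N_power2 B_add_left B_add_right)

lemma N_diff_power2: "(N (x - y))\<^sup>2 = (N x)\<^sup>2 - 2 * Re (B x y) + (N y)\<^sup>2"
  using Re_B_commute[of y x] by (simp add: N_power2 B_diff_left B_diff_right)

lemma N_parallelogram: "(N (x + y))\<^sup>2 + (N (x - y))\<^sup>2 = 2 * (N x)\<^sup>2 + 2 * (N y)\<^sup>2"
  by (simp add: N_add_power2 N_diff_power2)

lemma N_minus_commute: "N (x - y) = N (y - x)"
  by (simp add: N_def B_diff_left B_diff_right)

lemma N_scl: "N (scl c x) = cmod c * N x"
proof -
  have "B (scl c x) (scl c x) = (c * cnj c) * B x x" by (simp add: B_scl_left B_scl_right)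
  also have "\<dots> = of_real ((cmod c * N x)\<^sup>2)"
    by (simp only: B_self complex_norm_square[symmetric] of_real_mult[symmetric] power_mult_distrib)
  finally show ?thesis
    unfolding N_def by (simp add: real_sqrt_mult real_sqrt_abs2 B_nonneg del: of_real_power)
qed

lemma N_add_scl_power2:
  "(N (x + scl c y))\<^sup>2 = (N x)\<^sup>2 + 2 * Re (cnj c * B x y) + (cmod c)\<^sup>2 * (N y)\<^sup>2"
  by (simp add: N_add_power2 N_scl power_mult_distrib B_scl_right)

text \<open>Testing with the multiples \<open>- t * B x y\<close> of \<open>y\<close> for real
  \<open>t\<close> gives a real quadratic polynomial: the phase of \<open>B x y\<close> makes the
  cross term \<open>- 2 * t * b\<close>.\<close>

lemma Cauchy_Schwarz: "cmod (B x y) \<le> N x * N y"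
proof (rule ccontr)
  assume less: "\<not> cmod (B x y) \<le> N x * N y"
  define b where "b = (cmod (B x y))\<^sup>2"
  have bpos: "0 < b" unfolding b_def using less N_nonneg[of x] N_nonneg[of y]
    by (metis mult_nonneg_nonneg norm_zero zero_less_norm_iff zero_less_power)
  have quad: "0 \<le> (N x)\<^sup>2 - 2 * t * b + t\<^sup>2 * b * (N y)\<^sup>2" for t :: real
  proof -
    have "2 * Re (cnj (- of_real t * B x y) * B x y) = - 2 * t * b"
      unfolding b_def cmod_power2 by (simp add: power2_eq_square algebra_simps)
    moreover have "(cmod (- of_real t * B x y))\<^sup>2 = t\<^sup>2 * b"
      by (simp add: norm_mult power_mult_distrib b_def)
    ultimately show ?thesis
      using N_add_scl_power2[of x "- of_real t * B x y" y]
        zero_le_power2[of "N (x + scl (- of_real t * B x y) y)"] by simp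
  qed
  show False
  proof (cases "N y = 0")
    case True
    \<comment> \<open>The polynomial is linear in this case, and the chosen \<open>t\<close> gives
      it the value \<open>-1\<close>.\<close>
    then show False using quad[of "((N x)\<^sup>2 + 1) / (2 * b)"] bpos by simp
  next
    case False
    define n where "n = (N y)\<^sup>2"
    have n: "0 < n" using False unfolding n_def by simp
    have "b \<le> (N x)\<^sup>2 * n"
      using quad[of "1 / n", folded n_def] n by (simp add: field_simps power2_eq_square)
    then have "(cmod (B x y))\<^sup>2 \<le> (N x * N y)\<^sup>2" by (simp add: b_def n_def power_mult_distrib)
    then show False using less by (meson N_nonneg mult_nonneg_nonneg power2_le_imp_le)
  qed
qed

lemma N_triangle: "N (x + y) \<le> N x + N y"
proof (rule power2_le_imp_le)
  have "Re (B x y) \<le> N x * N y" using Cauchy_Schwarz complex_Re_le_cmod order_trans by blast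
  then show "(N (x + y))\<^sup>2 \<le> (N x + N y)\<^sup>2" by (simp add: N_add_power2 power2_sum)
qed simp

lemma N_le_diff: "N x \<le> N y + N (x - y)"
  using N_triangle[of y "x - y"] by simp

lemma B_diff_bound: "cmod (B x y - B x' y') \<le> N (x - x') * N y + N x' * N (y - y')"
proof -
  have "B x y - B x' y' = B (x - x') y + B x' (y - y')"
    by (simp add: B_diff_left B_diff_right)
  then show ?thesis
    using norm_triangle_ineq[of "B (x - x') y" "B x' (y - y')"]
      Cauchy_Schwarz[of "x - x'" y] Cauchy_Schwarz[of x' "y - y'"] by simp
qed

lemma psd_kernel_Gram: "psd_kernel (\<lambda>i j :: 'i. Re (B (w i) (w j)))"
proof (rule psd_kernelI)
  fix A :: "'i set" and c :: "'i \<Rightarrow> real" assume "finite A"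
  let ?v = "\<Sum>i\<in>A. scl (of_real (c i)) (w i)"
  have "B ?v ?v = (\<Sum>i\<in>A. \<Sum>j\<in>A. of_real (c i * c j) * B (w i) (w j))"
  proof -
    have "B (w i) ?v = (\<Sum>j\<in>A. of_real (c j) * B (w i) (w j))" for i
      by (simp add: B_sum_right B_scl_right)
    moreover have "B ?v ?v = (\<Sum>i\<in>A. of_real (c i) * B (w i) ?v)"
      by (simp only: B_sum_left B_scl_left)
    ultimately show ?thesis by (simp add: sum_distrib_left mult.assoc)
  qed
  then have "Re (B ?v ?v) = (\<Sum>i\<in>A. \<Sum>j\<in>A. c i * c j * Re (B (w i) (w j)))"
    by (simp only: Re_sum) (simp add: mult.assoc)
  then show "0 \<le> (\<Sum>i\<in>A. \<Sum>j\<in>A. c i * c j * Re (B (w i) (w j)))" using B_nonneg by metis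
qed (rule Re_B_commute)

text \<open>Cauchy sequences for the seminorm \<open>N\<close>. As \<open>N\<close> need not
  separate points, this is not phrased through a metric; null vectors are identified later, by their
  coefficients.\<close>

definition csq :: "(nat \<Rightarrow> 'v) \<Rightarrow> bool" where
  "csq s \<longleftrightarrow> (\<forall>e>0. \<exists>M. \<forall>m\<ge>M. \<forall>n\<ge>M. N (s m - s n) < e)"

lemma csqI: "(\<And>e. 0 < e \<Longrightarrow> \<exists>M. \<forall>m\<ge>M. \<forall>n\<ge>M. N (s m - s n) < e) \<Longrightarrow> csq s"
  by (simp add: csq_def)

lemma csqD: "csq s \<Longrightarrow> 0 < e \<Longrightarrow> \<exists>M. \<forall>m\<ge>M. \<forall>n\<ge>M. N (s m - s n) < e"
  by (simp add: csq_def)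

lemma csq_const: "csq (\<lambda>_. v)" by (simp add: csq_def)

lemma csq_bounded:
  assumes "csq s" obtains C where "0 < C" "\<And>n. N (s n) \<le> C"
proof -
  obtain M where M: "\<And>n. n \<ge> M \<Longrightarrow> N (s n - s M) < 1"
    using csqD[OF assms, of 1] by fastforce
  define C where "C = N (s M) + 1 + (\<Sum>i\<le>M. N (s i))"
  have S: "0 \<le> (\<Sum>i\<le>M. N (s i))" by (simp add: sum_nonneg)
  have "N (s n) \<le> C" for n
  proof (cases "n \<ge> M")
    case True
    then show ?thesis using M[OF True] N_le_diff[of "s n" "s M"] S by (simp add: C_def)
  next
    case False
    then have "N (s n) \<le> (\<Sum>i\<le>M. N (s i))" by (intro member_le_sum) auto
    then show ?thesis using N_nonneg[of "s M"] unfolding C_def by linarith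
  qed
  moreover have "0 < C" using S N_nonneg[of "s M"] unfolding C_def by linarith
  ultimately show ?thesis using that by blast
qed

lemma csq_add:
  assumes "csq s" "csq t" shows "csq (\<lambda>n. s n + t n)"
proof (rule csqI)
  fix e :: real assume "0 < e"
  then obtain M1 M2 where M: "\<And>m n. m \<ge> M1 \<Longrightarrow> n \<ge> M1 \<Longrightarrow> N (s m - s n) < e/2"
    "\<And>m n. m \<ge> M2 \<Longrightarrow> n \<ge> M2 \<Longrightarrow> N (t m - t n) < e/2"
    using csqD[OF assms(1), of "e/2"] csqD[OF assms(2), of "e/2"] half_gt_zero by meson
  have "N (s m + t m - (s n + t n)) < e" if "m \<ge> max M1 M2" "n \<ge> max M1 M2" for m n
    using M(1)[of m n] M(2)[of m n] that N_triangle[of "s m - s n" "t m - t n"]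
    by (simp add: algebra_simps)
  then show "\<exists>M. \<forall>m\<ge>M. \<forall>n\<ge>M. N (s m + t m - (s n + t n)) < e" by blast
qed

lemma csq_isometric:
  assumes "csq s" and "\<And>m n. N (t m - t n) = N (s m - s n)" shows "csq t"
  using assms by (simp add: csq_def)

text \<open>Additivity of \<open>scl c\<close> is not among the axioms, but it holds inside
  \<open>B\<close>.\<close>

lemma N_scl_diff: "N (scl c x - scl c y) = cmod c * N (x - y)"
proof -
  have "B (scl c x - scl c y) (scl c x - scl c y) = B (scl c (x - y)) (scl c (x - y))"
    by (simp add: B_diff_left B_diff_right B_scl_left B_scl_right algebra_simps)
  then have "N (scl c x - scl c y) = N (scl c (x - y))" by (simp add: N_def)
  then show ?thesis by (simp add: N_scl)
qed

lemma csq_scl: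
  assumes "csq s" shows "csq (\<lambda>n. scl c (s n))"
proof (rule csqI)
  fix e :: real assume "0 < e"
  then have "0 < e / (cmod c + 1)" by (simp add: add_nonneg_pos)
  then obtain M where M: "\<And>m n. m \<ge> M \<Longrightarrow> n \<ge> M \<Longrightarrow> N (s m - s n) < e / (cmod c + 1)"
    using csqD[OF assms] by meson
  have "N (scl c (s m) - scl c (s n)) < e" if "m \<ge> M" "n \<ge> M" for m n
  proof -
    have "cmod c * N (s m - s n) \<le> (cmod c + 1) * N (s m - s n)"
      by (simp add: mult_right_mono)
    also have "\<dots> < e"
      using M[OF that] by (simp add: pos_less_divide_eq add_nonneg_pos mult.commute)
    finally show ?thesis by (simp add: N_scl_diff)
  qed
  then show "\<exists>M. \<forall>m\<ge>M. \<forall>n\<ge>M. N (scl c (s m) - scl c (s n)) < e" by blast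
qed

lemma csq_convergent_B:
  assumes "csq s" "csq t" shows "convergent (\<lambda>n. B (s n) (t n))"
proof -
  obtain C D where C: "0 < C" "\<And>n. N (s n) \<le> C" and D: "0 < D" "\<And>n. N (t n) \<le> D"
    using csq_bounded assms by metis
  have "Cauchy (\<lambda>n. B (s n) (t n))"
  proof (rule metric_CauchyI)
    fix e :: real assume "0 < e"
    then have "0 < e / (2 * D)" "0 < e / (2 * C)" using C D by simp_all
    then obtain M1 M2 where M: "\<And>m n. m \<ge> M1 \<Longrightarrow> n \<ge> M1 \<Longrightarrow> N (s m - s n) < e / (2 * D)"
      "\<And>m n. m \<ge> M2 \<Longrightarrow> n \<ge> M2 \<Longrightarrow> N (t m - t n) < e / (2 * C)"
      using csqD[OF assms(1)] csqD[OF assms(2)] by meson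
    have "dist (B (s m) (t m)) (B (s n) (t n)) < e" if "m \<ge> max M1 M2" "n \<ge> max M1 M2" for m n
    proof -
      have "N (s m - s n) * N (t m) \<le> N (s m - s n) * D" using D by (simp add: mult_left_mono)
      also have "\<dots> < e / 2" using M(1)[of m n] that D by (simp add: field_simps)
      finally have 1: "N (s m - s n) * N (t m) < e / 2" .
      have "N (s n) * N (t m - t n) \<le> C * N (t m - t n)" using C by (simp add: mult_right_mono)
      also have "\<dots> < e / 2" using M(2)[of m n] that C by (simp add: field_simps)
      finally show ?thesis using 1 B_diff_bound[of "s m" "t m" "s n" "t n"] by (simp add: dist_norm)
    qed
    then show "\<exists>M. \<forall>m\<ge>M. \<forall>n\<ge>M. dist (B (s m) (t m)) (B (s n) (t n)) < e" by blast
  qed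
  then show ?thesis by (simp add: Cauchy_convergent_iff)
qed

text \<open>\<open>s n - t n\<close> need not equal \<open>s n + scl (-1) (t n)\<close>, but the two
  sequences have the same mutual distances.\<close>

lemma csq_diff:
  assumes "csq s" "csq t" shows "csq (\<lambda>n. s n - t n)"
proof (rule csq_isometric)
  show "csq (\<lambda>n. s n + scl (-1) (t n))" using assms csq_add csq_scl by blast
qed (simp add: N_def B_diff_left B_diff_right B_add_left B_add_right B_scl_left B_scl_right algebra_simps)

end

section \<open>Completion of a semidefinite inner product space\<close>

text \<open>
  A vector of the completion is the class of a Cauchy sequence \<open>s\<close>, encoded by its coefficients
  \<open>lim\<^sub>k B (s k) (D j)\<close> against a total family \<open>D\<close>. The algebraic operations are then pointwise,
  and the type of the completion is determined by the index type of \<open>D\<close> alone.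
\<close>

locale semi_inner_product_total = semi_inner_product scl B
  for scl :: "complex \<Rightarrow> 'v \<Rightarrow> 'v::ab_group_add" and B +
  fixes D :: "'j \<Rightarrow> 'v"
  assumes total: "csq s \<Longrightarrow> (\<And>j. (\<lambda>k. B (s k) (D j)) \<longlonglongrightarrow> 0) \<Longrightarrow> (\<lambda>k. B (s k) v) \<longlonglongrightarrow> 0"
begin

definition coeff :: "(nat \<Rightarrow> 'v) \<Rightarrow> 'j \<Rightarrow> complex" where
  "coeff s = (\<lambda>j. lim (\<lambda>k. B (s k) (D j)))"

definition BL :: "(nat \<Rightarrow> 'v) \<Rightarrow> (nat \<Rightarrow> 'v) \<Rightarrow> complex" where
  "BL s t = lim (\<lambda>k. B (s k) (t k))"

lemma BL_tendsto: "csq s \<Longrightarrow> csq t \<Longrightarrow> (\<lambda>k. B (s k) (t k)) \<longlonglongrightarrow> BL s t"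
  unfolding BL_def using csq_convergent_B convergent_LIMSEQ_iff by blast

lemma coeff_tendsto: "csq s \<Longrightarrow> (\<lambda>k. B (s k) (D j)) \<longlonglongrightarrow> coeff s j"
  using BL_tendsto[OF _ csq_const] by (simp add: coeff_def BL_def)

lemma coeff_eqI: "(\<And>j. (\<lambda>k. B (s k) (D j)) \<longlonglongrightarrow> f j) \<Longrightarrow> coeff s = f"
  unfolding coeff_def by (intro ext limI)

lemma BL_eqI: "(\<lambda>k. B (s k) (t k)) \<longlonglongrightarrow> a \<Longrightarrow> BL s t = a"
  unfolding BL_def by (rule limI)

text \<open>A weakly null Cauchy sequence is null. Fix \<open>M\<close> far out and split the second
  argument of \<open>B (s k) (s k)\<close> as \<open>s M + (s k - s M)\<close>: the first term tends
  to zero by weak convergence, the second is small by the Cauchy property and boundedness.\<close>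

lemma null_if_coeff_zero:
  assumes s: "csq s" and 0: "coeff s = (\<lambda>_. 0)"
  shows "(\<lambda>k. N (s k)) \<longlonglongrightarrow> 0"
proof (rule LIMSEQ_I)
  fix e :: real assume e: "0 < e"
  obtain C where C: "0 < C" "\<And>k. N (s k) \<le> C" using csq_bounded[OF s] by metis
  have "0 < e\<^sup>2 / (2 * C)" using e C by simp
  then obtain M where M: "\<And>m n. m \<ge> M \<Longrightarrow> n \<ge> M \<Longrightarrow> N (s m - s n) < e\<^sup>2 / (2 * C)"
    using csqD[OF s] by meson
  have "(\<lambda>k. B (s k) (s M)) \<longlonglongrightarrow> 0"
    using total[OF s] coeff_tendsto[OF s] 0 by simp
  moreover have "0 < e\<^sup>2 / 2" using e by simp
  ultimately obtain L where L: "\<And>k. k \<ge> L \<Longrightarrow> cmod (B (s k) (s M)) < e\<^sup>2 / 2"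
    unfolding LIMSEQ_iff by (metis diff_zero)
  have "norm (N (s k) - 0) < e" if k: "k \<ge> max L M" for k
  proof -
    have "(N (s k))\<^sup>2 = Re (B (s k) (s M)) + Re (B (s k) (s k - s M))"
      by (simp add: N_power2 B_diff_right)
    also have "Re (B (s k) (s M)) < e\<^sup>2 / 2"
      using L[of k] k complex_Re_le_cmod[of "B (s k) (s M)"] by linarith
    also have "Re (B (s k) (s k - s M)) \<le> N (s k) * N (s k - s M)"
      using Cauchy_Schwarz complex_Re_le_cmod order_trans by blast
    also have "\<dots> \<le> C * N (s k - s M)" using C by (simp add: mult_right_mono)
    also have "\<dots> < e\<^sup>2 / 2" using M[of k M] k C by (simp add: pos_less_divide_eq mult.commute)
    finally have "(N (s k))\<^sup>2 < e\<^sup>2" by simp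
    then show ?thesis using e by (simp add: power2_less_imp_less)
  qed
  then show "\<exists>no. \<forall>n\<ge>no. norm (N (s n) - 0) < e" by blast
qed

text \<open>This makes the coefficients a faithful name for a Cauchy sequence modulo null sequences,
  so no quotient type is needed.\<close>

lemma coeff_eq_iff:
  assumes "csq s" "csq t"
  shows "coeff s = coeff t \<longleftrightarrow> (\<lambda>k. N (s k - t k)) \<longlonglongrightarrow> 0"
proof -
  have d: "coeff (\<lambda>k. s k - t k) = (\<lambda>j. coeff s j - coeff t j)"
    by (rule coeff_eqI) (unfold B_diff_left, intro tendsto_intros coeff_tendsto assms)
  show ?thesis
  proof
    assume "coeff s = coeff t"
    then show "(\<lambda>k. N (s k - t k)) \<longlonglongrightarrow> 0"
      by (intro null_if_coeff_zero csq_diff assms) (simp add: d)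
  next
    assume *: "(\<lambda>k. N (s k - t k)) \<longlonglongrightarrow> 0"
    have "(\<lambda>k. B (s k - t k) (D j)) \<longlonglongrightarrow> 0" for j
    proof (rule Lim_null_comparison)
      show "(\<lambda>k. N (s k - t k) * N (D j)) \<longlonglongrightarrow> 0"
        using tendsto_mult_left_zero[OF *] .
    qed (simp add: Cauchy_Schwarz)
    then have "coeff (\<lambda>k. s k - t k) = (\<lambda>_. 0)" by (rule coeff_eqI)
    then show "coeff s = coeff t" unfolding d by (auto simp: fun_eq_iff)
  qed
qed

text \<open>Well-definedness of the inner product on classes: on bounded sets \<open>B\<close> is
  Lipschitz in each argument.\<close>

lemma BL_cong:
  assumes s: "csq s" "csq s'" "coeff s = coeff s'" and t: "csq t" "csq t'" "coeff t = coeff t'"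
  shows "BL s t = BL s' t'"
proof -
  obtain C where C: "0 < C" "\<And>k. N (s' k) \<le> C" using csq_bounded[OF s(2)] by metis
  obtain C' where C': "0 < C'" "\<And>k. N (t k) \<le> C'" using csq_bounded[OF t(1)] by metis
  have "(\<lambda>k. B (s k) (t k) - B (s' k) (t' k)) \<longlonglongrightarrow> 0"
  proof (rule Lim_null_comparison)
    have 1: "(\<lambda>k. N (s k - s' k)) \<longlonglongrightarrow> 0" and 2: "(\<lambda>k. N (t k - t' k)) \<longlonglongrightarrow> 0"
      using coeff_eq_iff s t by blast+
    show "(\<lambda>k. N (s k - s' k) * C' + C * N (t k - t' k)) \<longlonglongrightarrow> 0"
      using tendsto_add[OF tendsto_mult_left_zero[OF 1, of C'] tendsto_mult_right_zero[OF 2, of C]] by simp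
    have "cmod (B (s k) (t k) - B (s' k) (t' k)) \<le> N (s k - s' k) * C' + C * N (t k - t' k)" for k
      using B_diff_bound[of "s k" "t k" "s' k" "t' k"] C C'
        mult_left_mono[OF C'(2), of "N (s k - s' k)" k] mult_right_mono[OF C(2), of "N (t k - t' k)" k]
      by (smt (verit) N_nonneg)
    then show "\<forall>\<^sub>F k in sequentially. norm (B (s k) (t k) - B (s' k) (t' k)) \<le> N (s k - s' k) * C' + C * N (t k - t' k)"
      by simp
  qed
  moreover have "(\<lambda>k. B (s k) (t k) - B (s' k) (t' k)) \<longlonglongrightarrow> BL s t - BL s' t'"
    by (intro tendsto_intros BL_tendsto s t)
  ultimately show ?thesis using LIMSEQ_unique by fastforce
qed

definition E :: "('j \<Rightarrow> complex) set" where "E = coeff ` {s. csq s}"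

definition rep :: "('j \<Rightarrow> complex) \<Rightarrow> nat \<Rightarrow> 'v" where
  "rep f = (SOME s. csq s \<and> coeff s = f)"

text \<open>\<open>mult\<close> and \<open>one\<close> are fillers: the record of modules extends
  that of rings, whereas a module structure uses only the additive part.\<close>

definition completion :: "('j \<Rightarrow> complex) inner_module" where
  "completion = \<lparr>carrier = E, mult = (\<lambda>f g. f), one = (\<lambda>_. 0), ring.zero = (\<lambda>_. 0),
     add = (\<lambda>f g j. f j + g j), smult = (\<lambda>c f j. c * f j),
     cinner = (\<lambda>f g. BL (rep f) (rep g))\<rparr>"

lemma completion_simps [simp]:
  "carrier completion = E" "ring.zero completion = (\<lambda>_. 0)" "add completion f g = (\<lambda>j. f j + g j)"
  "smult completion c f = (\<lambda>j. c * f j)" "cinner completion f g = BL (rep f) (rep g)"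
  by (simp_all add: completion_def)

lemma coeff_in_E [intro]: "csq s \<Longrightarrow> coeff s \<in> E" by (simp add: E_def)

lemma E_cases: assumes "f \<in> E" obtains s where "csq s" "f = coeff s"
  using assms by (auto simp: E_def)

lemma rep: assumes "f \<in> E" shows "csq (rep f)" "coeff (rep f) = f"
proof -
  have "\<exists>s. csq s \<and> coeff s = f" using assms by (auto simp: E_def)
  then have "csq (rep f) \<and> coeff (rep f) = f" unfolding rep_def by (rule someI_ex)
  then show "csq (rep f)" "coeff (rep f) = f" by auto
qed

lemma BL_rep: "csq s \<Longrightarrow> csq t \<Longrightarrow> BL (rep (coeff s)) (rep (coeff t)) = BL s t"
  by (rule BL_cong) (auto simp: rep coeff_in_E)

lemma coeff_add: "csq s \<Longrightarrow> csq t \<Longrightarrow> coeff (\<lambda>k. s k + t k) = (\<lambda>j. coeff s j + coeff t j)"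
  by (rule coeff_eqI) (unfold B_add_left, intro tendsto_intros coeff_tendsto)

lemma coeff_scl: "csq s \<Longrightarrow> coeff (\<lambda>k. scl c (s k)) = (\<lambda>j. c * coeff s j)"
  by (rule coeff_eqI) (unfold B_scl_left, intro tendsto_intros coeff_tendsto)

lemma coeff_zero: "coeff (\<lambda>_. 0) = (\<lambda>_. 0)"
  by (rule coeff_eqI) simp

lemma zero_in_E: "(\<lambda>_. 0) \<in> E" using coeff_in_E[OF csq_const[of 0]] by (simp add: coeff_zero)

lemma add_in_E: "f \<in> E \<Longrightarrow> g \<in> E \<Longrightarrow> (\<lambda>j. f j + g j) \<in> E"
  using coeff_add[of "rep f" "rep g"] coeff_in_E[OF csq_add[of "rep f" "rep g"]] rep[of f] rep[of g] by simp

lemma scl_in_E: "f \<in> E \<Longrightarrow> (\<lambda>j. c * f j) \<in> E"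
  using coeff_scl[of "rep f" c] coeff_in_E[OF csq_scl[of "rep f" c]] rep[of f] by simp

lemma module_completion: "module (ring_of_type_algebra :: complex ring) completion"
proof (rule moduleI)
  show "cring (ring_of_type_algebra :: complex ring)" by (rule cring_from_type_algebra)
next
  show "abelian_group completion"
  proof (rule abelian_groupI)
    fix f assume "f \<in> carrier completion"
    then have "(\<lambda>j. - 1 * f j) \<in> carrier completion" using scl_in_E[of f "-1"] by simp
    moreover have "add completion (\<lambda>j. - 1 * f j) f = ring.zero completion" by simp
    ultimately show "\<exists>g\<in>carrier completion. add completion g f = ring.zero completion" by blast
  qed (auto simp: zero_in_E add_in_E add.assoc add.commute)
qed (auto simp: ring_of_type_algebra_def scl_in_E algebra_simps)

sublocale completion: complex_inner_space completion
proof (intro complex_inner_space.intro module_completion complex_inner_space_axioms.intro)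
  fix f g h assume "f \<in> carrier completion" "g \<in> carrier completion" "h \<in> carrier completion"
  then obtain r s t where "csq r" "csq s" "csq t" "f = coeff r" "g = coeff s" "h = coeff t"
    by (metis E_cases completion_simps(1))
  then show "cinner completion (f \<oplus>\<^bsub>completion\<^esub> g) h = cinner completion f h + cinner completion g h"
    using tendsto_add[OF BL_tendsto[of r t] BL_tendsto[of s t]]
    by (simp add: coeff_add[symmetric] BL_rep csq_add BL_eqI B_add_left)
next
  fix c f g assume "f \<in> carrier completion" "g \<in> carrier completion"
  then obtain s t where "csq s" "csq t" "f = coeff s" "g = coeff t"
    by (metis E_cases completion_simps(1))
  then show "cinner completion (c \<odot>\<^bsub>completion\<^esub> f) g = c * cinner completion f g"
    using tendsto_mult_left[OF BL_tendsto[of s t], of c]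
    by (simp add: coeff_scl[symmetric] BL_rep csq_scl BL_eqI B_scl_left)
next
  fix f g assume "f \<in> carrier completion" "g \<in> carrier completion"
  then have "(\<lambda>k. B (rep f k) (rep g k)) \<longlonglongrightarrow> cnj (BL (rep g) (rep f))"
    using tendsto_cnj[OF BL_tendsto[of "rep g" "rep f"]] rep by (simp add: B_commute[symmetric])
  then show "cinner completion f g = cnj (cinner completion g f)" by (simp add: BL_eqI)
next
  fix f assume "f \<in> carrier completion"
  then have f: "f \<in> E" by simp
  have lim: "(\<lambda>k. Re (B (rep f k) (rep f k))) \<longlonglongrightarrow> Re (BL (rep f) (rep f))"
    by (intro tendsto_intros BL_tendsto rep f)
  then show "0 \<le> Re (cinner completion f f)"
    using LIMSEQ_le_const[OF lim, of 0] B_nonneg by simp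
  assume "cinner completion f f = 0"
  then have "(\<lambda>k. N (rep f k - 0)) \<longlonglongrightarrow> 0"
    using tendsto_real_sqrt[OF lim] by (simp add: N_def)
  then have "coeff (rep f) = coeff (\<lambda>_. 0)"
    using coeff_eq_iff[OF rep(1)[OF f] csq_const[of 0]] by simp
  then show "f = \<zero>\<^bsub>completion\<^esub>" using rep f by (simp add: coeff_zero)
qed

text \<open>Subtraction in \<open>completion\<close> goes through the inverse of an abstract
  additive group, for which the record has no formula; the difference is identified by adding
  \<open>coeff t\<close> back.\<close>

lemma coeff_diff: "csq s \<Longrightarrow> csq t \<Longrightarrow> coeff s \<ominus>\<^bsub>completion\<^esub> coeff t = coeff (\<lambda>k. s k - t k)"
proof -
  assume s: "csq s" and t: "csq t"
  let ?d = "coeff (\<lambda>k. s k - t k)"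
  have c: "?d \<in> carrier completion" "coeff t \<in> carrier completion"
    using s t csq_diff by auto
  have "coeff s = ?d \<oplus>\<^bsub>completion\<^esub> coeff t"
    using coeff_add[OF csq_diff[OF s t] t] by simp
  then have "coeff s \<ominus>\<^bsub>completion\<^esub> coeff t =
      ?d \<oplus>\<^bsub>completion\<^esub> coeff t \<oplus>\<^bsub>completion\<^esub> \<ominus>\<^bsub>completion\<^esub> coeff t"
    by (simp only: completion.M.minus_eq)
  also have "\<dots> = ?d \<oplus>\<^bsub>completion\<^esub> (coeff t \<oplus>\<^bsub>completion\<^esub> \<ominus>\<^bsub>completion\<^esub> coeff t)"
    using c by (intro completion.M.a_assoc completion.M.a_inv_closed)
  also have "coeff t \<oplus>\<^bsub>completion\<^esub> \<ominus>\<^bsub>completion\<^esub> coeff t = \<zero>\<^bsub>completion\<^esub>"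
    by (rule completion.M.r_neg) (use t in auto)
  finally show ?thesis by simp
qed

text \<open>Distance estimates in the completion are pulled back to the seminorm through this
  limit.\<close>

lemma hdist_tendsto:
  assumes s: "csq s" and t: "csq t"
  shows "(\<lambda>k. N (s k - t k)) \<longlonglongrightarrow> hdist completion (coeff s) (coeff t)"
proof -
  have "csq (\<lambda>k. s k - t k)" using s t by (rule csq_diff)
  then have "(\<lambda>k. N (s k - t k)) \<longlonglongrightarrow> sqrt (Re (BL (\<lambda>k. s k - t k) (\<lambda>k. s k - t k)))"
    unfolding N_def by (intro tendsto_intros BL_tendsto)
  then show ?thesis
    using s t by (simp add: hdist_def hnorm_def coeff_diff BL_rep csq_diff coeff_in_E)
qed

abbreviation emb :: "'v \<Rightarrow> 'j \<Rightarrow> complex" where "emb v \<equiv> coeff (\<lambda>_. v)"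

lemma hdist_emb: "hdist completion (emb u) (emb v) = N (u - v)"
  using LIMSEQ_unique[OF hdist_tendsto[OF csq_const csq_const]] tendsto_const by metis

lemma hdist_emb_le:
  assumes s: "csq s" and "\<And>k. k \<ge> M \<Longrightarrow> N (s k - v) \<le> e"
  shows "hdist completion (coeff s) (emb v) \<le> e"
  using LIMSEQ_le_const2[OF hdist_tendsto[OF s csq_const]] assms(2) by blast

lemma emb_dense:
  assumes f: "f \<in> E" and e: "0 < e"
  obtains v where "hdist completion f (emb v) < e"
proof -
  obtain s where s: "csq s" "f = coeff s" using E_cases[OF f] .
  obtain M where "\<And>k. k \<ge> M \<Longrightarrow> N (s k - s M) < e / 2"
    using csqD[OF s(1), of "e/2"] e by fastforce
  then have "hdist completion (coeff s) (emb (s M)) \<le> e / 2"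
    using hdist_emb_le[OF s(1), of M] less_imp_le by metis
  then show ?thesis using that[of "s M"] e s by simp
qed

text \<open>Approximate the \<open>n\<close>-th class \<open>\<sigma> n\<close> by the image of a
  vector \<open>v n\<close> to within \<open>1 / real (Suc n)\<close>. Then \<open>v\<close> is
  itself a Cauchy sequence of vectors, and its class is the limit of
  \<open>\<sigma>\<close>.\<close>

lemma complex_hilbert_space_completion: "complex_hilbert_space completion"
proof
  show "completion.mcomplete"
    unfolding completion.mcomplete_def
  proof (intro allI impI)
    fix \<sigma> assume "completion.MCauchy \<sigma>"
    then have \<sigma>: "\<And>n. \<sigma> n \<in> E" and
      Cau: "\<And>e. 0 < e \<Longrightarrow> \<exists>M. \<forall>m n. M \<le> m \<longrightarrow> M \<le> n \<longrightarrow> hdist completion (\<sigma> m) (\<sigma> n) < e"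
      unfolding completion.MCauchy_def by auto
    have "\<exists>v. hdist completion (\<sigma> n) (emb v) < 1 / real (Suc n)" for n
      by (rule emb_dense[OF \<sigma>[of n], of "1 / real (Suc n)"]) auto
    then obtain v where v: "\<And>n. hdist completion (\<sigma> n) (emb (v n)) < 1 / real (Suc n)" by metis
    have embE: "emb u \<in> carrier completion" for u by (simp add: coeff_in_E csq_const)
    have v_small: "\<exists>M. \<forall>n\<ge>M. hdist completion (\<sigma> n) (emb (v n)) < e" if "0 < e" for e
    proof -
      obtain M where M: "1 / real (Suc M) < e" using \<open>0 < e\<close> nat_approx_posE by blast
      have "hdist completion (\<sigma> n) (emb (v n)) < e" if "n \<ge> M" for n
      proof -
        have "1 / real (Suc n) \<le> 1 / real (Suc M)" using that by (simp add: frac_le)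
        then show ?thesis using v[of n] M by linarith
      qed
      then show ?thesis by blast
    qed
    have "csq v"
    proof (rule csqI)
      fix e :: real assume "0 < e"
      then have e3: "0 < e / 3" by simp
      obtain M1 where M1: "\<And>m n. M1 \<le> m \<Longrightarrow> M1 \<le> n \<Longrightarrow> hdist completion (\<sigma> m) (\<sigma> n) < e / 3"
        using Cau[OF e3] by blast
      obtain M2 where M2: "\<And>n. M2 \<le> n \<Longrightarrow> hdist completion (\<sigma> n) (emb (v n)) < e / 3"
        using v_small[OF e3] by blast
      have "N (v m - v n) < e" if "m \<ge> max M1 M2" "n \<ge> max M1 M2" for m n
      proof -
        have "hdist completion (emb (v m)) (emb (v n)) \<le>
            hdist completion (emb (v m)) (\<sigma> m) + hdist completion (\<sigma> m) (emb (v n))"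
          using completion.triangle embE \<sigma> by simp
        moreover have "hdist completion (\<sigma> m) (emb (v n)) \<le>
            hdist completion (\<sigma> m) (\<sigma> n) + hdist completion (\<sigma> n) (emb (v n))"
          using completion.triangle embE \<sigma> by simp
        ultimately show ?thesis
          using M1[of m n] M2[of m] M2[of n] that completion.commute[of "emb (v m)" "\<sigma> m"]
          by (simp add: hdist_emb)
      qed
      then show "\<exists>M. \<forall>m\<ge>M. \<forall>n\<ge>M. N (v m - v n) < e" by blast
    qed
    have "limitin completion.mtopology \<sigma> (coeff v) sequentially"
      unfolding completion.limit_metric_sequentially
    proof (intro conjI allI impI)
      show "coeff v \<in> carrier completion" using \<open>csq v\<close> by auto
      fix e :: real assume "0 < e"
      then have e3: "0 < e / 3" by simp
      obtain M1 where M1: "\<And>m n. M1 \<le> m \<Longrightarrow> M1 \<le> n \<Longrightarrow> N (v m - v n) < e / 3"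
        using csqD[OF \<open>csq v\<close> e3] by blast
      obtain M2 where M2: "\<And>n. M2 \<le> n \<Longrightarrow> hdist completion (\<sigma> n) (emb (v n)) < e / 3"
        using v_small[OF e3] by blast
      have "\<sigma> n \<in> carrier completion \<and> hdist completion (\<sigma> n) (coeff v) < e" if n: "n \<ge> max M1 M2" for n
      proof -
        have "hdist completion (coeff v) (emb (v n)) \<le> e / 3"
          using M1 n by (intro hdist_emb_le[OF \<open>csq v\<close>, of M1]) (simp add: less_imp_le)
        moreover have "hdist completion (\<sigma> n) (coeff v) \<le>
            hdist completion (\<sigma> n) (emb (v n)) + hdist completion (emb (v n)) (coeff v)"
          using completion.triangle[of "\<sigma> n" "emb (v n)" "coeff v"] embE \<sigma> coeff_in_E[OF \<open>csq v\<close>]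
          by simp
        ultimately show ?thesis
          using M2[of n] n \<sigma> completion.commute[of "emb (v n)" "coeff v"] \<open>0 < e\<close> by simp
      qed
      then show "\<exists>M. \<forall>n\<ge>M. \<sigma> n \<in> carrier completion \<and> hdist completion (\<sigma> n) (coeff v) < e" by blast
    qed
    then show "\<exists>x. limitin completion.mtopology \<sigma> x sequentially" by blast
  qed
qed

end

section \<open>Unitary groups\<close>

lemma unitary_ops_Bij: "U \<in> unitary_ops H \<Longrightarrow> U \<in> Bij (carrier H)"
  by (simp add: unitary_ops_def)

lemma unitary_ops_closed: "U \<in> unitary_ops H \<Longrightarrow> x \<in> carrier H \<Longrightarrow> U x \<in> carrier H"
  using Bij_imp_funcset unitary_ops_Bij by blast

lemma unitary_opsI:
  assumes "U \<in> Bij (carrier H)"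
    and "\<And>x y. x \<in> carrier H \<Longrightarrow> y \<in> carrier H \<Longrightarrow> U (x \<oplus>\<^bsub>H\<^esub> y) = U x \<oplus>\<^bsub>H\<^esub> U y"
    and "\<And>c x. x \<in> carrier H \<Longrightarrow> U (c \<odot>\<^bsub>H\<^esub> x) = c \<odot>\<^bsub>H\<^esub> U x"
    and "\<And>x y. x \<in> carrier H \<Longrightarrow> y \<in> carrier H \<Longrightarrow> cinner H (U x) (U y) = cinner H x y"
  shows "U \<in> unitary_ops H"
  using assms by (simp add: unitary_ops_def)

lemma unitary_ops_add:
  "U \<in> unitary_ops H \<Longrightarrow> x \<in> carrier H \<Longrightarrow> y \<in> carrier H \<Longrightarrow> U (x \<oplus>\<^bsub>H\<^esub> y) = U x \<oplus>\<^bsub>H\<^esub> U y"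
  by (simp add: unitary_ops_def)

lemma unitary_ops_smult:
  "U \<in> unitary_ops H \<Longrightarrow> x \<in> carrier H \<Longrightarrow> U (c \<odot>\<^bsub>H\<^esub> x) = c \<odot>\<^bsub>H\<^esub> U x"
  by (simp add: unitary_ops_def)

lemma unitary_ops_cinner:
  "U \<in> unitary_ops H \<Longrightarrow> x \<in> carrier H \<Longrightarrow> y \<in> carrier H \<Longrightarrow> cinner H (U x) (U y) = cinner H x y"
  by (simp add: unitary_ops_def)

lemma unitary_group_carrier [simp]: "carrier (unitary_group H) = unitary_ops H"
  by (simp add: unitary_group_def)

lemma unitary_group_mult:
  "U \<in> unitary_ops H \<Longrightarrow> V \<in> unitary_ops H \<Longrightarrow> U \<otimes>\<^bsub>unitary_group H\<^esub> V = compose (carrier H) U V"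
  by (simp add: unitary_group_def BijGroup_def unitary_ops_Bij)

lemma (in complex_inner_space) subgroup_unitary_ops: "subgroup (unitary_ops H) (BijGroup (carrier H))"
proof (rule group.subgroupI[OF group_BijGroup])
  show "unitary_ops H \<subseteq> carrier (BijGroup (carrier H))"
    by (auto simp: BijGroup_def unitary_ops_Bij)
  have "(\<lambda>x\<in>carrier H. x) \<in> unitary_ops H"
    by (rule unitary_opsI) (auto simp: id_Bij smult_in_carrier)
  then show "unitary_ops H \<noteq> {}" by blast
next
  fix U assume U: "U \<in> unitary_ops H"
  define V where "V = (\<lambda>x\<in>carrier H. inv_into (carrier H) U x)"
  have bij: "bij_betw U (carrier H) (carrier H)"
    using unitary_ops_Bij[OF U] by (simp add: Bij_def)
  have V: "V x \<in> carrier H" "U (V x) = x" if "x \<in> carrier H" for x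
    using that bij by (auto simp: V_def bij_betw_def inv_into_into f_inv_into_f)
  have VU: "V (U x) = x" if "x \<in> carrier H" for x
    using that bij unitary_ops_closed[OF U that] by (simp add: V_def bij_betw_def)
  have "V \<in> unitary_ops H"
  proof (rule unitary_opsI)
    show "V \<in> Bij (carrier H)" unfolding V_def using unitary_ops_Bij[OF U] by (rule restrict_inv_into_Bij)
  next
    fix x y assume x: "x \<in> carrier H" and y: "y \<in> carrier H"
    have "U (V x \<oplus> V y) = x \<oplus> y" using unitary_ops_add[OF U] V x y by simp
    then show "V (x \<oplus> y) = V x \<oplus> V y" using VU[of "V x \<oplus> V y"] V x y by simp
    show "cinner H (V x) (V y) = cinner H x y"
      using unitary_ops_cinner[OF U, of "V x" "V y"] V x y by simp
  next
    fix c x assume x: "x \<in> carrier H"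
    have "U (c \<odot> V x) = c \<odot> x" using unitary_ops_smult[OF U] V x by simp
    then show "V (c \<odot> x) = c \<odot> V x" using VU[of "c \<odot> V x"] V x by (simp add: smult_in_carrier)
  qed
  then show "inv\<^bsub>BijGroup (carrier H)\<^esub> U \<in> unitary_ops H"
    using inv_BijGroup[OF unitary_ops_Bij[OF U]] by (simp add: V_def)
next
  fix U V assume U: "U \<in> unitary_ops H" and V: "V \<in> unitary_ops H"
  have "compose (carrier H) U V \<in> unitary_ops H"
  proof (rule unitary_opsI)
    show "compose (carrier H) U V \<in> Bij (carrier H)"
      using U V by (simp add: compose_Bij unitary_ops_Bij)
  qed (use U V in \<open>simp_all add: compose_eq unitary_ops_closed unitary_ops_add unitary_ops_smult
        unitary_ops_cinner smult_in_carrier\<close>)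
  then show "U \<otimes>\<^bsub>BijGroup (carrier H)\<^esub> V \<in> unitary_ops H"
    using U V by (simp add: BijGroup_def unitary_ops_Bij)
qed

lemma (in complex_inner_space) group_unitary_group: "group (unitary_group H)"
  unfolding unitary_group_def
  using subgroup.subgroup_is_group[OF subgroup_unitary_ops group_BijGroup] .

text \<open>The product topology lives on extensional functions; unitary operators are extensional,
  so only the pointwise conditions remain.\<close>

lemma continuous_map_strong_operator_topology:
  assumes "complex_inner_space H" and f: "f ` topspace Z \<subseteq> unitary_ops H"
  shows "continuous_map Z (strong_operator_topology H) f \<longleftrightarrow>
     (\<forall>x\<in>carrier H. continuous_map Z (Metric_space.mtopology (carrier H) (hdist H)) (\<lambda>p. f p x))"
proof -
  have "f ` topspace Z \<subseteq> extensional (carrier H)"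
    using f unitary_ops_Bij Bij_imp_extensional by blast
  then show ?thesis
    using f by (auto simp: strong_operator_topology_def continuous_map_in_subtopology
        continuous_map_componentwise image_subset_iff Pi_iff)
qed

lemma topspace_strong_operator_topology [simp]:
  assumes "complex_inner_space H"
  shows "topspace (strong_operator_topology H) = unitary_ops H"
proof -
  interpret complex_inner_space H by fact
  have "unitary_ops H \<subseteq> PiE (carrier H) (\<lambda>_. carrier H)"
    by (auto simp: PiE_iff unitary_ops_closed
        intro: extensional_arb[OF Bij_imp_extensional[OF unitary_ops_Bij]])
  then show ?thesis by (auto simp: strong_operator_topology_def)
qed

lemma continuous_map_strong_operator_eval:
  assumes "complex_inner_space H" "x \<in> carrier H"
  shows "continuous_map (strong_operator_topology H) (Metric_space.mtopology (carrier H) (hdist H)) (\<lambda>U. U x)"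
  unfolding strong_operator_topology_def
  by (intro continuous_map_from_subtopology continuous_map_product_projection assms)

lemma openin_strong_operator_topologyD:
  assumes H: "complex_inner_space H" and W: "openin (strong_operator_topology H) W" and U: "U \<in> W"
  obtains F e where "finite F" "F \<subseteq> carrier H" "0 < e"
    "\<And>V. V \<in> unitary_ops H \<Longrightarrow> (\<And>x. x \<in> F \<Longrightarrow> hdist H (U x) (V x) < e) \<Longrightarrow> V \<in> W"
proof -
  interpret complex_inner_space H by fact
  obtain W' where W': "openin (product_topology (\<lambda>_. mtopology) (carrier H)) W'"
    and WW': "W = W' \<inter> unitary_ops H"
    using W by (auto simp: strong_operator_topology_def openin_subtopology)
  have "U \<in> W'" using U WW' by auto
  obtain O' where fin: "finite {x \<in> carrier H. O' x \<noteq> topspace mtopology}"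
    and op: "\<And>x. x \<in> carrier H \<Longrightarrow> openin mtopology (O' x)"
    and UO: "U \<in> PiE (carrier H) O'" and sub: "PiE (carrier H) O' \<subseteq> W'"
    using W' \<open>U \<in> W'\<close> unfolding openin_product_topology_alt by meson
  define F where "F = {x \<in> carrier H. O' x \<noteq> carrier H}"
  have F: "finite F" "F \<subseteq> carrier H" using fin by (auto simp: F_def)
  have "\<exists>e>0. mball (U x) e \<subseteq> O' x" if "x \<in> F" for x
    using op[of x] UO that F unfolding openin_mtopology by (auto simp: PiE_iff)
  then obtain r where r: "\<And>x. x \<in> F \<Longrightarrow> 0 < r x \<and> mball (U x) (r x) \<subseteq> O' x" by metis
  \<comment> \<open>The element \<open>1\<close> keeps the set nonempty when \<open>F\<close> is
    empty.\<close>
  define e where "e = Min (insert 1 (r ` F))"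
  have e: "0 < e" "\<And>x. x \<in> F \<Longrightarrow> e \<le> r x"
    using F r by (auto simp: e_def)
  have "V \<in> W" if V: "V \<in> unitary_ops H" and near: "\<And>x. x \<in> F \<Longrightarrow> hdist H (U x) (V x) < e" for V
  proof -
    have "V x \<in> O' x" if x: "x \<in> carrier H" for x
    proof (cases "x \<in> F")
      case True
      then have "V x \<in> mball (U x) (r x)"
        using near[OF True] e(2)[OF True] UO x unitary_ops_closed[OF V x] U WW' unitary_ops_closed[of U H x]
        by simp
      then show ?thesis using r[OF True] by blast
    next
      case False
      then show ?thesis using x unitary_ops_closed[OF V x] by (simp add: F_def)
    qed
    then have "V \<in> PiE (carrier H) O'"
      using Bij_imp_extensional[OF unitary_ops_Bij[OF V]] by (simp add: PiE_iff)
    then show ?thesis using sub V WW' by blast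
  qed
  then show ?thesis using that F e by blast
qed


section \<open>Unitary operators on a completion\<close>

context semi_inner_product_total
begin

definition isometric_op :: "('v \<Rightarrow> 'v) \<Rightarrow> bool" where
  "isometric_op R \<longleftrightarrow> (\<forall>x y. R (x + y) = R x + R y) \<and> (\<forall>c x. R (scl c x) = scl c (R x)) \<and>
     (\<forall>x y. B (R x) (R y) = B x y)"

text \<open>\<open>R\<close> is applied to a chosen representative; \<open>lift_coeff\<close> shows
  that the choice is immaterial. The restriction to \<open>E\<close> makes the operator extensional,
  as \<open>Bij\<close> requires.\<close>

definition lift :: "('v \<Rightarrow> 'v) \<Rightarrow> ('j \<Rightarrow> complex) \<Rightarrow> 'j \<Rightarrow> complex" where
  "lift R = (\<lambda>f\<in>E. coeff (\<lambda>k. R (rep f k)))"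

lemma isometric_op_N: "isometric_op R \<Longrightarrow> N (R x - R y) = N (x - y)"
  by (simp add: isometric_op_def N_def B_diff_left B_diff_right)

lemma csq_isometric_op: "isometric_op R \<Longrightarrow> csq s \<Longrightarrow> csq (\<lambda>k. R (s k))"
  by (erule csq_isometric) (simp add: isometric_op_N)

lemma lift_coeff:
  assumes R: "isometric_op R" and s: "csq s"
  shows "lift R (coeff s) = coeff (\<lambda>k. R (s k))"
proof -
  have r: "csq (rep (coeff s))" "coeff (rep (coeff s)) = coeff s" using rep coeff_in_E[OF s] by auto
  then have "coeff (\<lambda>k. R (rep (coeff s) k)) = coeff (\<lambda>k. R (s k))"
    using coeff_eq_iff[OF r(1) s] by (simp add: coeff_eq_iff csq_isometric_op R s isometric_op_N)
  then show ?thesis using s by (simp add: lift_def coeff_in_E)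
qed

lemma lift_in_E: "isometric_op R \<Longrightarrow> f \<in> E \<Longrightarrow> lift R f \<in> E"
  by (simp add: lift_def coeff_in_E csq_isometric_op rep)

lemma lift_compose:
  assumes "isometric_op R" "isometric_op R'"
  shows "lift (R \<circ> R') = compose E (lift R) (lift R')"
proof
  fix f show "lift (R \<circ> R') f = compose E (lift R) (lift R') f"
  proof (cases "f \<in> E")
    case True
    have 1: "lift R' f = coeff (\<lambda>k. R' (rep f k))" using True by (simp add: lift_def)
    have "lift R (lift R' f) = coeff (\<lambda>k. R (R' (rep f k)))"
      unfolding 1 by (rule lift_coeff[OF assms(1) csq_isometric_op[OF assms(2) rep(1)[OF True]]])
    moreover have "lift (R \<circ> R') f = coeff (\<lambda>k. R (R' (rep f k)))" using True by (simp add: lift_def)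
    ultimately show ?thesis using True by (simp add: compose_eq)
  qed (simp add: compose_def lift_def)
qed

lemma lift_id: "lift id f = (\<lambda>f\<in>E. f) f"
  by (simp add: lift_def rep)

lemma lift_unitary:
  assumes R: "isometric_op R" and R': "isometric_op R'" and "R \<circ> R' = id" "R' \<circ> R = id"
  shows "lift R \<in> unitary_ops completion"
proof (rule unitary_opsI)
  have "lift R (lift R' f) = f" "lift R' (lift R f) = f" if "f \<in> E" for f
    using fun_cong[OF lift_compose[OF R R'], of f] fun_cong[OF lift_compose[OF R' R], of f] that
    by (simp_all add: assms(3,4) lift_id compose_eq)
  then have "bij_betw (lift R) E E"
    using lift_in_E[OF R] lift_in_E[OF R'] by (intro bij_betw_byWitness[where f' = "lift R'"]) auto
  then show "lift R \<in> Bij (carrier completion)" by (simp add: Bij_def lift_def)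
next
  fix f g assume "f \<in> carrier completion" "g \<in> carrier completion"
  then obtain s t where *: "csq s" "csq t" "f = coeff s" "g = coeff t"
    by (metis E_cases completion_simps(1))
  have "(\<lambda>k. R (s k + t k)) = (\<lambda>k. R (s k) + R (t k))" using R by (simp add: isometric_op_def)
  then show "lift R (f \<oplus>\<^bsub>completion\<^esub> g) = lift R f \<oplus>\<^bsub>completion\<^esub> lift R g"
    using * R by (simp add: coeff_add[symmetric] lift_coeff csq_add csq_isometric_op)
  show "cinner completion (lift R f) (lift R g) = cinner completion f g"
    using * R by (simp add: lift_coeff BL_rep csq_isometric_op) (simp add: BL_def isometric_op_def)
next
  fix c f assume "f \<in> carrier completion"
  then obtain s where *: "csq s" "f = coeff s"
    by (metis E_cases completion_simps(1))
  have "(\<lambda>k. R (scl c (s k))) = (\<lambda>k. scl c (R (s k)))" using R by (simp add: isometric_op_def)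
  then show "lift R (c \<odot>\<^bsub>completion\<^esub> f) = c \<odot>\<^bsub>completion\<^esub> lift R f"
    using * R by (simp add: coeff_scl[symmetric] lift_coeff csq_scl csq_isometric_op)
qed

text \<open>An isometric operator need not be onto; here \<open>R (inv p)\<close> provides the
  two-sided inverse of \<open>R p\<close>.\<close>

lemma lift_hom:
  assumes "group G" and iso: "\<And>p. p \<in> carrier G \<Longrightarrow> isometric_op (R p)"
    and mult: "\<And>p q. p \<in> carrier G \<Longrightarrow> q \<in> carrier G \<Longrightarrow> R (p \<otimes>\<^bsub>G\<^esub> q) = R p \<circ> R q"
    and one: "R \<one>\<^bsub>G\<^esub> = id"
  shows "(\<lambda>p. lift (R p)) \<in> hom G (unitary_group completion)"
proof (rule homI)
  interpret group G by fact
  have U: "lift (R p) \<in> unitary_ops completion" if p: "p \<in> carrier G" for p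
    using p iso mult[of p "inv\<^bsub>G\<^esub> p"] mult[of "inv\<^bsub>G\<^esub> p" p] one
    by (intro lift_unitary[of _ "R (inv\<^bsub>G\<^esub> p)"]) auto
  then show "lift (R p) \<in> carrier (unitary_group completion)" if "p \<in> carrier G" for p
    using that by simp
  show "lift (R (p \<otimes>\<^bsub>G\<^esub> q)) = lift (R p) \<otimes>\<^bsub>unitary_group completion\<^esub> lift (R q)"
    if "p \<in> carrier G" "q \<in> carrier G" for p q
    using that by (simp add: U unitary_group_mult mult lift_compose iso)
qed

lemma lift_emb: "isometric_op R \<Longrightarrow> lift R (emb v) = emb (R v)"
  using lift_coeff[OF _ csq_const] .

text \<open>An \<open>e/3\<close> argument. All \<open>lift (R q)\<close> are isometric, so a single
  vector \<open>v\<close> whose image is close to \<open>f\<close> serves every \<open>q\<close> at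
  once, and continuity of the orbits needs checking only on vectors before completion.\<close>

lemma continuous_map_lift:
  assumes iso: "\<And>p. p \<in> topspace Z \<Longrightarrow> isometric_op (R p)"
    and U: "\<And>p. p \<in> topspace Z \<Longrightarrow> lift (R p) \<in> unitary_ops completion"
    and cont: "\<And>p v e. p \<in> topspace Z \<Longrightarrow> 0 < e \<Longrightarrow>
        \<exists>W. openin Z W \<and> p \<in> W \<and> (\<forall>q\<in>W. N (R p v - R q v) < e)"
  shows "continuous_map Z (strong_operator_topology completion) (\<lambda>p. lift (R p))"
proof -
  have emb: "emb v \<in> E" for v by (simp add: coeff_in_E csq_const)
  have "\<exists>W. openin Z W \<and> p \<in> W \<and> (\<forall>q\<in>W. lift (R q) f \<in> completion.mball (lift (R p) f) e)"
    if f: "f \<in> E" and p: "p \<in> topspace Z" and e: "0 < e" for f p e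
  proof -
    obtain v where v: "hdist completion f (emb v) < e / 3" using emb_dense[OF f, of "e/3"] e by auto
    obtain W where W: "openin Z W" "p \<in> W" "\<And>q. q \<in> W \<Longrightarrow> N (R p v - R q v) < e / 3"
      using cont[OF p, of "e/3"] e by (metis divide_pos_pos zero_less_numeral)
    have close: "hdist completion (lift (R q) f) (emb (R q v)) < e / 3" if q: "q \<in> topspace Z" for q
    proof -
      obtain s where s: "csq s" "f = coeff s" using E_cases[OF f] .
      have "(\<lambda>k. N (R q (s k) - R q v)) \<longlonglongrightarrow> hdist completion (lift (R q) f) (emb (R q v))"
        using hdist_tendsto[OF csq_isometric_op[OF iso[OF q] s(1)] csq_const] s iso[OF q]
        by (simp add: lift_coeff)
      then have "hdist completion (lift (R q) f) (emb (R q v)) = hdist completion f (emb v)"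
        using hdist_tendsto[OF s(1) csq_const, of v] s(2) LIMSEQ_unique
        by (simp add: isometric_op_N[OF iso[OF q]])
      then show ?thesis using v by simp
    qed
    have "lift (R q) f \<in> completion.mball (lift (R p) f) e" if q: "q \<in> W" for q
    proof -
      have qZ: "q \<in> topspace Z" using W(1) q openin_subset by blast
      have c: "lift (R p) f \<in> E" "lift (R q) f \<in> E" using f p qZ iso lift_in_E by auto
      have "hdist completion (lift (R p) f) (lift (R q) f) \<le>
          hdist completion (lift (R p) f) (emb (R p v)) + hdist completion (emb (R p v)) (lift (R q) f)"
        using completion.triangle c emb by simp
      moreover have "hdist completion (emb (R p v)) (lift (R q) f) \<le>
          hdist completion (emb (R p v)) (emb (R q v)) + hdist completion (emb (R q v)) (lift (R q) f)"
        using completion.triangle c emb by simp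
      moreover have "hdist completion (emb (R p v)) (emb (R q v)) < e / 3"
        using W(3)[OF q] by (simp add: hdist_emb)
      ultimately have "hdist completion (lift (R p) f) (lift (R q) f) < e"
        using close[OF p] close[OF qZ] completion.commute[of "emb (R q v)" "lift (R q) f"] by linarith
      then show ?thesis unfolding completion.in_mball using c by simp
    qed
    then show ?thesis using W by blast
  qed
  then have "continuous_map Z completion.mtopology (\<lambda>p. lift (R p) f)" if "f \<in> E" for f
    using that unfolding completion.continuous_map_to_metric by blast
  then show ?thesis
    using U by (subst continuous_map_strong_operator_topology[OF completion.complex_inner_space_axioms]) auto
qed

end

section \<open>Finitely supported functions with the inner product of a kernel\<close>

abbreviation wt :: "('a \<Rightarrow>\<^sub>0 complex) \<Rightarrow> 'a \<Rightarrow> complex" where "wt \<equiv> Poly_Mapping.lookup"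

abbreviation supp :: "('a \<Rightarrow>\<^sub>0 complex) \<Rightarrow> 'a set" where "supp \<equiv> Poly_Mapping.keys"

abbreviation pscl :: "complex \<Rightarrow> ('a \<Rightarrow>\<^sub>0 complex) \<Rightarrow> 'a \<Rightarrow>\<^sub>0 complex" where
  "pscl c \<equiv> Poly_Mapping.map ((*) c)"

abbreviation delta :: "'a \<Rightarrow> 'a \<Rightarrow>\<^sub>0 complex" where "delta x \<equiv> Poly_Mapping.single x 1"

text \<open>The integral of \<open>F\<close> against \<open>v\<close>, seen as a finitely supported
  complex measure.\<close>

definition lin :: "('a \<Rightarrow> complex) \<Rightarrow> ('a \<Rightarrow>\<^sub>0 complex) \<Rightarrow> complex" where
  "lin F v = (\<Sum>x\<in>supp v. wt v x * F x)"

lemma wt_pscl: "wt (pscl c v) x = c * wt v x"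
  by (simp add: Poly_Mapping.map.rep_eq when_def)

lemma lin_superset: "finite A \<Longrightarrow> supp v \<subseteq> A \<Longrightarrow> lin F v = (\<Sum>x\<in>A. wt v x * F x)"
  unfolding lin_def by (rule sum.mono_neutral_left) (auto simp: Poly_Mapping.in_keys_iff)

lemma lin_add: "lin F (u + v) = lin F u + lin F v"
proof -
  let ?A = "supp u \<union> supp v"
  have "lin F (u + v) = (\<Sum>x\<in>?A. wt (u + v) x * F x)"
    using Poly_Mapping.keys_add[of u v] by (intro lin_superset) auto
  also have "\<dots> = (\<Sum>x\<in>?A. wt u x * F x) + (\<Sum>x\<in>?A. wt v x * F x)"
    by (simp add: Poly_Mapping.lookup_add distrib_right sum.distrib)
  also have "\<dots> = lin F u + lin F v"
    by (simp add: lin_superset[of ?A])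
  finally show ?thesis .
qed

lemma lin_scl: "lin F (pscl c v) = c * lin F v"
proof -
  have "supp (pscl c v) \<subseteq> supp v" by (auto simp: Poly_Mapping.in_keys_iff wt_pscl)
  then show ?thesis
    by (simp add: lin_superset[of "supp v"] wt_pscl sum_distrib_left mult.assoc)
qed

lemma lin_single: "lin F (Poly_Mapping.single x a) = a * F x"
  by (simp add: lin_superset[of "{x}"])

text \<open>\<open>map_key f\<close> pulls weights back along \<open>f\<close>, which moves point
  masses by the inverse map \<open>g\<close>.\<close>

lemma lin_map_key:
  fixes f g :: "'a \<Rightarrow> 'a"
  assumes f: "inj f" and g: "f \<circ> g = id" "g \<circ> f = id"
  shows "lin F (Poly_Mapping.map_key f v) = lin (F \<circ> g) v"
proof -
  have fg: "f (g x) = x" "g (f x) = x" for x using g by (metis comp_apply id_apply)+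
  have w: "wt (Poly_Mapping.map_key f v) x = wt v (f x)" for x
    using f by (simp add: Poly_Mapping.map_key.rep_eq)
  have "supp (Poly_Mapping.map_key f v) = g ` supp v"
    unfolding Poly_Mapping.keys_map_key[OF f]
  proof (intro Set.set_eqI iffI)
    fix x assume "x \<in> f -` supp v"
    then show "x \<in> g ` supp v" by (intro image_eqI[of _ _ "f x"]) (simp_all add: fg)
  qed (auto simp: fg)
  moreover have "inj_on g (supp v)" using fg by (metis inj_on_inverseI)
  ultimately show ?thesis
    by (simp add: lin_def w sum.reindex fg)
qed

text \<open>The sesquilinear extension of \<open>\<kappa>\<close>, written as nested integrals so
  that linearity and translation reduce to properties of \<open>lin\<close>.\<close>

definition form :: "('a \<Rightarrow> 'a \<Rightarrow> real) \<Rightarrow> ('a \<Rightarrow>\<^sub>0 complex) \<Rightarrow> ('a \<Rightarrow>\<^sub>0 complex) \<Rightarrow> complex" where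
  "form \<kappa> u v = lin (\<lambda>x. cnj (lin (\<lambda>y. of_real (\<kappa> x y)) v)) u"

lemma form_sum: "form \<kappa> u v = (\<Sum>x\<in>supp u. \<Sum>y\<in>supp v. wt u x * cnj (wt v y) * of_real (\<kappa> x y))"
  by (simp add: form_def lin_def sum_distrib_left mult.assoc)

lemma Re_form_sum: "Re (form \<kappa> u v) = (\<Sum>x\<in>supp u. \<Sum>y\<in>supp v. Re (wt u x * cnj (wt v y)) * \<kappa> x y)"
  by (simp add: form_sum)

lemma form_single: "form \<kappa> (Poly_Mapping.single x a) (Poly_Mapping.single y b) = a * cnj b * of_real (\<kappa> x y)"
  by (simp add: form_def lin_single)

locale psd_form =
  fixes \<kappa> :: "'a \<Rightarrow> 'a \<Rightarrow> real"
  assumes psd: "psd_kernel \<kappa>"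

text \<open>For a real symmetric kernel, the products of a real with an imaginary part contribute
  nothing to \<open>Re (form \<kappa> u u)\<close>. What remains is the sum of two real quadratic
  forms, one in the real and one in the imaginary parts of the weights.\<close>

sublocale psd_form \<subseteq> semi_inner_product pscl "form \<kappa>"
proof
  fix u v w :: "'a \<Rightarrow>\<^sub>0 complex" and c
  show "form \<kappa> (u + v) w = form \<kappa> u w + form \<kappa> v w" by (simp add: form_def lin_add)
  show "form \<kappa> (pscl c u) w = c * form \<kappa> u w" by (simp add: form_def lin_scl)
  show "form \<kappa> u v = cnj (form \<kappa> v u)"
    unfolding form_sum using psd_kernel_sym[OF psd]
    by (subst sum.swap) (simp add: mult.commute mult.left_commute)
  have "Re (form \<kappa> u u) = (\<Sum>x\<in>supp u. \<Sum>y\<in>supp u. Re (wt u x) * Re (wt u y) * \<kappa> x y) +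
      (\<Sum>x\<in>supp u. \<Sum>y\<in>supp u. Im (wt u x) * Im (wt u y) * \<kappa> x y)"
    unfolding Re_form_sum sum.distrib[symmetric] by (simp add: distrib_right)
  then show "0 \<le> Re (form \<kappa> u u)"
    using psd_kernel_sum_nonneg[OF psd, of "supp u" "\<lambda>x. Re (wt u x)"]
      psd_kernel_sum_nonneg[OF psd, of "supp u" "\<lambda>x. Im (wt u x)"] by simp
qed


section \<open>Positive definite functions on groups\<close>

text \<open>This order of the arguments makes the kernel invariant under left translation. The value
  zero off the carrier makes it a kernel on the whole type.\<close>

definition pd_kernel :: "('a, 'm) monoid_scheme \<Rightarrow> ('a \<Rightarrow> real) \<Rightarrow> 'a \<Rightarrow> 'a \<Rightarrow> real" where
  "pd_kernel G h x y = (if x \<in> carrier G \<and> y \<in> carrier G then h (inv\<^bsub>G\<^esub> y \<otimes>\<^bsub>G\<^esub> x) else 0)"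

definition positive_definite :: "('a, 'm) monoid_scheme \<Rightarrow> ('a \<Rightarrow> real) \<Rightarrow> bool" where
  "positive_definite G h \<longleftrightarrow> psd_kernel (pd_kernel G h)"

lemma positive_definite_const: "0 \<le> a \<Longrightarrow> positive_definite G (\<lambda>_. a)"
  unfolding positive_definite_def pd_kernel_def by (intro psd_kernel_restrict psd_kernel_const)

lemma positive_definite_add:
  "positive_definite G h \<Longrightarrow> positive_definite G h' \<Longrightarrow> positive_definite G (\<lambda>x. h x + h' x)"
  unfolding positive_definite_def
  by (drule (1) psd_kernel_add) (erule back_subst[of psd_kernel], auto simp: pd_kernel_def fun_eq_iff)

lemma positive_definite_mult:
  "positive_definite G h \<Longrightarrow> positive_definite G h' \<Longrightarrow> positive_definite G (\<lambda>x. h x * h' x)"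
  unfolding positive_definite_def
  by (drule (1) psd_kernel_mult) (erule back_subst[of psd_kernel], auto simp: pd_kernel_def fun_eq_iff)

lemma positive_definite_power: "positive_definite G h \<Longrightarrow> positive_definite G (\<lambda>x. h x ^ n)"
  by (induction n) (simp_all add: positive_definite_const positive_definite_mult)

lemma (in group) positive_definite_limit:
  assumes h: "\<And>n. positive_definite G (h n)" and lim: "\<And>x. x \<in> carrier G \<Longrightarrow> (\<lambda>n. h n x) \<longlonglongrightarrow> f x"
  shows "positive_definite G f"
  unfolding positive_definite_def
  by (rule psd_kernel_limit[where \<kappa> = "\<lambda>n. pd_kernel G (h n)"])
    (use h in \<open>auto simp: pd_kernel_def lim positive_definite_def\<close>)

lemma (in group) positive_definite_sum:
  "(\<And>i. i \<in> I \<Longrightarrow> positive_definite G (h i)) \<Longrightarrow> positive_definite G (\<lambda>x. \<Sum>i\<in>I. h i x)"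
  by (induction I rule: infinite_finite_induct) (simp_all add: positive_definite_const positive_definite_add)

locale positive_definite_function = group G for G (structure) +
  fixes h :: "'a \<Rightarrow> real"
  assumes pd: "positive_definite G h"

sublocale positive_definite_function \<subseteq> psd_form "pd_kernel G h"
  using pd by unfold_locales (simp add: positive_definite_def)

section \<open>Left translation of finitely supported functions\<close>

context group
begin

text \<open>Being the identity off the carrier, it is a bijection of the whole type for
  \<open>p\<close> in the carrier; \<open>map_key\<close> asks for injectivity on the whole
  type.\<close>

definition shift :: "'a \<Rightarrow> 'a \<Rightarrow> 'a" where
  "shift p x = (if x \<in> carrier G then p \<otimes> x else x)"

text \<open>The inverse compensates for the pullback in \<open>map_key\<close>: the point mass at
  \<open>x\<close> moves to \<open>p \<otimes> x\<close>.\<close>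

definition trl :: "'a \<Rightarrow> ('a \<Rightarrow>\<^sub>0 complex) \<Rightarrow> 'a \<Rightarrow>\<^sub>0 complex" where
  "trl p = Poly_Mapping.map_key (shift (inv p))"

lemma shift_mult: "p \<in> carrier G \<Longrightarrow> q \<in> carrier G \<Longrightarrow> shift (p \<otimes> q) = shift p \<circ> shift q"
  by (auto simp: shift_def m_assoc)

lemma shift_one: "shift \<one> = id" by (auto simp: shift_def)

lemma shift_inv: assumes "p \<in> carrier G" shows "shift p \<circ> shift (inv p) = id" "shift (inv p) \<circ> shift p = id"
  using shift_mult[of p "inv p"] shift_mult[of "inv p" p] assms by (simp_all add: shift_one)

lemma inj_shift: "p \<in> carrier G \<Longrightarrow> inj (shift p)"
  using shift_inv(2) by (metis inj_on_id inj_on_imageI2)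

lemma trl_mult: "p \<in> carrier G \<Longrightarrow> q \<in> carrier G \<Longrightarrow> trl (p \<otimes> q) = trl p \<circ> trl q"
  by (rule ext) (simp add: trl_def inv_mult_group shift_mult Poly_Mapping.map_key_compose inj_shift)

lemma trl_one: "trl \<one> = id"
  by (rule ext) (simp add: trl_def shift_one id_def Poly_Mapping.map_key_id)

lemma trl_add: "p \<in> carrier G \<Longrightarrow> trl p (u + v) = trl p u + trl p v"
  by (simp add: trl_def Poly_Mapping.map_key_plus inj_shift)

lemma trl_scl: "p \<in> carrier G \<Longrightarrow> trl p (pscl c u) = pscl c (trl p u)"
  by (simp add: trl_def Poly_Mapping.map_key_map inj_shift)

lemma lin_trl: "p \<in> carrier G \<Longrightarrow> lin F (trl p v) = lin (F \<circ> shift p) v"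
  unfolding trl_def by (rule lin_map_key) (auto simp: inj_shift shift_inv)

lemma trl_delta: "p \<in> carrier G \<Longrightarrow> x \<in> carrier G \<Longrightarrow> trl p (delta x) = delta (p \<otimes> x)"
  using Poly_Mapping.map_key_single[OF inj_shift[of "inv p"], of "p \<otimes> x" 1]
  by (simp add: trl_def shift_def m_assoc[symmetric])

lemma supp_trl: "p \<in> carrier G \<Longrightarrow> supp v \<subseteq> carrier G \<Longrightarrow> supp (trl p v) = (\<lambda>x. p \<otimes> x) ` supp v"
proof -
  assume p: "p \<in> carrier G" and v: "supp v \<subseteq> carrier G"
  have "supp (trl p v) = shift (inv p) -` supp v"
    by (simp add: trl_def Poly_Mapping.keys_map_key inj_shift p)
  also have "\<dots> = shift p ` supp v"
  proof (intro Set.set_eqI iffI)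
    fix x assume "x \<in> shift (inv p) -` supp v"
    then show "x \<in> shift p ` supp v"
      using fun_cong[OF shift_inv(1)[OF p], of x] by (intro image_eqI[of _ _ "shift (inv p) x"]) auto
  next
    fix x assume "x \<in> shift p ` supp v"
    then obtain y where "y \<in> supp v" "x = shift p y" by blast
    then show "x \<in> shift (inv p) -` supp v"
      using fun_cong[OF shift_inv(2)[OF p], of y] by simp
  qed
  also have "\<dots> = (\<lambda>x. p \<otimes> x) ` supp v" using v by (intro image_cong) (auto simp: shift_def)
  finally show ?thesis .
qed

lemma wt_trl: "p \<in> carrier G \<Longrightarrow> wt (trl p v) x = wt v (shift (inv p) x)"
  by (simp add: trl_def Poly_Mapping.map_key.rep_eq inj_shift)

lemma pd_kernel_shift: "p \<in> carrier G \<Longrightarrow> pd_kernel G h (shift p x) (shift p y) = pd_kernel G h x y"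
  by (auto simp: pd_kernel_def shift_def inv_mult_group m_assoc inv_solve_left' l_inv r_inv)
    (metis inv_closed l_inv l_one m_assoc)

lemma form_trl: "p \<in> carrier G \<Longrightarrow> form (pd_kernel G h) (trl p u) (trl p v) = form (pd_kernel G h) u v"
  by (simp add: form_def lin_trl comp_def pd_kernel_shift)

text \<open>With the translation moved into the kernel, the index sets of the sum no longer depend
  on \<open>p\<close>, which makes continuity in \<open>p\<close> visible.\<close>

lemma form_trl_left:
  "p \<in> carrier G \<Longrightarrow> Re (form (pd_kernel G h) (trl p u) v) =
     (\<Sum>x\<in>supp u. \<Sum>y\<in>supp v. Re (wt u x * cnj (wt v y)) * pd_kernel G h (shift p x) y)"
proof -
  assume p: "p \<in> carrier G"
  have "form (pd_kernel G h) (trl p u) v =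
      (\<Sum>x\<in>supp u. \<Sum>y\<in>supp v. (wt u x * cnj (wt v y)) * of_real (pd_kernel G h (shift p x) y))"
    unfolding form_def lin_trl[OF p] by (simp add: lin_def sum_distrib_left mult.assoc)
  then show ?thesis by simp
qed

end

section \<open>Continuity of translated inner products\<close>

lemma (in topological_group) continuous_map_mult_left:
  "p \<in> carrier G \<Longrightarrow> continuous_map T T (\<lambda>x. p \<otimes> x)"
  using continuous_map_compose[OF _ continuous_mult, of T "\<lambda>x. (p, x)"]
  by (simp add: continuous_map_paired topspace_eq comp_def)

lemma (in topological_group) continuous_map_mult_right:
  "p \<in> carrier G \<Longrightarrow> continuous_map T T (\<lambda>x. x \<otimes> p)"
  using continuous_map_compose[OF _ continuous_mult, of T "\<lambda>x. (x, p)"]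
  by (simp add: continuous_map_paired topspace_eq comp_def)

lemma (in topological_group) continuous_map_Re_form_trl:
  assumes h: "continuous_map T euclideanreal h"
  shows "continuous_map T euclideanreal (\<lambda>p. Re (form (pd_kernel G h) (trl p u) v))"
proof (rule continuous_map_eq)
  have "continuous_map T euclideanreal (\<lambda>p. pd_kernel G h (shift p x) y)" for x y
  proof (cases "x \<in> carrier G \<and> y \<in> carrier G")
    case True
    have "continuous_map T T (\<lambda>p. inv y \<otimes> (p \<otimes> x))"
      using continuous_map_compose[OF continuous_map_mult_right[of x] continuous_map_mult_left[of "inv y"]] True
      by (simp add: comp_def)
    then have "continuous_map T euclideanreal (\<lambda>p. h (inv y \<otimes> (p \<otimes> x)))"
      using continuous_map_compose[OF _ h] by (force simp: comp_def)
    then show ?thesis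
      by (rule continuous_map_eq) (use True in \<open>simp add: pd_kernel_def shift_def topspace_eq\<close>)
  next
    case False
    have "continuous_map T euclideanreal (\<lambda>p. 0)" by simp
    then show ?thesis
      by (rule continuous_map_eq) (use False in \<open>auto simp: pd_kernel_def shift_def topspace_eq\<close>)
  qed
  then show "continuous_map T euclideanreal
      (\<lambda>p. \<Sum>x\<in>supp u. \<Sum>y\<in>supp v. Re (wt u x * cnj (wt v y)) * pd_kernel G h (shift p x) y)"
    by (intro continuous_map_sum continuous_map_real_mult_left Poly_Mapping.finite_keys)
qed (simp add: form_trl_left topspace_eq)

lemma continuous_map_real_uniform_limit:
  fixes f :: "nat \<Rightarrow> 'a \<Rightarrow> real"
  assumes "\<And>n. continuous_map Z euclideanreal (f n)"
    and "\<And>e. 0 < e \<Longrightarrow> \<exists>M. \<forall>n\<ge>M. \<forall>x\<in>topspace Z. \<bar>f n x - g x\<bar> < e"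
  shows "continuous_map Z euclideanreal g"
  using Met_TC.continuous_map_uniform_limit[of Z f sequentially g] assms
  by (simp add: dist_real_def eventually_sequentially)

section \<open>Averaging over a compact subgroup\<close>

text \<open>
  Haar measure is replaced by a sequence of convex combinations of point masses on the subgroup
  whose norm tends to the infimum; by the parallelogram law it is Cauchy and asymptotically invariant.
\<close>

definition conv :: "'a set \<Rightarrow> ('a \<Rightarrow>\<^sub>0 complex) \<Rightarrow> bool" where
  "conv K v \<longleftrightarrow> supp v \<subseteq> K \<and> (\<forall>x. Im (wt v x) = 0 \<and> 0 \<le> Re (wt v x)) \<and> lin (\<lambda>_. 1) v = 1"

lemma conv_supp: "conv K v \<Longrightarrow> supp v \<subseteq> K" by (simp add: conv_def)

lemma conv_wt: "conv K v \<Longrightarrow> Im (wt v x) = 0" "conv K v \<Longrightarrow> 0 \<le> Re (wt v x)"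
  by (simp_all add: conv_def)

lemma conv_sum: "conv K v \<Longrightarrow> (\<Sum>x\<in>supp v. Re (wt v x)) = 1"
proof -
  assume "conv K v"
  then have "Re (lin (\<lambda>_. 1) v) = 1" by (simp add: conv_def)
  then show ?thesis by (simp add: lin_def)
qed

lemma Re_form_conv:
  "conv K u \<Longrightarrow> conv L v \<Longrightarrow>
     Re (form \<kappa> u v) = (\<Sum>x\<in>supp u. \<Sum>y\<in>supp v. Re (wt u x) * Re (wt v y) * \<kappa> x y)"
  by (simp add: Re_form_sum conv_wt)

lemma conv_sum_const:
  assumes "conv K u" "conv L v"
  shows "(\<Sum>x\<in>supp u. \<Sum>y\<in>supp v. Re (wt u x) * Re (wt v y) * M) = M"
proof -
  have "(\<Sum>x\<in>supp u. \<Sum>y\<in>supp v. Re (wt u x) * Re (wt v y) * M) =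
      (\<Sum>x\<in>supp u. Re (wt u x)) * (\<Sum>y\<in>supp v. Re (wt v y)) * M"
    by (simp add: mult.assoc flip: sum_distrib_left sum_distrib_right)
  then show ?thesis by (simp add: conv_sum[OF assms(1)] conv_sum[OF assms(2)])
qed

lemma Re_form_conv_le:
  assumes "conv K u" "conv L v" and "\<And>x y. x \<in> K \<Longrightarrow> y \<in> L \<Longrightarrow> \<kappa> x y \<le> M"
  shows "Re (form \<kappa> u v) \<le> M"
proof -
  have "(\<Sum>x\<in>supp u. \<Sum>y\<in>supp v. Re (wt u x) * Re (wt v y) * \<kappa> x y) \<le>
      (\<Sum>x\<in>supp u. \<Sum>y\<in>supp v. Re (wt u x) * Re (wt v y) * M)"
    using conv_supp[OF assms(1)] conv_supp[OF assms(2)]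
    by (intro sum_mono mult_left_mono mult_nonneg_nonneg conv_wt[OF assms(1)] conv_wt[OF assms(2)] assms(3)) auto
  then show ?thesis
    by (simp only: conv_sum_const[OF assms(1,2)] Re_form_conv[OF assms(1,2)])
qed

lemma Re_form_conv_nonneg:
  assumes "conv K u" "conv L v" and "\<And>x y. x \<in> K \<Longrightarrow> y \<in> L \<Longrightarrow> 0 \<le> \<kappa> x y"
  shows "0 \<le> Re (form \<kappa> u v)"
  unfolding Re_form_conv[OF assms(1,2)]
  using conv_supp[OF assms(1)] conv_supp[OF assms(2)]
  by (intro sum_nonneg mult_nonneg_nonneg conv_wt[OF assms(1)] conv_wt[OF assms(2)] assms(3)) auto

text \<open>By the pigeonhole principle some \<open>A i\<close> carries at least the fraction
  \<open>1 / card I\<close> of the mass of \<open>u\<close>. All terms are nonnegative, so the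
  double sum may be cut down to pairs from \<open>A i\<close>, where the kernel is at least
  \<open>M\<close>.\<close>

lemma Re_form_conv_cover:
  assumes u: "conv K u" and I: "finite I" "K \<subseteq> (\<Union>i\<in>I. A i)"
    and nonneg: "\<And>x y. x \<in> K \<Longrightarrow> y \<in> K \<Longrightarrow> 0 \<le> \<kappa> x y" and M: "0 \<le> M"
    and large: "\<And>i x y. i \<in> I \<Longrightarrow> x \<in> A i \<Longrightarrow> y \<in> A i \<Longrightarrow> x \<in> K \<Longrightarrow> y \<in> K \<Longrightarrow> M \<le> \<kappa> x y"
  shows "M / (real (card I))\<^sup>2 \<le> Re (form \<kappa> u u)"
proof -
  define w where "w = (\<lambda>x. Re (wt u x))"
  have w: "0 \<le> w x" for x by (simp add: w_def conv_wt[OF u])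
  note S = conv_supp[OF u]
  have 1: "1 \<le> (\<Sum>i\<in>I. \<Sum>x\<in>supp u \<inter> A i. w x)"
  proof -
    have "1 = (\<Sum>x\<in>supp u. w x)" using conv_sum[OF u] by (simp add: w_def)
    \<comment> \<open>The pieces may overlap, so each weight is counted at least once.\<close>
    also have "\<dots> \<le> (\<Sum>x\<in>supp u. \<Sum>i\<in>I. if x \<in> A i then w x else 0)"
    proof (rule sum_mono)
      fix x assume "x \<in> supp u"
      then obtain i where i: "i \<in> I" "x \<in> A i" using S I(2) by blast
      then show "w x \<le> (\<Sum>i\<in>I. if x \<in> A i then w x else 0)"
        using member_le_sum[of i I "\<lambda>i. if x \<in> A i then w x else 0"] w I(1) by simp
    qed
    also have "\<dots> = (\<Sum>i\<in>I. \<Sum>x\<in>supp u. if x \<in> A i then w x else 0)" by (rule sum.swap)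
    also have "\<dots> = (\<Sum>i\<in>I. \<Sum>x\<in>supp u \<inter> A i. w x)"
      by (simp add: sum.inter_restrict)
    finally show ?thesis .
  qed
  have "I \<noteq> {}" using 1 by auto
  then have c: "0 < real (card I)" using I(1) by (simp add: card_gt_0_iff)
  have "\<exists>i\<in>I. 1 / real (card I) \<le> (\<Sum>x\<in>supp u \<inter> A i. w x)"
  proof (rule ccontr)
    assume "\<not> ?thesis"
    then have "(\<Sum>x\<in>supp u \<inter> A i. w x) < 1 / real (card I)" if "i \<in> I" for i
      using that not_le by blast
    then have "(\<Sum>i\<in>I. \<Sum>x\<in>supp u \<inter> A i. w x) < (\<Sum>i\<in>I. 1 / real (card I))"
      by (rule sum_strict_mono[OF I(1) \<open>I \<noteq> {}\<close>])
    then show False using 1 c by simp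
  qed
  then obtain i where i: "i \<in> I" "1 / real (card I) \<le> (\<Sum>x\<in>supp u \<inter> A i. w x)" by blast
  let ?B = "supp u \<inter> A i"
  have "M / (real (card I))\<^sup>2 = (1 / real (card I))\<^sup>2 * M" by (simp add: power_divide)
  also have "\<dots> \<le> (\<Sum>x\<in>?B. w x)\<^sup>2 * M"
    using i(2) c M by (intro mult_right_mono power_mono) auto
  also have "\<dots> = (\<Sum>x\<in>?B. \<Sum>y\<in>?B. w x * w y * M)"
    by (simp add: power2_eq_square mult.assoc flip: sum_distrib_left sum_distrib_right)
  also have "\<dots> \<le> (\<Sum>x\<in>?B. \<Sum>y\<in>?B. w x * w y * \<kappa> x y)"
    by (intro sum_mono mult_left_mono mult_nonneg_nonneg w large[OF i(1)]) (use S in auto)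
  also have "\<dots> \<le> (\<Sum>x\<in>supp u. \<Sum>y\<in>?B. w x * w y * \<kappa> x y)"
    by (intro sum_mono2 sum_nonneg mult_nonneg_nonneg w nonneg) (use S in auto)
  also have "\<dots> \<le> (\<Sum>x\<in>supp u. \<Sum>y\<in>supp u. w x * w y * \<kappa> x y)"
    by (intro sum_mono sum_mono2 mult_nonneg_nonneg w nonneg) (use S in auto)
  also have "\<dots> = Re (form \<kappa> u u)" by (simp add: Re_form_conv[OF u u] w_def)
  finally show ?thesis .
qed

lemma conv_midpoint: "conv K u \<Longrightarrow> conv K v \<Longrightarrow> conv K (pscl (1/2) (u + v))"
  unfolding conv_def lin_scl lin_add
proof (intro conjI allI)
  assume *: "supp u \<subseteq> K \<and> (\<forall>x. Im (wt u x) = 0 \<and> 0 \<le> Re (wt u x)) \<and> lin (\<lambda>_. 1) u = 1"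
    "supp v \<subseteq> K \<and> (\<forall>x. Im (wt v x) = 0 \<and> 0 \<le> Re (wt v x)) \<and> lin (\<lambda>_. 1) v = 1"
  show "supp (pscl (1/2) (u + v)) \<subseteq> K"
  proof
    fix x assume "x \<in> supp (pscl (1/2) (u + v))"
    then have "x \<in> supp u \<or> x \<in> supp v"
      by (auto simp: Poly_Mapping.in_keys_iff wt_pscl Poly_Mapping.lookup_add)
    then show "x \<in> K" using * by blast
  qed
  show "1 / 2 * (lin (\<lambda>_. 1) u + lin (\<lambda>_. 1) v) = 1" using * by simp
  fix x
  have w: "wt (pscl (1/2) (u + v)) x = of_real (1/2) * (wt u x + wt v x)"
    by (simp add: wt_pscl Poly_Mapping.lookup_add)
  show "Im (wt (pscl (1/2) (u + v)) x) = 0" "0 \<le> Re (wt (pscl (1/2) (u + v)) x)"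
    unfolding w using * by simp_all
qed

lemma conv_delta: "x \<in> K \<Longrightarrow> conv K (delta x)"
  by (auto simp: conv_def lin_single Poly_Mapping.lookup_single when_def)

lemma (in group) conv_trl:
  assumes K: "subgroup K G" and k: "k \<in> K" and u: "conv K u"
  shows "conv K (trl k u)"
proof -
  interpret K: subgroup K G by fact
  have "supp (trl k u) \<subseteq> K"
    using supp_trl[of k u] conv_supp[OF u] K.subset k by auto
  moreover have "lin (\<lambda>_. 1) (trl k u) = 1"
    using u k by (simp add: lin_trl comp_def conv_def)
  ultimately show ?thesis
    using u k by (simp add: conv_def wt_trl)
qed

context positive_definite_function
begin

abbreviation "\<kappa> \<equiv> pd_kernel G h"

lemma N_trl_diff: "p \<in> carrier G \<Longrightarrow> N (trl p u - trl p v) = N (u - v)"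
  by (simp add: N_def B_diff_left B_diff_right form_trl)

lemma N_trl: "p \<in> carrier G \<Longrightarrow> N (trl p u) = N u"
  by (simp add: N_def form_trl)

text \<open>Translation by an element of \<open>K\<close> preserves both the convex combinations on
  \<open>K\<close> and the norm. Hence \<open>trl k (c n)\<close> is as nearly minimal as
  \<open>c n\<close>, and two near minimisers are close.\<close>

lemma exists_almost_invariant:
  assumes K: "subgroup K G"
  shows "\<exists>c. csq c \<and> (\<forall>n. conv K (c n)) \<and> (\<forall>k\<in>K. (\<lambda>n. N (trl k (c n) - c n)) \<longlonglongrightarrow> 0)"
proof -
  interpret K: subgroup K G by fact
  define S where "S = N ` {v. conv K v}"
  define d where "d = Inf S"
  have ne: "S \<noteq> {}" using conv_delta[OF K.one_closed] by (auto simp: S_def)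
  have bdd: "bdd_below S" unfolding S_def by (rule bdd_belowI[of _ 0]) auto
  have d0: "0 \<le> d" unfolding d_def by (rule cInf_greatest[OF ne]) (auto simp: S_def)
  have d: "d \<le> N v" if "conv K v" for v
    unfolding d_def by (rule cInf_lower[OF _ bdd]) (use that in \<open>auto simp: S_def\<close>)
  \<comment> \<open>The excess over the infimum is measured in squares, to suit the parallelogram
    law.\<close>
  have "\<exists>v. conv K v \<and> (N v)\<^sup>2 < d\<^sup>2 + 1 / real (Suc n)" for n
  proof -
    have "d < sqrt (d\<^sup>2 + 1 / real (Suc n))" by (rule real_less_rsqrt) simp
    then obtain s where "s \<in> S" "s < sqrt (d\<^sup>2 + 1 / real (Suc n))"
      unfolding d_def using cInf_lessD[OF ne] by blast
    then obtain v where v: "conv K v" "N v < sqrt (d\<^sup>2 + 1 / real (Suc n))" by (auto simp: S_def)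
    have "(N v)\<^sup>2 < (sqrt (d\<^sup>2 + 1 / real (Suc n)))\<^sup>2"
      by (rule power_strict_mono[OF v(2)]) auto
    then show ?thesis using v(1) by auto
  qed
  then obtain c where c: "\<And>n. conv K (c n)" "\<And>n. (N (c n))\<^sup>2 < d\<^sup>2 + 1 / real (Suc n)" by metis
  \<comment> \<open>The midpoint of \<open>u\<close> and \<open>v\<close> competes for the infimum,
    so \<open>N (u + v)\<close> is at least \<open>2 * d\<close>; the parallelogram law turns this
    into a bound by the two excesses.\<close>
  have close: "(N (u - v))\<^sup>2 \<le> 2 * ((N u)\<^sup>2 - d\<^sup>2) + 2 * ((N v)\<^sup>2 - d\<^sup>2)"
    if "conv K u" "conv K v" for u v
  proof -
    have "2 * d \<le> N (u + v)" using d[OF conv_midpoint[OF that]] by (simp add: N_scl)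
    then have "(2 * d)\<^sup>2 \<le> (N (u + v))\<^sup>2" using d0 by (intro power_mono) auto
    then show ?thesis using N_parallelogram[of u v] by simp
  qed
  have "csq c"
  proof (rule csqI)
    fix e :: real assume e: "0 < e"
    obtain M where M: "1 / real (Suc M) < e\<^sup>2 / 4"
      using nat_approx_posE[of "e\<^sup>2 / 4"] e by auto
    have "N (c m - c n) < e" if "m \<ge> M" "n \<ge> M" for m n
    proof -
      have *: "(N (c i))\<^sup>2 - d\<^sup>2 < e\<^sup>2 / 4" if "i \<ge> M" for i
      proof -
        have "1 / real (Suc i) \<le> 1 / real (Suc M)" using that by (simp add: frac_le)
        then have "1 / real (Suc i) < e\<^sup>2 / 4" using M by (rule le_less_trans)
        moreover have "(N (c i))\<^sup>2 - d\<^sup>2 < 1 / real (Suc i)" using c(2)[of i] by (simp only: less_diff_eq diff_less_eq)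
        ultimately show ?thesis by (rule less_trans[rotated])
      qed
      have "(N (c m - c n))\<^sup>2 < e\<^sup>2"
        using close[OF c(1) c(1), of m n] *[OF that(1)] *[OF that(2)] by simp
      then show ?thesis using e by (simp add: power2_less_imp_less)
    qed
    then show "\<exists>M. \<forall>m\<ge>M. \<forall>n\<ge>M. N (c m - c n) < e" by blast
  qed
  moreover have "(\<lambda>n. N (trl k (c n) - c n)) \<longlonglongrightarrow> 0" if k: "k \<in> K" for k
  proof -
    have "(N (trl k (c n) - c n))\<^sup>2 \<le> 4 * inverse (real (Suc n))" for n
    proof -
      have "(N (trl k (c n) - c n))\<^sup>2 \<le> 4 * ((N (c n))\<^sup>2 - d\<^sup>2)"
        using close[OF conv_trl[OF K k c(1)] c(1), of n n] k by (simp add: N_trl)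
      also have "\<dots> \<le> 4 * inverse (real (Suc n))"
      proof (rule mult_left_mono)
        show "(N (c n))\<^sup>2 - d\<^sup>2 \<le> inverse (real (Suc n))"
          using less_imp_le[OF c(2)[of n]] by (simp only: diff_le_eq inverse_eq_divide add.commute)
      qed simp
      finally show ?thesis .
    qed
    moreover have "(\<lambda>n. 4 * inverse (real (Suc n))) \<longlonglongrightarrow> 0"
      using tendsto_mult_right_zero[OF LIMSEQ_inverse_real_of_nat] .
    ultimately have "(\<lambda>n. (N (trl k (c n) - c n))\<^sup>2) \<longlonglongrightarrow> 0"
      by (intro Lim_null_comparison[of "\<lambda>n. (N (trl k (c n) - c n))\<^sup>2" "\<lambda>n. 4 * inverse (real (Suc n))"])
        (simp_all only: real_norm_def abs_power2 eventually_sequentially simp_thms)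
    then have "(\<lambda>n. sqrt ((N (trl k (c n) - c n))\<^sup>2)) \<longlonglongrightarrow> sqrt 0" by (rule tendsto_real_sqrt)
    then show ?thesis by simp
  qed
  ultimately show ?thesis using c(1) by blast
qed

end

text \<open>\<open>\<phi>\<close> is the matrix coefficient of an ideal \<open>K\<close>-invariant
  vector, the limit of the \<open>c n\<close>. Each approximant at \<open>p\<close> is a convex
  combination of the values \<open>h (inv l \<otimes> (p \<otimes> k))\<close> with \<open>k\<close>
  and \<open>l\<close> in \<open>K\<close>, which yields the two quantitative bounds. The index set
  in the last of them has type \<open>'a set\<close> because the pieces will be indexed by points of
  \<open>K\<close>.\<close>

lemma (in topological_group) exists_average:
  assumes pd: "positive_definite G h" and cont: "continuous_map T euclideanreal h"
    and nonneg: "\<And>x. x \<in> carrier G \<Longrightarrow> 0 \<le> h x" and K: "subgroup K G"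
  obtains \<phi> where "positive_definite G \<phi>" "continuous_map T euclideanreal \<phi>"
    "\<And>p k. p \<in> carrier G \<Longrightarrow> k \<in> K \<Longrightarrow> \<phi> (p \<otimes> k) = \<phi> p"
    "\<And>p. p \<in> carrier G \<Longrightarrow> 0 \<le> \<phi> p"
    "\<And>p M. p \<in> carrier G \<Longrightarrow> (\<And>k l. k \<in> K \<Longrightarrow> l \<in> K \<Longrightarrow> h (inv l \<otimes> (p \<otimes> k)) \<le> M) \<Longrightarrow> \<phi> p \<le> M"
    "\<And>(I::'a set) A M. finite I \<Longrightarrow> K \<subseteq> (\<Union>i\<in>I. A i) \<Longrightarrow> 0 \<le> M \<Longrightarrow>
       (\<And>i x y. i \<in> I \<Longrightarrow> x \<in> A i \<Longrightarrow> y \<in> A i \<Longrightarrow> x \<in> K \<Longrightarrow> y \<in> K \<Longrightarrow> M \<le> h (inv y \<otimes> x)) \<Longrightarrow>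
       M / (real (card I))\<^sup>2 \<le> \<phi> \<one>"
proof -
  interpret positive_definite_function G h using pd by unfold_locales
  interpret K: subgroup K G by fact
  obtain c where c: "csq c" "\<And>n. conv K (c n)"
    and inv: "\<And>k. k \<in> K \<Longrightarrow> (\<lambda>n. N (trl k (c n) - c n)) \<longlonglongrightarrow> 0"
    using exists_almost_invariant[OF K] by blast
  obtain C where C: "0 < C" "\<And>n. N (c n) \<le> C" using csq_bounded[OF c(1)] by metis
  define \<Phi> where "\<Phi> = (\<lambda>n p. Re (form \<kappa> (trl p (c n)) (c n)))"
  define \<phi> where "\<phi> = (\<lambda>p. lim (\<lambda>n. \<Phi> n p))"
  have lim: "(\<lambda>n. \<Phi> n p) \<longlonglongrightarrow> \<phi> p" if p: "p \<in> carrier G" for p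
  proof -
    have "csq (\<lambda>n. trl p (c n))" by (rule csq_isometric[OF c(1)]) (simp add: N_trl_diff p)
    then have "convergent (\<lambda>n. form \<kappa> (trl p (c n)) (c n))" using c(1) by (rule csq_convergent_B)
    then have "convergent (\<lambda>n. \<Phi> n p)"
      unfolding \<Phi>_def convergent_def using tendsto_Re by blast
    then show ?thesis unfolding \<phi>_def by (simp add: convergent_LIMSEQ_iff)
  qed
  \<comment> \<open>Translations preserve \<open>N\<close>, so the bound is independent of
    \<open>p\<close>; this makes the convergence uniform and the limit continuous.\<close>
  have diff: "\<bar>\<Phi> n p - \<Phi> m p\<bar> \<le> 2 * C * N (c n - c m)" if p: "p \<in> carrier G" for n m p
  proof -
    have "\<bar>\<Phi> n p - \<Phi> m p\<bar> \<le> cmod (form \<kappa> (trl p (c n)) (c n) - form \<kappa> (trl p (c m)) (c m))"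
      unfolding \<Phi>_def using abs_Re_le_cmod by (metis minus_complex.sel(1))
    also have "\<dots> \<le> N (c n - c m) * N (c n) + N (c m) * N (c n - c m)"
      using B_diff_bound[of "trl p (c n)" "c n" "trl p (c m)" "c m"] by (simp add: N_trl_diff N_trl p)
    also have "\<dots> \<le> N (c n - c m) * C + C * N (c n - c m)"
      by (intro add_mono mult_left_mono mult_right_mono C) auto
    finally show ?thesis by simp
  qed
  have a1: "positive_definite G \<phi>"
    unfolding positive_definite_def
  proof (rule psd_kernel_limit)
    show "psd_kernel (\<lambda>x y. if x \<in> carrier G \<and> y \<in> carrier G then Re (form \<kappa> (trl x (c n)) (trl y (c n))) else 0)" for n
      by (intro psd_kernel_restrict psd_kernel_Gram)
    fix x y
    \<comment> \<open>Translating both arguments by \<open>inv y\<close> exhibits the approximants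
      as Gram kernels.\<close>
    have "Re (form \<kappa> (trl x (c n)) (trl y (c n))) = \<Phi> n (inv y \<otimes> x)"
      if "x \<in> carrier G" "y \<in> carrier G" for n
      using form_trl[of "inv y" h "trl x (c n)" "trl y (c n)"] that
        fun_cong[OF trl_mult[of "inv y" x], of "c n"] fun_cong[OF trl_mult[of "inv y" y], of "c n"]
      by (simp add: \<Phi>_def trl_one)
    then show "(\<lambda>n. if x \<in> carrier G \<and> y \<in> carrier G then Re (form \<kappa> (trl x (c n)) (trl y (c n))) else 0)
        \<longlonglongrightarrow> pd_kernel G \<phi> x y"
      using lim[of "inv y \<otimes> x"] by (auto simp: pd_kernel_def)
  qed
  have a2: "continuous_map T euclideanreal \<phi>"
  proof (rule continuous_map_real_uniform_limit)
    show "continuous_map T euclideanreal (\<Phi> n)" for n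
      unfolding \<Phi>_def by (rule continuous_map_Re_form_trl[OF cont])
    fix e :: real assume "0 < e"
    then have e: "0 < e / (4 * C)" using C by simp
    then obtain M where M: "\<And>m n. m \<ge> M \<Longrightarrow> n \<ge> M \<Longrightarrow> N (c m - c n) < e / (4 * C)"
      using csqD[OF c(1)] by meson
    have "\<bar>\<Phi> n p - \<phi> p\<bar> < e" if n: "n \<ge> M" and p: "p \<in> topspace T" for n p
    proof -
      have pG: "p \<in> carrier G" using p topspace_eq by simp
      have "\<bar>\<Phi> n p - \<Phi> m p\<bar> \<le> e / 2" if "m \<ge> M" for m
      proof -
        have "2 * C * N (c n - c m) \<le> 2 * C * (e / (4 * C))"
          using M[OF n that] C by (intro mult_left_mono) auto
        then show ?thesis using diff[OF pG, of n m] C by simp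
      qed
      moreover have "(\<lambda>m. \<bar>\<Phi> n p - \<Phi> m p\<bar>) \<longlonglongrightarrow> \<bar>\<Phi> n p - \<phi> p\<bar>"
        by (intro tendsto_intros lim pG)
      ultimately have "\<bar>\<Phi> n p - \<phi> p\<bar> \<le> e / 2" using LIMSEQ_le_const2 by blast
      then show ?thesis using \<open>0 < e\<close> by simp
    qed
    then show "\<exists>M. \<forall>n\<ge>M. \<forall>p\<in>topspace T. \<bar>\<Phi> n p - \<phi> p\<bar> < e" by blast
  qed
  have a3: "\<phi> (p \<otimes> k) = \<phi> p" if p: "p \<in> carrier G" and k: "k \<in> K" for p k
  proof -
    have kG: "k \<in> carrier G" using k by simp
    have "(\<lambda>n. \<Phi> n (p \<otimes> k) - \<Phi> n p) \<longlonglongrightarrow> 0"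
    proof (rule Lim_null_comparison)
      show "(\<lambda>n. N (trl k (c n) - c n) * C) \<longlonglongrightarrow> 0" using tendsto_mult_left_zero[OF inv[OF k]] .
      \<comment> \<open>\<open>p \<otimes> k\<close> acts as \<open>k\<close> followed by
        \<open>p\<close>, and the action of \<open>p\<close> is isometric, so only the displacement
        of \<open>c n\<close> by \<open>k\<close> counts.\<close>
      have "\<bar>\<Phi> n (p \<otimes> k) - \<Phi> n p\<bar> \<le> N (trl k (c n) - c n) * C" for n
      proof -
        have "\<bar>\<Phi> n (p \<otimes> k) - \<Phi> n p\<bar> \<le> cmod (form \<kappa> (trl p (trl k (c n))) (c n) - form \<kappa> (trl p (c n)) (c n))"
          unfolding \<Phi>_def trl_mult[OF p kG] comp_apply using abs_Re_le_cmod by (metis minus_complex.sel(1))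
        also have "\<dots> \<le> N (trl k (c n) - c n) * N (c n)"
          using B_diff_bound[of "trl p (trl k (c n))" "c n" "trl p (c n)" "c n"] by (simp add: N_trl_diff p)
        also have "\<dots> \<le> N (trl k (c n) - c n) * C" by (intro mult_left_mono C) auto
        finally show ?thesis .
      qed
      then show "\<forall>\<^sub>F n in sequentially. norm (\<Phi> n (p \<otimes> k) - \<Phi> n p) \<le> N (trl k (c n) - c n) * C" by simp
    qed
    moreover have "(\<lambda>n. \<Phi> n (p \<otimes> k) - \<Phi> n p) \<longlonglongrightarrow> \<phi> (p \<otimes> k) - \<phi> p"
      by (intro tendsto_intros lim) (use p kG in auto)
    ultimately show ?thesis using LIMSEQ_unique by fastforce
  qed
  \<comment> \<open>Once the translation is in the kernel, both arguments are the convex combination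
    \<open>c n\<close> on \<open>K\<close>, to which the bounds for such combinations apply.\<close>
  have conv: "\<Phi> n p = Re (form (\<lambda>x y. \<kappa> (shift p x) y) (c n) (c n))" if "p \<in> carrier G" for n p
    unfolding \<Phi>_def form_trl_left[OF that] by (rule Re_form_sum[symmetric])
  have k: "\<kappa> (shift p x) y = h (inv y \<otimes> (p \<otimes> x))" if "p \<in> carrier G" "x \<in> K" "y \<in> K" for p x y
    using that by (simp add: pd_kernel_def shift_def)
  have a4: "0 \<le> \<phi> p" if p: "p \<in> carrier G" for p
  proof (rule LIMSEQ_le_const[OF lim[OF p]])
    have "0 \<le> \<Phi> n p" for n
      unfolding conv[OF p] by (rule Re_form_conv_nonneg[OF c(2) c(2)]) (use p in \<open>simp add: k nonneg\<close>)
    then show "\<exists>M. \<forall>n\<ge>M. 0 \<le> \<Phi> n p" by blast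
  qed
  have a5: "\<phi> p \<le> M" if p: "p \<in> carrier G" and M: "\<And>k l. k \<in> K \<Longrightarrow> l \<in> K \<Longrightarrow> h (inv l \<otimes> (p \<otimes> k)) \<le> M" for p M
  proof (rule LIMSEQ_le_const2[OF lim[OF p]])
    have "\<Phi> n p \<le> M" for n
      unfolding conv[OF p] by (rule Re_form_conv_le[OF c(2) c(2)]) (use p M in \<open>simp add: k\<close>)
    then show "\<exists>m. \<forall>n\<ge>m. \<Phi> n p \<le> M" by blast
  qed
  have a6: "M / (real (card I))\<^sup>2 \<le> \<phi> \<one>"
    if "finite I" "K \<subseteq> (\<Union>i\<in>I. A i)" "0 \<le> M"
      and M: "\<And>i x y. i \<in> I \<Longrightarrow> x \<in> A i \<Longrightarrow> y \<in> A i \<Longrightarrow> x \<in> K \<Longrightarrow> y \<in> K \<Longrightarrow> M \<le> h (inv y \<otimes> x)"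
    for I :: "'a set" and A M
  proof (rule LIMSEQ_le_const[OF lim[OF one_closed]])
    have "M / (real (card I))\<^sup>2 \<le> \<Phi> n \<one>" for n
      unfolding conv[OF one_closed]
      by (rule Re_form_conv_cover[OF c(2) that(1,2) _ that(3)]) (use M in \<open>simp_all add: k nonneg\<close>)
    then show "\<exists>m. \<forall>n\<ge>m. M / (real (card I))\<^sup>2 \<le> \<Phi> n \<one>" by blast
  qed
  show ?thesis by (rule that[OF a1 a2 a3 a4 a5 a6])
qed

section \<open>The quotient by a compact normal subgroup is Polish\<close>

lemma (in topological_group) continuous_map_mult:
  assumes "continuous_map Z T f" "continuous_map Z T g"
  shows "continuous_map Z T (\<lambda>z. f z \<otimes> g z)"
  using continuous_map_compose[OF _ continuous_mult, of Z "\<lambda>z. (f z, g z)"] assms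
  by (simp add: continuous_map_paired comp_def)

locale compact_normal_subgroup = topological_group G T + normal K G
  for G :: "('a, 'm) monoid_scheme" (structure) and T K +
  assumes compact: "compactin T K"
begin

abbreviation q :: "'a \<Rightarrow> 'a set" where "q x \<equiv> K #> x"

abbreviation Q :: "'a set topology" where "Q \<equiv> quotient_group_topology G T K"

lemma one_carrier: "\<one> \<in> carrier G" by simp

lemma quotient_map_q: "quotient_map T Q q"
  unfolding quotient_group_topology_def by (rule quotient_map_quotient_topology)

lemma continuous_map_q: "continuous_map T Q q"
  using quotient_map_q by (rule quotient_imp_continuous_map)

lemma topspace_Q: "topspace Q = carrier (G Mod K)"
  by (simp add: quotient_group_topology_def carrier_FactGroup topspace_eq)

lemma mem_q: "x \<in> carrier G \<Longrightarrow> y \<in> q x \<longleftrightarrow> (\<exists>k\<in>K. y = k \<otimes> x)"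
  by (auto simp: r_coset_def)

lemma q_closed: "x \<in> carrier G \<Longrightarrow> q x \<in> carrier (G Mod K)"
  by (simp add: carrier_FactGroup)

lemma q_eq: "x \<in> carrier G \<Longrightarrow> y \<in> q x \<Longrightarrow> q y = q x"
  using repr_independence subgroup_axioms by metis

lemma q_self: "x \<in> carrier G \<Longrightarrow> x \<in> q x"
  using rcos_self subgroup_axioms by metis

lemma q_mult_left: "k \<in> K \<Longrightarrow> x \<in> carrier G \<Longrightarrow> q (k \<otimes> x) = q x"
  by (rule q_eq) (auto simp: mem_q)

text \<open>The saturation of \<open>W\<close> is the union of its left translates by elements of
  \<open>K\<close>, and these are open.\<close>

lemma open_map_q: "open_map T Q q"
  unfolding open_map_def
proof (intro allI impI)
  fix W assume W: "openin T W"
  then have WG: "W \<subseteq> carrier G" using openin_subset topspace_eq by metis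
  have "{x \<in> topspace T. q x \<in> q ` W} = (\<Union>k\<in>K. {x \<in> topspace T. k \<otimes> x \<in> W})"
  proof (intro Set.set_eqI iffI)
    fix x assume "x \<in> {x \<in> topspace T. q x \<in> q ` W}"
    then obtain w where x: "x \<in> carrier G" and w: "w \<in> W" "q x = q w" by (auto simp: topspace_eq)
    have "w \<in> q x" using q_self[of w] w WG by auto
    then obtain k where "k \<in> K" "w = k \<otimes> x" using mem_q[OF x] by blast
    then show "x \<in> (\<Union>k\<in>K. {x \<in> topspace T. k \<otimes> x \<in> W})" using x w(1) by (auto simp: topspace_eq)
  next
    fix x assume "x \<in> (\<Union>k\<in>K. {x \<in> topspace T. k \<otimes> x \<in> W})"
    then obtain k where "k \<in> K" "x \<in> carrier G" "k \<otimes> x \<in> W" by (auto simp: topspace_eq)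
    then show "x \<in> {x \<in> topspace T. q x \<in> q ` W}"
      using q_mult_left[of k x] by (auto simp: topspace_eq intro!: image_eqI[of _ _ "k \<otimes> x"])
  qed
  moreover have "openin T (\<Union>k\<in>K. {x \<in> topspace T. k \<otimes> x \<in> W})"
    by (intro openin_Union) (auto intro!: openin_continuous_map_preimage[OF continuous_map_mult_left W])
  ultimately show "openin Q (q ` W)"
    unfolding quotient_group_topology_def openin_quotient_topology
    using WG topspace_eq by auto
qed

text \<open>A product of quotient maps need not be a quotient map. Joint continuity of the
  multiplication therefore rests on openness of \<open>q\<close>, which sends open rectangles to
  open rectangles.\<close>

lemma topological_group_quotient: "topological_group (G Mod K) Q"
proof (intro topological_group.intro topological_group_axioms.intro)
  show "group (G Mod K)" by (rule factorgroup_is_group)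
  show "topspace Q = carrier (G Mod K)" by (rule topspace_Q)
  have mult: "q x \<otimes>\<^bsub>G Mod K\<^esub> q y = q (x \<otimes> y)" if "x \<in> carrier G" "y \<in> carrier G" for x y
    using that by (simp add: rcos_sum)
  have inv: "inv\<^bsub>G Mod K\<^esub> (q x) = q (inv x)" if "x \<in> carrier G" for x
    using that inv_FactGroup[OF q_closed] rcos_inv by simp
  show "continuous_map Q Q (\<lambda>x. inv\<^bsub>G Mod K\<^esub> x)"
  proof (rule continuous_compose_quotient_map[OF quotient_map_q])
    have "continuous_map T Q (\<lambda>x. q (inv x))"
      using continuous_map_compose[OF continuous_inv continuous_map_q] by (simp add: comp_def)
    then show "continuous_map T Q ((\<lambda>x. inv\<^bsub>G Mod K\<^esub> x) \<circ> q)"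
      by (rule continuous_map_eq) (simp add: inv topspace_eq)
  qed
  show "continuous_map (prod_topology Q Q) Q (\<lambda>(x, y). x \<otimes>\<^bsub>G Mod K\<^esub> y)"
    unfolding continuous_map_def
  proof (intro conjI allI impI)
    show "(\<lambda>(x, y). x \<otimes>\<^bsub>G Mod K\<^esub> y) \<in> topspace (prod_topology Q Q) \<rightarrow> topspace Q"
      using monoid.m_closed[OF group.is_monoid[OF factorgroup_is_group]] by (auto simp: topspace_Q)
    fix W assume W: "openin Q W"
    then have oW: "openin T {x \<in> topspace T. q x \<in> W}"
      using openin_continuous_map_preimage[OF continuous_map_q] by blast
    show "openin (prod_topology Q Q) {z \<in> topspace (prod_topology Q Q). (case z of (x, y) \<Rightarrow> x \<otimes>\<^bsub>G Mod K\<^esub> y) \<in> W}"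
      unfolding openin_prod_topology_alt
    proof (intro allI impI)
      fix C D assume "(C, D) \<in> {z \<in> topspace (prod_topology Q Q). (case z of (x, y) \<Rightarrow> x \<otimes>\<^bsub>G Mod K\<^esub> y) \<in> W}"
      then obtain x y where xy: "x \<in> carrier G" "y \<in> carrier G" "C = q x" "D = q y" "q (x \<otimes> y) \<in> W"
        by (auto simp: topspace_Q carrier_FactGroup rcos_sum)
      have "openin (prod_topology T T)
          {z \<in> topspace (prod_topology T T). (case z of (x, y) \<Rightarrow> x \<otimes> y) \<in> {x \<in> topspace T. q x \<in> W}}"
        by (rule openin_continuous_map_preimage[OF continuous_mult oW])
      moreover have "(x, y) \<in> {z \<in> topspace (prod_topology T T). (case z of (x, y) \<Rightarrow> x \<otimes> y) \<in> {x \<in> topspace T. q x \<in> W}}"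
        using xy by (simp add: topspace_eq)
      ultimately obtain U V where UV: "openin T U" "openin T V" "x \<in> U" "y \<in> V"
        "U \<times> V \<subseteq> {z \<in> topspace (prod_topology T T). (case z of (x, y) \<Rightarrow> x \<otimes> y) \<in> {x \<in> topspace T. q x \<in> W}}"
        unfolding openin_prod_topology_alt by meson
      have "openin Q (q ` U)" "openin Q (q ` V)" using open_map_q UV by (auto simp: open_map_def)
      moreover have "C \<in> q ` U" "D \<in> q ` V" using xy UV by auto
      moreover have "q ` U \<times> q ` V \<subseteq> {z \<in> topspace (prod_topology Q Q). (case z of (x, y) \<Rightarrow> x \<otimes>\<^bsub>G Mod K\<^esub> y) \<in> W}"
      proof
        fix z assume "z \<in> q ` U \<times> q ` V"
        then obtain u v where z: "u \<in> U" "v \<in> V" "z = (q u, q v)" by auto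
        then have "(u, v) \<in> {z \<in> topspace (prod_topology T T). (case z of (x, y) \<Rightarrow> x \<otimes> y) \<in> {x \<in> topspace T. q x \<in> W}}"
          using UV(5) by blast
        then show "z \<in> {z \<in> topspace (prod_topology Q Q). (case z of (x, y) \<Rightarrow> x \<otimes>\<^bsub>G Mod K\<^esub> y) \<in> W}"
          by (simp add: z topspace_eq topspace_Q q_closed rcos_sum)
      qed
      ultimately show "\<exists>U V. openin Q U \<and> openin Q V \<and> C \<in> U \<and> D \<in> V \<and>
          U \<times> V \<subseteq> {z \<in> topspace (prod_topology Q Q). (case z of (x, y) \<Rightarrow> x \<otimes>\<^bsub>G Mod K\<^esub> y) \<in> W}"
        by blast
    qed
  qed
qed

end

text \<open>For closed sets, the Hausdorff distance is the sup-distance of the distance functions.\<close>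

locale compact_normal_subgroup_metric = compact_normal_subgroup G T K + Metric_space "carrier G" d
  for G :: "('a, 'm) monoid_scheme" (structure) and T K d +
  assumes top: "T = mtopology" and bounded: "d x y \<le> 1" and complete: "mcomplete"
begin

definition dfun :: "'a set \<Rightarrow> 'a \<Rightarrow> real" where "dfun C z = Inf (d z ` C)"

text \<open>The bound \<open>d x y \<le> 1\<close> makes the supremum exist. The value
  \<open>0\<close> off the cosets secures nonnegativity and symmetry on the whole type, as
  \<open>Metric_space\<close> demands.\<close>

definition hausdorff :: "'a set \<Rightarrow> 'a set \<Rightarrow> real" where
  "hausdorff C D = (if C \<in> carrier (G Mod K) \<and> D \<in> carrier (G Mod K)
     then Sup ((\<lambda>z. \<bar>dfun C z - dfun D z\<bar>) ` carrier G) else 0)"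

lemma coset_cases:
  assumes "C \<in> carrier (G Mod K)" obtains x where "x \<in> carrier G" "C = q x"
  using assms by (auto simp: carrier_FactGroup)

lemma coset_subset: "C \<in> carrier (G Mod K) \<Longrightarrow> C \<subseteq> carrier G"
  using coset_cases r_coset_subset_G subset by metis

lemma coset_nonempty: "C \<in> carrier (G Mod K) \<Longrightarrow> C \<noteq> {}"
  using coset_cases q_self by blast

lemma dfun_le: "y \<in> C \<Longrightarrow> dfun C z \<le> d z y"
  unfolding dfun_def by (rule cINF_lower) (auto intro: bdd_belowI[of _ 0])

lemma dfun_greatest: "C \<in> carrier (G Mod K) \<Longrightarrow> (\<And>y. y \<in> C \<Longrightarrow> e \<le> d z y) \<Longrightarrow> e \<le> dfun C z"
  unfolding dfun_def by (rule cINF_greatest[OF coset_nonempty])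

lemma dfun_less: assumes "C \<in> carrier (G Mod K)" "dfun C z < e" obtains y where "y \<in> C" "d z y < e"
  using dfun_greatest[OF assms(1), of e z] assms(2) by force

lemma dfun_nonneg: "C \<in> carrier (G Mod K) \<Longrightarrow> 0 \<le> dfun C z"
  by (rule dfun_greatest) auto

lemma dfun_le_1: assumes "C \<in> carrier (G Mod K)" shows "dfun C z \<le> 1"
proof -
  obtain y where "y \<in> C" using coset_nonempty[OF assms] by blast
  then show ?thesis using dfun_le bounded order_trans by metis
qed

lemma dfun_self: assumes "C \<in> carrier (G Mod K)" "y \<in> C" shows "dfun C y = 0"
  using dfun_le[OF assms(2), of y] dfun_nonneg[OF assms(1), of y] coset_subset assms by fastforce

lemma hausdorff_upper:
  assumes "C \<in> carrier (G Mod K)" "D \<in> carrier (G Mod K)" "z \<in> carrier G"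
  shows "\<bar>dfun C z - dfun D z\<bar> \<le> hausdorff C D"
proof -
  have "\<bar>dfun C z - dfun D z\<bar> \<le> 1" for z
    using dfun_nonneg[OF assms(1), of z] dfun_nonneg[OF assms(2), of z]
      dfun_le_1[OF assms(1), of z] dfun_le_1[OF assms(2), of z] by linarith
  then have "bdd_above ((\<lambda>z. \<bar>dfun C z - dfun D z\<bar>) ` carrier G)" by (intro bdd_aboveI[of _ 1]) auto
  then have "\<bar>dfun C z - dfun D z\<bar> \<le> Sup ((\<lambda>z. \<bar>dfun C z - dfun D z\<bar>) ` carrier G)"
    by (rule cSUP_upper[OF assms(3)])
  then show ?thesis using assms by (simp add: hausdorff_def)
qed

lemma hausdorff_least:
  assumes "C \<in> carrier (G Mod K)" "D \<in> carrier (G Mod K)"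
    and "\<And>z. z \<in> carrier G \<Longrightarrow> \<bar>dfun C z - dfun D z\<bar> \<le> e"
  shows "hausdorff C D \<le> e"
proof -
  have "Sup ((\<lambda>z. \<bar>dfun C z - dfun D z\<bar>) ` carrier G) \<le> e"
    by (rule cSUP_least) (use assms(3) one_carrier in auto)
  then show ?thesis using assms by (simp add: hausdorff_def)
qed

lemma hausdorff_less:
  assumes C: "C \<in> carrier (G Mod K)" and D: "D \<in> carrier (G Mod K)" and "hausdorff C D < e" "x \<in> C"
  obtains y where "y \<in> D" "d x y < e"
proof -
  have "x \<in> carrier G" using coset_subset[OF C] assms(4) by blast
  then have "dfun D x < e"
    using hausdorff_upper[OF C D, of x] dfun_self[OF C assms(4)] assms(3) by linarith
  then show ?thesis using dfun_less[OF D] that by blast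
qed

lemma closedin_coset: "C \<in> carrier (G Mod K) \<Longrightarrow> closedin T C"
proof -
  assume "C \<in> carrier (G Mod K)"
  then obtain x where x: "x \<in> carrier G" "C = q x" by (rule coset_cases)
  have "C = (\<lambda>k. k \<otimes> x) ` K" using x by (auto simp: mem_q)
  then have "compactin T C"
    using image_compactin[OF compact continuous_map_mult_right[OF x(1)]] by simp
  then show ?thesis
    using compactin_imp_closedin Hausdorff_space_mtopology top by blast
qed

text \<open>Distance zero puts each point of \<open>C\<close> into the closure of \<open>D\<close>.
  Cosets are compact, hence closed, and two cosets with a common point coincide, so one point is
  enough.\<close>

lemma Metric_space_hausdorff: "Metric_space (carrier (G Mod K)) hausdorff"
proof
  fix C D
  have "0 \<le> hausdorff C D" if "C \<in> carrier (G Mod K)" "D \<in> carrier (G Mod K)"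
    using hausdorff_upper[OF that one_carrier] by (rule order_trans[OF abs_ge_zero])
  then show "0 \<le> hausdorff C D" by (cases "C \<in> carrier (G Mod K) \<and> D \<in> carrier (G Mod K)") (auto simp: hausdorff_def)
  show "hausdorff C D = hausdorff D C" by (simp add: hausdorff_def abs_minus_commute)
next
  fix C D assume C: "C \<in> carrier (G Mod K)" and D: "D \<in> carrier (G Mod K)"
  show "hausdorff C D = 0 \<longleftrightarrow> C = D"
  proof
    assume 0: "hausdorff C D = 0"
    obtain x where x: "x \<in> C" using coset_nonempty[OF C] by blast
    have "x \<in> D"
    proof (rule ccontr)
      assume "x \<notin> D"
      then have "x \<in> carrier G - D" using coset_subset[OF C] x by blast
      moreover have "openin mtopology (carrier G - D)"
        using closedin_coset[OF D] by (simp add: top closedin_def)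
      ultimately obtain e where e: "0 < e" "mball x e \<subseteq> carrier G - D"
        unfolding openin_mtopology by blast
      then obtain y where y: "y \<in> D" "d x y < e" using hausdorff_less[OF C D _ x, of e] 0 by auto
      then have "y \<in> mball x e"
        unfolding in_mball using coset_subset[OF C] coset_subset[OF D] x by blast
      then show False using e(2) y(1) by blast
    qed
    then show "C = D" using C D x coset_cases q_eq by metis
  next
    assume "C = D"
    then have "hausdorff C D \<le> 0" by (intro hausdorff_least C D) simp
    moreover have "0 \<le> hausdorff C D" using hausdorff_upper[OF C D one_carrier] by linarith
    ultimately show "hausdorff C D = 0" by simp
  qed
next
  fix C D F assume C: "C \<in> carrier (G Mod K)" and D: "D \<in> carrier (G Mod K)" and F: "F \<in> carrier (G Mod K)"
  show "hausdorff C F \<le> hausdorff C D + hausdorff D F"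
  proof (rule hausdorff_least[OF C F])
    fix z assume z: "z \<in> carrier G"
    show "\<bar>dfun C z - dfun F z\<bar> \<le> hausdorff C D + hausdorff D F"
      using hausdorff_upper[OF C D z] hausdorff_upper[OF D F z] by linarith
  qed
qed

sublocale hd: Metric_space "carrier (G Mod K)" hausdorff
  by (rule Metric_space_hausdorff)

text \<open>Pairing \<open>k \<otimes> x\<close> with \<open>k \<otimes> y\<close> for the same
  \<open>k\<close> keeps each coset within \<open>e\<close> of the other.\<close>

lemma hausdorff_q_le:
  assumes x: "x \<in> carrier G" and y: "y \<in> carrier G" and near: "\<And>k. k \<in> K \<Longrightarrow> d (k \<otimes> x) (k \<otimes> y) \<le> e"
  shows "hausdorff (q x) (q y) \<le> e"
proof (rule hausdorff_least)
  have *: "dfun (q u) z - e \<le> dfun (q v) z"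
    if u: "u \<in> carrier G" and v: "v \<in> carrier G" and z: "z \<in> carrier G"
      and near: "\<And>k. k \<in> K \<Longrightarrow> d (k \<otimes> v) (k \<otimes> u) \<le> e" for u v z
  proof (rule dfun_greatest[OF q_closed[OF v]])
    fix w assume "w \<in> q v"
    then obtain k where k: "k \<in> K" "w = k \<otimes> v" using v by (auto simp: mem_q)
    then have "k \<otimes> u \<in> q u" using u by (auto simp: mem_q)
    then have "dfun (q u) z \<le> d z (k \<otimes> u)" by (rule dfun_le)
    also have "\<dots> \<le> d z w + d w (k \<otimes> u)" using k u v z by (intro triangle) auto
    also have "d w (k \<otimes> u) \<le> e" using near k by simp
    finally show "dfun (q u) z - e \<le> d z w" by simp
  qed
  fix z assume z: "z \<in> carrier G"
  have "d (k \<otimes> y) (k \<otimes> x) \<le> e" if "k \<in> K" for k using near[OF that] by (simp add: commute)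
  then show "\<bar>dfun (q x) z - dfun (q y) z\<bar> \<le> e"
    using *[OF x y z] *[OF y x z near] by force
qed (use x y q_closed in auto)

text \<open>The metric is not assumed invariant, so \<open>d (k \<otimes> x) (k \<otimes> y)\<close>
  has to be made small uniformly in \<open>k\<close>; compactness of \<open>K\<close> achieves this
  through the tube lemma.\<close>

lemma continuous_map_q_hausdorff: "continuous_map T hd.mtopology q"
  unfolding hd.continuous_map_to_metric
proof (intro ballI allI impI)
  fix x and e :: real assume "x \<in> topspace T" and e: "0 < e"
  then have x: "x \<in> carrier G" by (simp add: topspace_eq)
  let ?P = "prod_topology T T"
  define f where "f = (\<lambda>z. mdist (metric (carrier G, d)) (snd z \<otimes> x) (snd z \<otimes> fst z))"
  have T: "T = mtopology_of (metric (carrier G, d))" by (simp add: mtopology_of top)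
  have "continuous_map ?P euclideanreal f"
    unfolding f_def
    by (intro continuous_map_mdist; unfold T[symmetric]; intro continuous_map_mult continuous_map_snd continuous_map_fst)
      (simp add: x topspace_eq)
  then have "openin ?P {z \<in> topspace ?P. f z \<in> {..<e/2}}"
    by (rule openin_continuous_map_preimage) auto
  moreover have "{x} \<times> K \<subseteq> {z \<in> topspace ?P. f z \<in> {..<e/2}}"
    using x e subset by (auto simp: f_def topspace_eq)
  ultimately obtain U V where U: "openin T U" "x \<in> U" "K \<subseteq> V" "U \<times> V \<subseteq> {z \<in> topspace ?P. f z \<in> {..<e/2}}"
    using tube_lemma_right[of T T "{z \<in> topspace ?P. f z \<in> {..<e/2}}" K x] compact \<open>x \<in> topspace T\<close> by blast
  have "q y \<in> hd.mball (q x) e" if "y \<in> U" for y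
  proof -
    have y: "y \<in> carrier G" using that U(1) openin_subset topspace_eq by blast
    have "d (k \<otimes> x) (k \<otimes> y) \<le> e / 2" if k: "k \<in> K" for k
    proof -
      have "(y, k) \<in> {z \<in> topspace ?P. f z \<in> {..<e/2}}" using U \<open>y \<in> U\<close> k by blast
      then show ?thesis by (simp add: f_def)
    qed
    then have "hausdorff (q x) (q y) \<le> e / 2" by (rule hausdorff_q_le[OF x y])
    then show ?thesis using e x y by (simp add: q_closed)
  qed
  then show "\<exists>U. openin T U \<and> x \<in> U \<and> (\<forall>y\<in>U. q y \<in> hd.mball (q x) e)" using U by blast
qed

text \<open>Continuity of \<open>q\<close> gives one inclusion. For the other, every coset within
  Hausdorff distance \<open>e\<close> of \<open>q x\<close> contains a point of the
  \<open>e\<close>-ball about \<open>x\<close>, so a quotient-open set containing \<open>q x\<close>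
  contains a Hausdorff ball.\<close>

lemma Q_eq_hausdorff: "Q = hd.mtopology"
proof (rule topology_eq[THEN iffD2], intro allI iffI)
  fix W assume W: "openin hd.mtopology W"
  then have "openin T {x \<in> topspace T. q x \<in> W}"
    by (rule openin_continuous_map_preimage[OF continuous_map_q_hausdorff])
  moreover have "W \<subseteq> q ` topspace T"
    using openin_subset[OF W] unfolding hd.topspace_mtopology by (simp add: carrier_FactGroup topspace_eq)
  ultimately show "openin Q W"
    by (simp add: quotient_group_topology_def openin_quotient_topology)
next
  fix W assume W: "openin Q W"
  then have oW: "openin mtopology {x \<in> topspace T. q x \<in> W}"
    using openin_continuous_map_preimage[OF continuous_map_q] top by simp
  have WQ: "W \<subseteq> carrier (G Mod K)" using openin_subset[OF W] topspace_Q by simp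
  show "openin hd.mtopology W"
    unfolding hd.openin_mtopology
  proof (intro conjI allI impI WQ)
    fix C assume "C \<in> W"
    then have C: "C \<in> carrier (G Mod K)" using WQ by blast
    then obtain x where x: "x \<in> carrier G" "C = q x" by (rule coset_cases)
    then have "x \<in> {x \<in> topspace T. q x \<in> W}" using \<open>C \<in> W\<close> by (simp add: topspace_eq)
    then obtain e where e: "0 < e" "mball x e \<subseteq> {x \<in> topspace T. q x \<in> W}"
      using oW unfolding openin_mtopology by blast
    have "hd.mball C e \<subseteq> W"
    proof
      fix D assume "D \<in> hd.mball C e"
      then have D: "D \<in> carrier (G Mod K)" "hausdorff C D < e" by auto
      then obtain y where y: "y \<in> D" "d x y < e"
        using hausdorff_less[OF C D(1), of e x] x q_self by auto
      then have "y \<in> carrier G" using coset_subset[OF D(1)] by blast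
      then have "q y \<in> W" using e(2) y x by auto
      moreover have "q y = D" using D y coset_cases q_eq by metis
      ultimately show "D \<in> W" by simp
    qed
    then show "\<exists>r>0. hd.mball C r \<subseteq> W" using e by blast
  qed
qed

text \<open>A fast subsequence of cosets is lifted to points, each chosen in the next coset within
  \<open>(1/2) ^ n\<close> of its predecessor. The lift is Cauchy in \<open>G\<close>, its limit
  projects to a limit of the subsequence, and a Cauchy sequence with a convergent subsequence
  converges.\<close>

lemma mcomplete_hausdorff: "hd.mcomplete"
  unfolding hd.mcomplete_def
proof (intro allI impI)
  fix \<sigma> assume \<sigma>: "hd.MCauchy \<sigma>"
  have \<sigma>c: "\<sigma> n \<in> carrier (G Mod K)" for n using \<sigma> by (auto simp: hd.MCauchy_def)
  have "\<exists>M. \<forall>m n. M \<le> m \<longrightarrow> M \<le> n \<longrightarrow> hausdorff (\<sigma> m) (\<sigma> n) < (1/2) ^ k" for k :: nat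
    using \<sigma> unfolding hd.MCauchy_def by simp
  then obtain M where M: "\<And>k m n. M k \<le> m \<Longrightarrow> M k \<le> n \<Longrightarrow> hausdorff (\<sigma> m) (\<sigma> n) < (1/2) ^ k" by metis
  \<comment> \<open>The summand \<open>k\<close> makes \<open>r\<close> strictly increasing, and the
    sum makes \<open>r k\<close> at least \<open>M k\<close>.\<close>
  define r where "r = (\<lambda>k. k + (\<Sum>i\<le>k. M i))"
  have rM: "M k \<le> r k" for k
  proof -
    have "M k \<le> (\<Sum>i\<le>k. M i)" by (rule member_le_sum) auto
    then show ?thesis by (simp add: r_def)
  qed
  have r: "strict_mono r" by (rule strict_monoI_Suc) (simp add: r_def)
  have step: "hausdorff (\<sigma> (r k)) (\<sigma> (r (Suc k))) < (1/2) ^ k" for k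
    using M[of k "r k" "r (Suc k)"] rM[of k] strict_mono_leD[OF r, of k "Suc k"] by simp
  have "\<exists>x. \<forall>n. x n \<in> \<sigma> (r n) \<and> d (x n) (x (Suc n)) < (1/2) ^ n"
  proof (rule dependent_nat_choice)
    show "\<exists>x. x \<in> \<sigma> (r 0)" using coset_nonempty[OF \<sigma>c] by blast
    fix x n assume "x \<in> \<sigma> (r n)"
    then show "\<exists>y. y \<in> \<sigma> (r (Suc n)) \<and> d x y < (1/2) ^ n"
      using hausdorff_less[OF \<sigma>c \<sigma>c step[of n]] by blast
  qed
  then obtain x where x: "\<And>n. x n \<in> \<sigma> (r n)" "\<And>n. d (x n) (x (Suc n)) < (1/2) ^ n" by blast
  have xG: "x n \<in> carrier G" for n using x(1) coset_subset[OF \<sigma>c] by blast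
  \<comment> \<open>The subtracted remainder of the geometric series is what lets the induction go
    through.\<close>
  have tail: "d (x m) (x (m + k)) \<le> 2 * (1/2) ^ m - 2 * (1/2) ^ (m + k)" for m k
  proof (induction k)
    case (Suc k)
    have "d (x m) (x (m + Suc k)) \<le> d (x m) (x (m + k)) + d (x (m + k)) (x (Suc (m + k)))"
      using triangle xG by simp
    also have "\<dots> \<le> (2 * (1/2) ^ m - 2 * (1/2) ^ (m + k)) + (1/2) ^ (m + k)"
      using Suc x(2)[of "m + k"] by linarith
    finally show ?case by simp
  qed (simp add: xG)
  have tail': "d (x m) (x n) \<le> 2 * (1/2) ^ m" if "m \<le> n" for m n
  proof -
    have "0 \<le> 2 * (1/2 :: real) ^ n" by simp
    moreover have "d (x m) (x n) \<le> 2 * (1/2) ^ m - 2 * (1/2) ^ n" using tail[of m "n - m"] that by simp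
    ultimately show ?thesis by linarith
  qed
  have "MCauchy x"
    unfolding MCauchy_def
  proof (intro conjI allI impI)
    show "range x \<subseteq> carrier G" using xG by blast
    fix e :: real assume "0 < e"
    then obtain L where L: "(1/2) ^ L < e / 2" using real_arch_pow_inv[of "e/2" "1/2"] by auto
    have "d (x m) (x n) < e" if "L \<le> m" "L \<le> n" for m n
    proof -
      have *: "d (x m) (x n) < e" if "m \<le> n" "L \<le> m" for m n
      proof -
        have "d (x m) (x n) \<le> 2 * (1/2) ^ m" by (rule tail'[OF that(1)])
        also have "\<dots> \<le> 2 * (1/2) ^ L" using that(2) by (intro mult_left_mono power_decreasing) auto
        also have "\<dots> < e" using L by simp
        finally show ?thesis .
      qed
      show ?thesis using *[of m n] *[of n m] that commute[of "x m" "x n"] by (cases "m \<le> n") auto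
    qed
    then show "\<exists>L. \<forall>m n. L \<le> m \<longrightarrow> L \<le> n \<longrightarrow> d (x m) (x n) < e" by blast
  qed
  then obtain l where "limitin mtopology x l sequentially"
    using complete unfolding mcomplete_def by blast
  then have "limitin hd.mtopology (q \<circ> x) (q l) sequentially"
    using continuous_map_limit[OF continuous_map_q_hausdorff] top by simp
  moreover have "q \<circ> x = \<sigma> \<circ> r"
  proof
    fix n
    obtain y where "y \<in> carrier G" "\<sigma> (r n) = q y" using coset_cases[OF \<sigma>c] .
    then show "(q \<circ> x) n = (\<sigma> \<circ> r) n" using x(1)[of n] q_eq by simp
  qed
  ultimately have "limitin hd.mtopology (\<sigma> \<circ> r) (q l) sequentially" by simp
  then show "\<exists>x. limitin hd.mtopology \<sigma> x sequentially"
    using hd.MCauchy_convergent_subsequence[OF \<sigma> r] by blast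
qed

end

lemma (in compact_normal_subgroup) polish_group_quotient:
  assumes "polish_group G T"
  shows "polish_group (G Mod K) Q"
proof -
  obtain M d where d: "Metric_space M d" "Metric_space.mcomplete M d" "T = Metric_space.mtopology M d"
    using assms by (auto simp: polish_group_def completely_metrizable_space_def)
  interpret d: Metric_space M d by fact
  \<comment> \<open>Capping changes neither the topology nor completeness and supplies the bound
    \<open>1\<close>.\<close>
  define d' where "d' = d.capped_dist 1"
  have M: "M = carrier G" using d(3) topspace_eq d.topspace_mtopology by metis
  interpret d': Metric_space "carrier G" d' unfolding d'_def M[symmetric] by (rule d.capped_dist)
  interpret m: compact_normal_subgroup_metric G T K d'
  proof
    show "T = d'.mtopology" unfolding d'_def M[symmetric] d.mtopology_capped_metric by (rule d(3))
    show "d'.mcomplete" unfolding d'_def M[symmetric] d.mcomplete_capped_metric by (rule d(2))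
    show "d' x y \<le> 1" for x y by (simp add: d'_def d.capped_dist_def)
  qed
  have "completely_metrizable_space Q"
    unfolding m.Q_eq_hausdorff by (rule m.hd.completely_metrizable_space_mtopology[OF m.mcomplete_hausdorff])
  moreover have "separable_space Q"
    using separable_space_quotient_map_image[OF quotient_map_q] assms by (simp add: polish_group_def)
  ultimately show ?thesis using topological_group_quotient by (simp add: polish_group_def)
qed

section \<open>Invariant positive definite functions\<close>

text \<open>The combination of the \<open>w i\<close> matters only through its inner products, so a
  vector with the right inner products is built by induction instead of a finite sum in
  \<open>H\<close>.\<close>

lemma (in complex_inner_space) psd_kernel_Gram:
  fixes w :: "'i \<Rightarrow> 'h"
  assumes w: "\<And>i. w i \<in> carrier H"
  shows "psd_kernel (\<lambda>i j. Re (cinner H (w i) (w j)))"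
proof (rule psd_kernelI)
  show "Re (cinner H (w i) (w j)) = Re (cinner H (w j) (w i))" for i j
    using cinner_commute[OF w w, of i j] by simp
  fix A :: "'i set" and c :: "'i \<Rightarrow> real"
  assume "finite A"
  then have "\<exists>u\<in>carrier H. \<forall>v\<in>carrier H. cinner H u v = (\<Sum>i\<in>A. of_real (c i) * cinner H (w i) v)"
  proof (induction A rule: finite_induct)
    case empty
    have "\<zero> \<in> carrier H" "\<forall>v\<in>carrier H. cinner H \<zero> v = 0" by (auto simp: cinner_zero_left)
    then show ?case by auto
  next
    case (insert a A)
    then obtain u where "u \<in> carrier H" "\<And>v. v \<in> carrier H \<Longrightarrow> cinner H u v = (\<Sum>i\<in>A. of_real (c i) * cinner H (w i) v)"
      by blast
    then show ?case
      using insert.hyps w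
      by (intro bexI[of _ "(of_real (c a) \<odot> w a) \<oplus> u"]) (auto simp: cinner_add cinner_smult smult_in_carrier)
  qed
  then obtain u where u: "u \<in> carrier H"
    and uv: "\<And>v. v \<in> carrier H \<Longrightarrow> cinner H u v = (\<Sum>i\<in>A. of_real (c i) * cinner H (w i) v)" by blast
  have "cinner H (w i) u = (\<Sum>j\<in>A. of_real (c j) * cinner H (w i) (w j))" for i
  proof -
    have "cinner H (w i) u = cnj (cinner H u (w i))" using cinner_commute[OF w u] .
    also have "\<dots> = (\<Sum>j\<in>A. of_real (c j) * cnj (cinner H (w j) (w i)))" by (simp add: uv w)
    also have "\<dots> = (\<Sum>j\<in>A. of_real (c j) * cinner H (w i) (w j))"
      by (intro sum.cong refl) (simp add: cinner_commute[OF w w, symmetric])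
    finally show ?thesis .
  qed
  then have "cinner H u u = (\<Sum>i\<in>A. \<Sum>j\<in>A. of_real (c i * c j) * cinner H (w i) (w j))"
    by (simp add: uv[OF u] sum_distrib_left mult.assoc)
  then have "Re (cinner H u u) = (\<Sum>i\<in>A. \<Sum>j\<in>A. c i * c j * Re (cinner H (w i) (w j)))"
    by (simp only: Re_sum) (simp add: mult.assoc)
  then show "0 \<le> (\<Sum>i\<in>A. \<Sum>j\<in>A. c i * c j * Re (cinner H (w i) (w j)))"
    using cinner_nonneg[OF u] by simp
qed

lemma (in complex_inner_space) hdist_power2:
  assumes "x \<in> carrier H" "y \<in> carrier H"
  shows "(hdist H x y)\<^sup>2 = (hnorm H x)\<^sup>2 - 2 * Re (cinner H y x) + (hnorm H y)\<^sup>2"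
proof -
  have "x \<ominus> y = x \<oplus> (-1) \<odot> y" using assms by (simp add: smult_minus_1 M.minus_eq)
  then show ?thesis using hnorm_add_smult[OF assms, of "-1"] assms by (simp add: hdist_def)
qed

lemma unitary_ops_hnorm: "U \<in> unitary_ops H \<Longrightarrow> x \<in> carrier H \<Longrightarrow> hnorm H (U x) = hnorm H x"
  by (simp add: hnorm_def unitary_ops_cinner)

text \<open>By unitarity this is the Gram kernel of the orbit vectors \<open>\<pi> x v\<close>. Off
  the carrier, \<open>v\<close> itself stands in so that all vectors lie in \<open>H\<close>; the
  restriction then discards those entries.\<close>

lemma (in topological_group) positive_definite_matrix_coefficient:
  assumes H: "complex_inner_space H" and \<pi>: "\<pi> \<in> hom G (unitary_group H)" and v: "v \<in> carrier H"
  shows "positive_definite G (\<lambda>x. Re (cinner H (\<pi> x v) v))"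
proof -
  interpret H: complex_inner_space H by fact
  have U: "\<pi> x \<in> unitary_ops H" if "x \<in> carrier G" for x using hom_in_carrier[OF \<pi> that] by simp
  have "pd_kernel G (\<lambda>x. Re (cinner H (\<pi> x v) v)) =
      (\<lambda>x y. if x \<in> carrier G \<and> y \<in> carrier G
        then Re (cinner H (if x \<in> carrier G then \<pi> x v else v) (if y \<in> carrier G then \<pi> y v else v)) else 0)"
  proof (intro ext)
    fix x y
    have "cinner H (\<pi> (inv y \<otimes> x) v) v = cinner H (\<pi> x v) (\<pi> y v)" if xy: "x \<in> carrier G" "y \<in> carrier G"
    proof -
      have "\<pi> x = \<pi> y \<otimes>\<^bsub>unitary_group H\<^esub> \<pi> (inv y \<otimes> x)"
        using hom_mult[OF \<pi>, of y "inv y \<otimes> x"] xy by (simp add: m_assoc[symmetric])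
      then have "\<pi> x v = \<pi> y (\<pi> (inv y \<otimes> x) v)"
        using U xy v by (simp add: unitary_group_mult compose_eq)
      moreover have "\<pi> (inv y \<otimes> x) v \<in> carrier H" using xy by (intro unitary_ops_closed[OF U v]) simp
      ultimately show ?thesis
        using unitary_ops_cinner[OF U[OF xy(2)] _ v] by simp
    qed
    then show "pd_kernel G (\<lambda>x. Re (cinner H (\<pi> x v) v)) x y =
      (if x \<in> carrier G \<and> y \<in> carrier G
        then Re (cinner H (if x \<in> carrier G then \<pi> x v else v) (if y \<in> carrier G then \<pi> y v else v)) else 0)"
      by (simp add: pd_kernel_def)
  qed
  moreover have "psd_kernel (\<lambda>x y. Re (cinner H (if x \<in> carrier G then \<pi> x v else v) (if y \<in> carrier G then \<pi> y v else v)))"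
    by (rule H.psd_kernel_Gram) (use U v unitary_ops_closed in force)
  ultimately show ?thesis unfolding positive_definite_def by (simp only: psd_kernel_restrict)
qed

lemma (in complex_inner_space) continuous_map_Re_cinner:
  assumes f: "continuous_map Z mtopology f" and v: "v \<in> carrier H"
  shows "continuous_map Z euclideanreal (\<lambda>x. Re (cinner H (f x) v))"
  unfolding mtopology_is_euclidean[symmetric] Met_TC.continuous_map_to_metric
proof (intro ballI allI impI)
  fix x and e :: real assume x: "x \<in> topspace Z" and e: "0 < e"
  \<comment> \<open>The added \<open>1\<close> covers the case that \<open>v\<close> is
    zero.\<close>
  have pos: "0 < hnorm H v + 1" using hnorm_nonneg[OF v] by simp
  then have "0 < e / (hnorm H v + 1)" using e by simp
  then obtain U where U: "openin Z U" "x \<in> U" "\<And>y. y \<in> U \<Longrightarrow> f y \<in> mball (f x) (e / (hnorm H v + 1))"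
    using f x unfolding continuous_map_to_metric by meson
  have "Re (cinner H (f y) v) \<in> Met_TC.mball (Re (cinner H (f x) v)) e" if y: "y \<in> U" for y
  proof -
    have c: "f x \<in> carrier H" "f y \<in> carrier H" "hdist H (f x) (f y) < e / (hnorm H v + 1)"
      using U(3)[OF y] by auto
    then have "f x \<ominus> f y \<in> carrier H" by simp
    have "f x = (f x \<ominus> f y) \<oplus> f y" using c by (simp add: M.minus_eq M.a_assoc M.l_neg)
    then have "cinner H (f x) v = cinner H (f x \<ominus> f y) v + cinner H (f y) v"
      using cinner_add[of "f x \<ominus> f y" "f y" v] c v by simp
    then have "\<bar>Re (cinner H (f x) v) - Re (cinner H (f y) v)\<bar> \<le> cmod (cinner H (f x \<ominus> f y) v)"
      using abs_Re_le_cmod[of "cinner H (f x \<ominus> f y) v"] by simp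
    also have "\<dots> \<le> hnorm H v * hdist H (f x) (f y)"
      using Cauchy_Schwarz[OF v \<open>f x \<ominus> f y \<in> carrier H\<close>] c by (simp add: hdist_def)
    also have "\<dots> \<le> (hnorm H v + 1) * hdist H (f x) (f y)"
      by (intro mult_right_mono) auto
    also have "\<dots> < e" using c(3) pos by (simp add: pos_less_divide_eq mult.commute)
    finally show ?thesis by (simp add: dist_real_def)
  qed
  then show "\<exists>U. openin Z U \<and> x \<in> U \<and> (\<forall>y\<in>U. Re (cinner H (f y) v) \<in> Met_TC.mball (Re (cinner H (f x) v)) e)"
    using U by blast
qed

text \<open>If \<open>x\<close> lies off \<open>V\<close>, some \<open>v\<close> in \<open>F\<close>
  is moved by at least \<open>e\<close>. The squared displacement is
  \<open>2 * (hnorm H v)\<^sup>2 - 2 * g v x\<close>, so this lowers \<open>g v x\<close> by at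
  least \<open>e\<^sup>2 / 2\<close> from its value at \<open>\<one>\<close>. Every summand of
  \<open>b\<close> is largest at \<open>\<one>\<close>, hence no other vector of \<open>F\<close>
  makes up for the loss.\<close>

lemma (in topological_group) exists_pd_neighbourhood:
  assumes H: "complex_inner_space H" and \<pi>: "\<pi> \<in> hom G (unitary_group H)"
    and inj: "inj_on \<pi> (carrier G)" and S: "S = \<pi> ` carrier G"
    and homeo: "homeomorphic_map T (subtopology (strong_operator_topology H) S) \<pi>"
    and V: "openin T V" "\<one> \<in> V"
  shows "\<exists>b \<delta>. positive_definite G b \<and> continuous_map T euclideanreal b \<and> 0 < \<delta> \<and> \<delta> < b \<one> \<and>
    (\<forall>x\<in>carrier G. 0 \<le> b x) \<and> (\<forall>x\<in>carrier G. x \<notin> V \<longrightarrow> b x \<le> b \<one> - \<delta>)"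
proof -
  interpret H: complex_inner_space H by fact
  have VG: "V \<subseteq> carrier G" using V openin_subset topspace_eq by blast
  have U: "\<pi> x \<in> unitary_ops H" if "x \<in> carrier G" for x using hom_in_carrier[OF \<pi> that] by simp
  have "\<pi> \<one> = \<one>\<^bsub>unitary_group H\<^esub>"
    using hom_one[OF \<pi> is_group H.group_unitary_group] .
  then have one: "\<pi> \<one> v = v" if "v \<in> carrier H" for v
    using that by (simp add: unitary_group_def BijGroup_def)
  have cont\<pi>: "continuous_map T (strong_operator_topology H) \<pi>"
    using homeomorphic_imp_continuous_map[OF homeo] by (simp add: continuous_map_in_subtopology)
  have "openin (subtopology (strong_operator_topology H) S) (\<pi> ` V)"
    using homeomorphic_imp_open_map[OF homeo] V(1) by (simp add: open_map_def)
  then obtain W where W: "openin (strong_operator_topology H) W" "\<pi> ` V = W \<inter> S"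
    by (auto simp: openin_subtopology)
  have "\<pi> \<one> \<in> W" using W V by blast
  then obtain F e where F: "finite F" "F \<subseteq> carrier H" "0 < e"
    and nbhd: "\<And>A. A \<in> unitary_ops H \<Longrightarrow> (\<And>v. v \<in> F \<Longrightarrow> hdist H (\<pi> \<one> v) (A v) < e) \<Longrightarrow> A \<in> W"
    using openin_strong_operator_topologyD[OF H W(1)] by metis
  define g where "g = (\<lambda>v x. Re (cinner H (\<pi> x v) v))"
  \<comment> \<open>Adding \<open>(hnorm H v)\<^sup>2\<close> makes each summand nonnegative on the
    carrier. The leading \<open>1\<close> makes \<open>b \<one>\<close> at least \<open>1\<close>,
    so that it exceeds \<open>\<delta> \<le> 1/2\<close> even when \<open>F\<close> is
    empty.\<close>
  define b where "b = (\<lambda>x. 1 + (\<Sum>v\<in>F. (hnorm H v)\<^sup>2 + g v x))"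
  define \<delta> where "\<delta> = min (e\<^sup>2 / 2) (1/2)"
  have g: "(hdist H v (\<pi> x v))\<^sup>2 = 2 * (hnorm H v)\<^sup>2 - 2 * g v x" "\<bar>g v x\<bar> \<le> (hnorm H v)\<^sup>2"
    if "v \<in> F" "x \<in> carrier G" for v x
  proof -
    have "v \<in> carrier H" using that F by blast
    then have v: "v \<in> carrier H" "\<pi> x v \<in> carrier H" using unitary_ops_closed[OF U[OF that(2)]] by auto
    show "(hdist H v (\<pi> x v))\<^sup>2 = 2 * (hnorm H v)\<^sup>2 - 2 * g v x"
      using H.hdist_power2[OF v] unitary_ops_hnorm[OF U[OF that(2)] v(1)] by (simp add: g_def)
    have "\<bar>g v x\<bar> \<le> hnorm H v * hnorm H (\<pi> x v)"
      unfolding g_def by (rule order_trans[OF abs_Re_le_cmod H.Cauchy_Schwarz[OF v]])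
    then show "\<bar>g v x\<bar> \<le> (hnorm H v)\<^sup>2"
      using unitary_ops_hnorm[OF U[OF that(2)] v(1)] by (simp add: power2_eq_square)
  qed
  have g1: "g v \<one> = (hnorm H v)\<^sup>2" if "v \<in> F" for v
    using that F one[of v] H.cinner_self[of v] unfolding g_def by auto
  have a1: "positive_definite G b"
    unfolding b_def g_def using F
    by (intro positive_definite_add positive_definite_sum positive_definite_const
        positive_definite_matrix_coefficient[OF H \<pi>]) auto
  have a2: "continuous_map T euclideanreal b"
  proof -
    have "continuous_map T euclideanreal (g v)" if "v \<in> F" for v
    proof -
      have v: "v \<in> carrier H" using that F by blast
      have "continuous_map T H.mtopology (\<lambda>x. \<pi> x v)"
        using continuous_map_compose[OF cont\<pi> continuous_map_strong_operator_eval[OF H v]] by (simp add: comp_def)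
      then show ?thesis unfolding g_def by (rule H.continuous_map_Re_cinner[OF _ v])
    qed
    then show ?thesis
      unfolding b_def using F(1)
      by (intro continuous_map_add continuous_map_sum) auto
  qed
  have b1: "b \<one> = 1 + (\<Sum>v\<in>F. 2 * (hnorm H v)\<^sup>2)" unfolding b_def by (simp add: g1)
  have pos: "0 \<le> (\<Sum>v\<in>F. 2 * (hnorm H v)\<^sup>2)" by (simp add: sum_nonneg)
  have a3: "0 < \<delta>" using F(3) by (simp add: \<delta>_def)
  have "\<delta> \<le> 1/2" by (simp add: \<delta>_def)
  then have a4: "\<delta> < b \<one>" using b1 pos by linarith
  have a5: "0 \<le> b x" if x: "x \<in> carrier G" for x
  proof -
    have "0 \<le> (\<Sum>v\<in>F. (hnorm H v)\<^sup>2 + g v x)"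
      using g(2)[OF _ x] by (intro sum_nonneg) (smt (verit))
    then show ?thesis by (simp add: b_def)
  qed
  have a6: "b x \<le> b \<one> - \<delta>" if x: "x \<in> carrier G" "x \<notin> V" for x
  proof -
    have "\<pi> x \<notin> W"
    proof
      assume "\<pi> x \<in> W"
      then have "\<pi> x \<in> \<pi> ` V" using W S x by blast
      then show False using inj x VG by (metis image_iff inj_onD subsetD)
    qed
    then obtain v where v: "v \<in> F" "\<not> hdist H (\<pi> \<one> v) (\<pi> x v) < e" using nbhd[OF U[OF x(1)]] by blast
    then have "e \<le> hdist H v (\<pi> x v)" using one[of v] F by auto
    then have "e\<^sup>2 \<le> (hdist H v (\<pi> x v))\<^sup>2" using F(3) by (intro power_mono) auto
    then have gv: "g v x \<le> (hnorm H v)\<^sup>2 - e\<^sup>2 / 2" using g(1)[OF v(1) x(1)] by simp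
    have "(\<Sum>u\<in>F. (hnorm H u)\<^sup>2 + g u x) = ((hnorm H v)\<^sup>2 + g v x) + (\<Sum>u\<in>F - {v}. (hnorm H u)\<^sup>2 + g u x)"
      by (rule sum.remove[OF F(1) v(1)])
    also have "(\<Sum>u\<in>F - {v}. (hnorm H u)\<^sup>2 + g u x) \<le> (\<Sum>u\<in>F - {v}. 2 * (hnorm H u)\<^sup>2)"
      using g(2)[OF _ x(1)] by (intro sum_mono) (smt (verit) Diff_iff)
    also have "((hnorm H v)\<^sup>2 + g v x) + (\<Sum>u\<in>F - {v}. 2 * (hnorm H u)\<^sup>2) \<le>
        (2 * (hnorm H v)\<^sup>2 + (\<Sum>u\<in>F - {v}. 2 * (hnorm H u)\<^sup>2)) - e\<^sup>2 / 2" using gv by simp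
    also have "2 * (hnorm H v)\<^sup>2 + (\<Sum>u\<in>F - {v}. 2 * (hnorm H u)\<^sup>2) = (\<Sum>u\<in>F. 2 * (hnorm H u)\<^sup>2)"
      by (rule sum.remove[OF F(1) v(1), symmetric])
    finally have "b x \<le> b \<one> - e\<^sup>2 / 2" using b1 by (simp add: b_def)
    moreover have "\<delta> \<le> e\<^sup>2 / 2" by (simp add: \<delta>_def)
    ultimately show ?thesis by linarith
  qed
  show ?thesis using a1 a2 a3 a4 a5 a6 by (intro exI[of _ b] exI[of _ \<delta>]) simp
qed

lemma (in compact_normal_subgroup) exists_invariant_pd_neighbourhood:
  assumes b: "positive_definite G b" "continuous_map T euclideanreal b" and \<delta>: "0 < \<delta>" "\<delta> < b \<one>"
    and nonneg: "\<And>x. x \<in> carrier G \<Longrightarrow> 0 \<le> b x"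
    and off: "\<And>x. x \<in> carrier G \<Longrightarrow> x \<notin> V \<Longrightarrow> b x \<le> b \<one> - \<delta>"
  shows "\<exists>\<phi>. positive_definite G \<phi> \<and> continuous_map T euclideanreal \<phi> \<and>
    (\<forall>p\<in>carrier G. \<forall>k\<in>K. \<phi> (p \<otimes> k) = \<phi> p) \<and> (\<forall>p\<in>carrier G. 0 \<le> \<phi> p) \<and> \<phi> \<one> = 1 \<and>
    (\<forall>p\<in>carrier G. (\<forall>k\<in>K. p \<otimes> k \<notin> V) \<longrightarrow> \<phi> p \<le> 1/2)"
proof -
  \<comment> \<open>\<open>M\<close> lies strictly between \<open>L\<close>, the bound off
    \<open>V\<close>, and \<open>b \<one>\<close>: close to the diagonal of \<open>K\<close> the
    kernel exceeds \<open>M\<close>, and the ratio \<open>L / M\<close> is below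
    \<open>1\<close>.\<close>
  define M where "M = b \<one> - \<delta> / 2"
  define L where "L = b \<one> - \<delta>"
  have M: "0 < M" "0 \<le> L" "L < M" using \<delta> by (simp_all add: M_def L_def)
  have "\<exists>U. openin T U \<and> k \<in> U \<and> (\<forall>x\<in>U. \<forall>y\<in>U. M \<le> b (inv y \<otimes> x))" if k: "k \<in> K" for k
  proof -
    let ?f = "\<lambda>z. b (inv (snd z) \<otimes> fst z)"
    have kG: "k \<in> carrier G" using k by simp
    have "continuous_map (prod_topology T T) T (\<lambda>z. inv (snd z) \<otimes> fst z)"
      using continuous_map_compose[OF continuous_map_snd continuous_inv]
      by (intro continuous_map_mult continuous_map_fst) (simp add: comp_def)
    then have "continuous_map (prod_topology T T) euclideanreal ?f"
      using continuous_map_compose[OF _ b(2)] by (force simp: comp_def)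
    then have "openin (prod_topology T T) {z \<in> topspace (prod_topology T T). ?f z \<in> {M<..}}"
      by (rule openin_continuous_map_preimage) auto
    moreover have "(k, k) \<in> {z \<in> topspace (prod_topology T T). ?f z \<in> {M<..}}"
      using kG \<delta> by (simp add: topspace_eq M_def)
    ultimately obtain A B where AB: "openin T A" "openin T B" "k \<in> A" "k \<in> B"
      "A \<times> B \<subseteq> {z \<in> topspace (prod_topology T T). ?f z \<in> {M<..}}"
      unfolding openin_prod_topology_alt by meson
    have "M \<le> b (inv y \<otimes> x)" if "x \<in> A \<inter> B" "y \<in> A \<inter> B" for x y
    proof -
      have "(x, y) \<in> A \<times> B" using that by blast
      then show ?thesis using AB(5) by fastforce
    qed
    then show ?thesis using AB by (intro exI[of _ "A \<inter> B"]) auto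
  qed
  then obtain U where U: "\<And>k. k \<in> K \<Longrightarrow> openin T (U k)" "\<And>k. k \<in> K \<Longrightarrow> k \<in> U k"
    "\<And>k x y. k \<in> K \<Longrightarrow> x \<in> U k \<Longrightarrow> y \<in> U k \<Longrightarrow> M \<le> b (inv y \<otimes> x)" by metis
  have "\<exists>F. finite F \<and> F \<subseteq> U ` K \<and> K \<subseteq> \<Union>F"
    by (rule compactinD[OF compact]) (use U(1,2) in auto)
  then obtain I where I: "finite I" "I \<subseteq> K" "K \<subseteq> (\<Union>i\<in>I. U i)"
    by (metis finite_subset_image)
  have "I \<noteq> {}" using I(3) one_closed by blast
  then have m: "1 \<le> real (card I)" using I(1) by (simp add: Suc_leI card_gt_0_iff)
  have "0 < 1 / (2 * (real (card I))\<^sup>2)" using m by simp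
  moreover have "L / M < 1" "0 \<le> L / M" using M by simp_all
  \<comment> \<open>\<open>(card I)\<^sup>2\<close> is the loss in the covering bound, and the
    factor \<open>2\<close> produces the ratio \<open>1/2\<close> in the conclusion.\<close>
  ultimately obtain n where n: "(L / M) ^ n < 1 / (2 * (real (card I))\<^sup>2)"
    using real_arch_pow_inv by blast
  show ?thesis
  proof (rule exists_average[of "\<lambda>x. b x ^ n" K])
    show "positive_definite G (\<lambda>x. b x ^ n)" by (rule positive_definite_power[OF b(1)])
    show "continuous_map T euclideanreal (\<lambda>x. b x ^ n)" by (rule continuous_map_real_pow[OF b(2)])
    show "0 \<le> b x ^ n" if "x \<in> carrier G" for x using nonneg[OF that] by simp
    show "subgroup K G" by (rule subgroup_axioms)
  next
    fix \<psi> assume \<psi>: "positive_definite G \<psi>" "continuous_map T euclideanreal \<psi>"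
      "\<And>p k. p \<in> carrier G \<Longrightarrow> k \<in> K \<Longrightarrow> \<psi> (p \<otimes> k) = \<psi> p"
      "\<And>p. p \<in> carrier G \<Longrightarrow> 0 \<le> \<psi> p"
        and \<psi>_le: "\<And>p M. p \<in> carrier G \<Longrightarrow> (\<And>k l. k \<in> K \<Longrightarrow> l \<in> K \<Longrightarrow> b (inv l \<otimes> (p \<otimes> k)) ^ n \<le> M) \<Longrightarrow> \<psi> p \<le> M"
        and \<psi>_ge: "\<And>(I::'a set) A M. finite I \<Longrightarrow> K \<subseteq> (\<Union>i\<in>I. A i) \<Longrightarrow> 0 \<le> M \<Longrightarrow>
         (\<And>i x y. i \<in> I \<Longrightarrow> x \<in> A i \<Longrightarrow> y \<in> A i \<Longrightarrow> x \<in> K \<Longrightarrow> y \<in> K \<Longrightarrow> M \<le> b (inv y \<otimes> x) ^ n) \<Longrightarrow>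
         M / (real (card I))\<^sup>2 \<le> \<psi> \<one>"
    have lower: "M ^ n / (real (card I))\<^sup>2 \<le> \<psi> \<one>"
      using I U(3) M(1) by (intro \<psi>_ge[of I U] I(1,3)) (auto intro!: power_mono)
    have pos: "0 < \<psi> \<one>"
    proof -
      have "0 < M ^ n / (real (card I))\<^sup>2" using M m by simp
      then show ?thesis using lower by linarith
    qed
    have upper: "\<psi> p \<le> \<psi> \<one> / 2" if p: "p \<in> carrier G" and pV: "\<And>k. k \<in> K \<Longrightarrow> p \<otimes> k \<notin> V" for p
    proof -
      have "\<psi> p \<le> L ^ n"
      proof (rule \<psi>_le[OF p])
        fix k l assume k: "k \<in> K" and l: "l \<in> K"
        \<comment> \<open>Normality moves \<open>inv l\<close> past \<open>p\<close> at the price of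
          a conjugation, which stays in \<open>K\<close>; so all points entering the average lie in
          \<open>p\<close> times \<open>K\<close>.\<close>
        then have "inv l \<otimes> (p \<otimes> k) = p \<otimes> ((inv p \<otimes> inv l \<otimes> p) \<otimes> k)"
          using p by (simp add: m_assoc[symmetric])
        moreover have "(inv p \<otimes> inv l \<otimes> p) \<otimes> k \<in> K" using inv_op_closed1[of p "inv l"] p k l by simp
        ultimately have "inv l \<otimes> (p \<otimes> k) \<notin> V" using pV by simp
        then show "b (inv l \<otimes> (p \<otimes> k)) ^ n \<le> L ^ n"
          using off nonneg p k l by (intro power_mono) (auto simp: L_def)
      qed
      also have "L ^ n = (L / M) ^ n * M ^ n" using M by (simp add: power_divide)
      also have "\<dots> \<le> 1 / (2 * (real (card I))\<^sup>2) * M ^ n" using n M by (intro mult_right_mono) auto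
      also have "\<dots> = (M ^ n / (real (card I))\<^sup>2) / 2" by simp
      also have "\<dots> \<le> \<psi> \<one> / 2" using lower by simp
      finally show ?thesis .
    qed
    show ?thesis
    proof (intro exI conjI ballI impI)
      show "positive_definite G (\<lambda>x. inverse (\<psi> \<one>) * \<psi> x)"
        using pos by (intro positive_definite_mult positive_definite_const \<psi>(1)) simp
      show "continuous_map T euclideanreal (\<lambda>x. inverse (\<psi> \<one>) * \<psi> x)"
        by (rule continuous_map_real_mult_left[OF \<psi>(2)])
      show "inverse (\<psi> \<one>) * \<psi> p \<le> 1/2" if "p \<in> carrier G" "\<forall>k\<in>K. p \<otimes> k \<notin> V" for p
        using upper[of p] that pos by (simp add: field_simps)
    qed (use pos \<psi> in auto)
  qed
qed

context positive_definite_function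
begin

lemma N_delta_diff:
  assumes "p \<in> carrier G" "q \<in> carrier G"
  shows "(N (delta p - delta q))\<^sup>2 = 2 * h \<one> - 2 * h (inv q \<otimes> p)"
  using assms by (simp add: N_diff_power2) (simp add: N_power2 form_single pd_kernel_def)

text \<open>The squared distance of two point masses is nonnegative.\<close>

lemma pd_le_one: "p \<in> carrier G \<Longrightarrow> h p \<le> h \<one>"
  using N_delta_diff[of p \<one>] zero_le_power2[of "N (delta p - delta \<one>)"] by simp

end

text \<open>The weights \<open>(1/2) ^ Suc i\<close> add up to \<open>1\<close> and each
  \<open>f i\<close> is at most \<open>1\<close>, so \<open>1 - \<phi> p\<close> is a sum of
  nonnegative defects. If \<open>p\<close> times \<open>K\<close> misses the \<open>i\<close>-th
  basic neighbourhood, the \<open>i\<close>-th defect alone is at least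
  \<open>(1/2) ^ Suc i * (1/2)\<close>, and this is the threshold \<open>e\<close>.\<close>

lemma (in compact_normal_subgroup) exists_detecting_pd:
  assumes fc: "first_countable T"
    and loc: "\<forall>V. openin T V \<longrightarrow> \<one> \<in> V \<longrightarrow>
      (\<exists>\<phi>. positive_definite G \<phi> \<and> continuous_map T euclideanreal \<phi> \<and>
        (\<forall>p\<in>carrier G. \<forall>k\<in>K. \<phi> (p \<otimes> k) = \<phi> p) \<and> (\<forall>p\<in>carrier G. 0 \<le> \<phi> p) \<and> \<phi> \<one> = 1 \<and>
        (\<forall>p\<in>carrier G. (\<forall>k\<in>K. p \<otimes> k \<notin> V) \<longrightarrow> \<phi> p \<le> 1/2))"
  shows "\<exists>\<phi>. positive_definite G \<phi> \<and> continuous_map T euclideanreal \<phi> \<and>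
    (\<forall>p\<in>carrier G. \<forall>k\<in>K. \<phi> (p \<otimes> k) = \<phi> p) \<and> \<phi> \<one> = 1 \<and>
    (\<forall>V. openin T V \<longrightarrow> \<one> \<in> V \<longrightarrow> (\<exists>e>0. \<forall>p\<in>carrier G. 1 - \<phi> p < e \<longrightarrow> (\<exists>k\<in>K. p \<otimes> k \<in> V)))"
proof -
  have "\<one> \<in> topspace T" using topspace_eq one_carrier by simp
  then obtain \<B> where \<B>: "countable \<B>" "\<And>V. V \<in> \<B> \<Longrightarrow> openin T V"
    "\<And>U. openin T U \<Longrightarrow> \<one> \<in> U \<Longrightarrow> \<exists>V\<in>\<B>. \<one> \<in> V \<and> V \<subseteq> U"
    using fc unfolding first_countable_def by meson
  define \<C> where "\<C> = {V \<in> \<B>. \<one> \<in> V}"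
  have \<C>: "countable \<C>" "\<C> \<noteq> {}"
    using \<B>(1) \<B>(3)[OF openin_topspace \<open>\<one> \<in> topspace T\<close>] by (auto simp: \<C>_def)
  \<comment> \<open>A finite family is enumerated with repetitions, which does no harm to the
    sum.\<close>
  define V where "V = from_nat_into \<C>"
  have V: "openin T (V i)" "\<one> \<in> V i" for i
    using from_nat_into[OF \<C>(2), of i] \<B>(2) by (auto simp: V_def \<C>_def)
  have "\<forall>i. \<exists>\<phi>. positive_definite G \<phi> \<and> continuous_map T euclideanreal \<phi> \<and>
        (\<forall>p\<in>carrier G. \<forall>k\<in>K. \<phi> (p \<otimes> k) = \<phi> p) \<and> (\<forall>p\<in>carrier G. 0 \<le> \<phi> p) \<and> \<phi> \<one> = 1 \<and>
        (\<forall>p\<in>carrier G. (\<forall>k\<in>K. p \<otimes> k \<notin> V i) \<longrightarrow> \<phi> p \<le> 1/2)"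
    using loc V by blast
  from choice[OF this] obtain f where f: "\<And>i. positive_definite G (f i)" "\<And>i. continuous_map T euclideanreal (f i)"
    "\<And>i p k. p \<in> carrier G \<Longrightarrow> k \<in> K \<Longrightarrow> f i (p \<otimes> k) = f i p"
    "\<And>i p. p \<in> carrier G \<Longrightarrow> 0 \<le> f i p" "\<And>i. f i \<one> = 1"
    "\<And>i p. p \<in> carrier G \<Longrightarrow> \<forall>k\<in>K. p \<otimes> k \<notin> V i \<Longrightarrow> f i p \<le> 1/2" by blast
  have le1: "f i p \<le> 1" if "p \<in> carrier G" for i p
  proof -
    interpret positive_definite_function G "f i" using f(1) by unfold_locales
    show ?thesis using pd_le_one[OF that] by (simp add: f(5))
  qed
  define \<phi> where "\<phi> = (\<lambda>p. suminf (\<lambda>i. (1/2) ^ Suc i * f i p))"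
  have geo: "(\<lambda>i. (1/2 :: real) ^ Suc i) sums 1" by (rule power_half_series)
  have bound: "norm ((1/2) ^ Suc i * f i p) \<le> (1/2) ^ Suc i" if "p \<in> carrier G" for i p
    using f(4)[OF that, of i] le1[OF that, of i] by (simp add: abs_mult)
  have sm: "summable (\<lambda>i. (1/2) ^ Suc i * f i p)" if "p \<in> carrier G" for p
    by (rule summable_comparison_test'[OF sums_summable[OF geo], of 0]) (rule bound[OF that])
  have lim: "(\<lambda>n. \<Sum>i<n. (1/2) ^ Suc i * f i p) \<longlonglongrightarrow> \<phi> p" if "p \<in> carrier G" for p
    unfolding \<phi>_def by (rule summable_LIMSEQ[OF sm[OF that]])
  have a1: "positive_definite G \<phi>"
    by (rule positive_definite_limit[OF _ lim])
      (intro positive_definite_sum positive_definite_mult positive_definite_const f(1), simp)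
  have a2: "continuous_map T euclideanreal \<phi>"
  proof (rule continuous_map_real_uniform_limit)
    show "continuous_map T euclideanreal (\<lambda>p. \<Sum>i<n. (1/2) ^ Suc i * f i p)" for n
      by (intro continuous_map_sum continuous_map_real_mult_left f(2)) auto
    have "uniform_limit (carrier G) (\<lambda>n p. \<Sum>i<n. (1/2) ^ Suc i * f i p) \<phi> sequentially"
      unfolding \<phi>_def by (rule Weierstrass_m_test[OF bound sums_summable[OF geo]])
    then show "\<exists>M. \<forall>n\<ge>M. \<forall>p\<in>topspace T. \<bar>(\<Sum>i<n. (1/2) ^ Suc i * f i p) - \<phi> p\<bar> < e" if "0 < e" for e
      using that by (simp add: uniform_limit_iff eventually_sequentially dist_real_def topspace_eq)
  qed
  have a3: "\<phi> (p \<otimes> k) = \<phi> p" if "p \<in> carrier G" "k \<in> K" for p k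
    using that by (simp add: \<phi>_def f(3))
  have a4: "\<phi> \<one> = 1" using sums_unique[OF geo] by (simp add: \<phi>_def f(5))
  have a5: "\<exists>e>0. \<forall>p\<in>carrier G. 1 - \<phi> p < e \<longrightarrow> (\<exists>k\<in>K. p \<otimes> k \<in> W)" if W: "openin T W" "\<one> \<in> W" for W
  proof -
    obtain U where U: "U \<in> \<C>" "U \<subseteq> W" using \<B>(3)[OF W] by (auto simp: \<C>_def)
    then obtain i where i: "V i = U" unfolding V_def using from_nat_into_surj[OF \<C>(1)] by blast
    have "\<exists>k\<in>K. p \<otimes> k \<in> W" if p: "p \<in> carrier G" and near: "1 - \<phi> p < (1/2) ^ Suc i * (1/2)" for p
    proof (rule ccontr)
      assume "\<not> ?thesis"
      then have "f i p \<le> 1/2" using U(2) i by (intro f(6)[OF p]) auto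
      then have "(1/2) ^ Suc i * (1/2) \<le> (1/2) ^ Suc i * (1 - f i p)" by (intro mult_left_mono) auto
      also have "\<dots> \<le> suminf (\<lambda>j. (1/2) ^ Suc j * (1 - f j p))"
      \<comment> \<open>The partial sum over \<open>{i}\<close> is simplified to its only term
        before the rule is matched.\<close>
      proof (rule sum_le_suminf[of _ "{i}", simplified sum.insert[OF finite.emptyI] empty_iff not_False_eq_True sum.empty add_0_right])
        show "summable (\<lambda>j. (1/2) ^ Suc j * (1 - f j p))"
          using summable_diff[OF sums_summable[OF geo] sm[OF p]] by (simp add: right_diff_distrib)
        show "0 \<le> (1/2) ^ Suc j * (1 - f j p)" for j using le1[OF p, of j] by simp
      qed simp_all
      also have "\<dots> = 1 - \<phi> p"
        using suminf_diff[OF sums_summable[OF geo] sm[OF p]] sums_unique[OF geo]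
        by (simp add: \<phi>_def right_diff_distrib)
      finally show False using near by simp
    qed
    then show ?thesis by (intro exI[of _ "(1/2) ^ Suc i * (1/2)"]) auto
  qed
  show ?thesis using a1 a2 a3 a4 a5 by (intro exI[of _ \<phi>]) blast
qed


section \<open>The representation of the quotient\<close>

lemma form_expand_right: "form \<kappa> u v = (\<Sum>y\<in>supp v. cnj (wt v y) * form \<kappa> u (delta y))"
  unfolding form_sum[of \<kappa> u v]
  by (subst sum.swap) (simp add: form_def lin_single lin_def sum_distrib_left mult.assoc mult.left_commute)

text \<open>Point masses at nearby points are close in the seminorm, their squared distance being
  \<open>2 * \<phi> \<one> - 2 * \<phi> (inv z \<otimes> y)\<close>. A Cauchy sequence is bounded,
  so convergence of its coefficients to zero carries over from a dense sequence of points to all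
  points, and then to all finite combinations.\<close>

lemma (in topological_group) exists_total_sequence:
  assumes pd: "positive_definite G \<phi>" and cont: "continuous_map T euclideanreal \<phi>"
    and sep: "separable_space T"
  obtains D :: "nat \<Rightarrow> 'a" where
    "semi_inner_product_total pscl (form (pd_kernel G \<phi>)) (\<lambda>j. delta (D j))"
proof -
  interpret positive_definite_function G \<phi> using pd by unfold_locales
  obtain C where C: "countable C" "C \<subseteq> carrier G" "T closure_of C = carrier G"
    using sep unfolding separable_space_def topspace_eq by blast
  then have "C \<noteq> {}" using one_closed by force
  define D where "D = from_nat_into C"
  have D: "range D = C" unfolding D_def using range_from_nat_into[OF \<open>C \<noteq> {}\<close> C(1)] .
  have "semi_inner_product_total pscl (form (pd_kernel G \<phi>)) (\<lambda>j. delta (D j))"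
  proof
    fix s v
    assume s: "csq s" and lim: "\<And>j. (\<lambda>k. form (pd_kernel G \<phi>) (s k) (delta (D j))) \<longlonglongrightarrow> 0"
    obtain M where M: "0 < M" "\<And>k. N (s k) \<le> M" using csq_bounded[OF s] by metis
    have "(\<lambda>k. form (pd_kernel G \<phi>) (s k) (delta y)) \<longlonglongrightarrow> 0" for y
    proof (cases "y \<in> carrier G")
      case False
      \<comment> \<open>Point masses off the carrier are null vectors.\<close>
      then have "form (pd_kernel G \<phi>) u (delta y) = 0" for u
        by (simp add: form_def lin_single lin_def pd_kernel_def)
      then show ?thesis by simp
    next
      case y: True
      show ?thesis
      proof (rule LIMSEQ_I)
        fix e :: real assume e: "0 < e"
        define \<delta> where "\<delta> = e / (2 * M)"
        have \<delta>: "0 < \<delta>" using e M by (simp add: \<delta>_def)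
        have "continuous_map T T (\<lambda>z. inv z \<otimes> y)"
          using continuous_map_compose[OF continuous_inv continuous_map_mult_right[OF y]] by (simp add: comp_def)
        then have "continuous_map T euclideanreal (\<lambda>z. \<phi> (inv z \<otimes> y))"
          using continuous_map_compose[OF _ cont] by (force simp: comp_def)
        then have "openin T {z \<in> topspace T. \<phi> (inv z \<otimes> y) \<in> {\<phi> \<one> - \<delta>\<^sup>2 / 2<..}}"
          by (rule openin_continuous_map_preimage) auto
        moreover have "y \<in> {z \<in> topspace T. \<phi> (inv z \<otimes> y) \<in> {\<phi> \<one> - \<delta>\<^sup>2 / 2<..}}"
          using y \<delta> by (simp add: topspace_eq)
        moreover have "y \<in> T closure_of C" using y C by simp
        ultimately obtain z where "z \<in> C" "z \<in> {z \<in> topspace T. \<phi> (inv z \<otimes> y) \<in> {\<phi> \<one> - \<delta>\<^sup>2 / 2<..}}"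
          unfolding in_closure_of by meson
        then have "z \<in> C" "\<phi> \<one> - \<delta>\<^sup>2 / 2 < \<phi> (inv z \<otimes> y)" by simp_all
        then obtain j where j: "\<phi> \<one> - \<delta>\<^sup>2 / 2 < \<phi> (inv (D j) \<otimes> y)" using D by blast
        have "D j \<in> carrier G" using D C(2) by blast
        then have "(N (delta y - delta (D j)))\<^sup>2 < \<delta>\<^sup>2"
          using j N_delta_diff[OF y] by simp
        then have near: "N (delta y - delta (D j)) < \<delta>" using \<delta> by (simp add: power2_less_imp_less)
        have "0 < e / 2" using e by simp
        then obtain L where L: "\<And>k. k \<ge> L \<Longrightarrow> cmod (form (pd_kernel G \<phi>) (s k) (delta (D j))) < e / 2"
          using lim[of j] unfolding LIMSEQ_iff by (metis diff_zero)
        have "norm (form (pd_kernel G \<phi>) (s k) (delta y) - 0) < e" if "k \<ge> L" for k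
        proof -
          have "cmod (form (pd_kernel G \<phi>) (s k) (delta y)) \<le>
              cmod (form (pd_kernel G \<phi>) (s k) (delta (D j))) + cmod (form (pd_kernel G \<phi>) (s k) (delta y - delta (D j)))"
            using norm_triangle_ineq[of "form (pd_kernel G \<phi>) (s k) (delta (D j))"
                "form (pd_kernel G \<phi>) (s k) (delta y - delta (D j))"] by (simp add: B_diff_right)
          also have "cmod (form (pd_kernel G \<phi>) (s k) (delta y - delta (D j))) \<le> N (s k) * N (delta y - delta (D j))"
            by (rule Cauchy_Schwarz)
          also have "\<dots> \<le> M * \<delta>" using M near by (intro mult_mono) auto
          also have "M * \<delta> = e / 2" using M by (simp add: \<delta>_def)
          finally show ?thesis using L[OF that] by simp
        qed
        then show "\<exists>L. \<forall>k\<ge>L. norm (form (pd_kernel G \<phi>) (s k) (delta y) - 0) < e" by blast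
      qed
    qed
    then have "(\<lambda>k. \<Sum>y\<in>supp v. cnj (wt v y) * form (pd_kernel G \<phi>) (s k) (delta y)) \<longlonglongrightarrow> (\<Sum>y\<in>supp v. cnj (wt v y) * 0)"
      by (intro tendsto_intros)
    then show "(\<lambda>k. form (pd_kernel G \<phi>) (s k) v) \<longlonglongrightarrow> 0"
      by (subst form_expand_right) simp
  qed
  then show ?thesis using that by blast
qed

text \<open>\<open>G\<close> acts on the completion by left translation. The orbit of
  \<open>w\<close>, the image of the point mass at \<open>\<one>\<close>, satisfies the distance
  formula \<open>Uw\<close>; through it \<open>detect\<close> shows both that the kernel is no
  larger than \<open>K\<close> and that \<open>U\<close> is open onto its image.\<close>

lemma (in compact_normal_subgroup) quotient_unitary_representation:
  assumes pd: "positive_definite G \<phi>" and cont: "continuous_map T euclideanreal \<phi>"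
    and sep: "separable_space T" and haus: "Hausdorff_space T"
    and inv: "\<And>p k. p \<in> carrier G \<Longrightarrow> k \<in> K \<Longrightarrow> \<phi> (p \<otimes> k) = \<phi> p" and \<phi>1: "\<phi> \<one> = 1"
    and detect: "\<And>V. openin T V \<Longrightarrow> \<one> \<in> V \<Longrightarrow> \<exists>e>0. \<forall>p\<in>carrier G. 1 - \<phi> p < e \<longrightarrow> (\<exists>k\<in>K. p \<otimes> k \<in> V)"
  shows "\<exists>(H :: (nat \<Rightarrow> complex) inner_module) S \<psi>. complex_hilbert_space H \<and>
        subgroup S (unitary_group H) \<and>
        \<psi> \<in> iso (G Mod K) (unitary_group H \<lparr>carrier := S\<rparr>) \<and>
        homeomorphic_map Q (subtopology (strong_operator_topology H) S) \<psi>"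
proof -
  interpret positive_definite_function G \<phi> using pd by unfold_locales
  obtain D :: "nat \<Rightarrow> 'a" where "semi_inner_product_total pscl (form (pd_kernel G \<phi>)) (\<lambda>j. delta (D j))"
    using exists_total_sequence[OF pd cont sep] .
  then interpret t: semi_inner_product_total pscl "form (pd_kernel G \<phi>)" "\<lambda>j. delta (D j)" .
  define H where "H = t.completion"
  note H = t.completion.complex_inner_space_axioms[folded H_def]
  interpret H: complex_inner_space H by (rule H)
  define U where "U = (\<lambda>p. t.lift (trl p))"
  have iso: "t.isometric_op (trl p)" if "p \<in> carrier G" for p
    using that by (simp add: t.isometric_op_def trl_add trl_scl form_trl)
  have hom: "U \<in> hom G (unitary_group H)"
    unfolding U_def H_def by (rule t.lift_hom[OF is_group iso trl_mult trl_one])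
  have Uu: "U p \<in> unitary_ops H" if "p \<in> carrier G" for p using hom_in_carrier[OF hom that] by simp
  have contU: "continuous_map T (strong_operator_topology H) U"
    unfolding U_def H_def
  proof (rule t.continuous_map_lift)
    show "t.isometric_op (trl p)" "t.lift (trl p) \<in> unitary_ops t.completion" if "p \<in> topspace T" for p
      using that iso Uu by (auto simp: U_def H_def topspace_eq)
    fix p v and e :: real assume p: "p \<in> topspace T" and e: "0 < e"
    then have pG: "p \<in> carrier G" by (simp add: topspace_eq)
    \<comment> \<open>Expanding the squared distance of the two translates of \<open>v\<close> shows
      that this is exactly the set where it is below \<open>e\<^sup>2\<close>.\<close>
    let ?W = "{q \<in> topspace T. Re (form (pd_kernel G \<phi>) (trl q v) (trl p v)) \<in> {(N v)\<^sup>2 - e\<^sup>2 / 2<..}}"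
    have N: "(N (trl p v - trl q v))\<^sup>2 = 2 * (N v)\<^sup>2 - 2 * Re (form (pd_kernel G \<phi>) (trl q v) (trl p v))"
      if "q \<in> carrier G" for q
      using N_diff_power2[of "trl q v" "trl p v"] pG that by (simp add: N_trl N_minus_commute)
    have "openin T ?W"
      by (rule openin_continuous_map_preimage[OF continuous_map_Re_form_trl[OF cont]]) auto
    moreover have "p \<in> ?W" using p pG e by (simp add: form_trl N_power2)
    moreover have "N (trl p v - trl q v) < e" if "q \<in> ?W" for q
    proof -
      have "(N (trl p v - trl q v))\<^sup>2 < e\<^sup>2" using N[of q] that by (simp add: topspace_eq)
      then show ?thesis using e by (simp add: power2_less_imp_less)
    qed
    ultimately show "\<exists>W. openin T W \<and> p \<in> W \<and> (\<forall>q\<in>W. N (trl p v - trl q v) < e)" by blast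
  qed
  \<comment> \<open>Conjugation by \<open>x\<close> brings \<open>k\<close> to the right, where
    \<open>\<phi>\<close> absorbs it. So \<open>trl k u\<close> and \<open>u\<close> have the same
    inner products with every vector, and their difference is null.\<close>
  have U_K: "U k = U \<one>" if k: "k \<in> K" for k
  proof -
    have kG: "k \<in> carrier G" using k by simp
    have "pd_kernel G \<phi> (shift k x) y = pd_kernel G \<phi> x y" for x y
    proof (cases "x \<in> carrier G \<and> y \<in> carrier G")
      case True
      then have "inv y \<otimes> (k \<otimes> x) = (inv y \<otimes> x) \<otimes> (inv x \<otimes> k \<otimes> x)"
        using kG by (simp add: m_assoc) (simp add: m_assoc[symmetric])
      then show ?thesis
        using True kG inv[of "inv y \<otimes> x" "inv x \<otimes> k \<otimes> x"] inv_op_closed1[of x k] k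
        by (simp add: pd_kernel_def shift_def)
    qed (auto simp: pd_kernel_def shift_def kG)
    then have "form (pd_kernel G \<phi>) (trl k u) v = form (pd_kernel G \<phi>) u v" for u v
      by (simp add: form_def lin_trl[OF kG] comp_def)
    then have 0: "N (trl k u - u) = 0" for u
      unfolding N_def by (simp add: B_diff_left)
    have "t.coeff (\<lambda>n. trl k (s n)) = t.coeff s" if "csq s" for s
      using t.coeff_eq_iff[OF t.csq_isometric_op[OF iso[OF kG] that] that] 0 by simp
    then show ?thesis by (auto simp: U_def trl_one t.lift_def fun_eq_iff t.rep)
  qed
  have U_mult: "U (p \<otimes> k) = U p" if p: "p \<in> carrier G" and k: "k \<in> K" for p k
  proof -
    have "U (p \<otimes> k) = U p \<otimes>\<^bsub>unitary_group H\<^esub> U k" using hom_mult[OF hom p] k by simp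
    also have "\<dots> = U (p \<otimes> \<one>)" unfolding U_K[OF k] using hom_mult[OF hom p one_carrier] by simp
    finally show ?thesis using p by simp
  qed
  define w where "w = t.emb (delta \<one>)"
  have w: "w \<in> carrier H" unfolding w_def H_def by (simp add: t.coeff_in_E csq_const)
  have Uw: "(hdist H (U p w) (U q w))\<^sup>2 = 2 - 2 * \<phi> (inv q \<otimes> p)" if "p \<in> carrier G" "q \<in> carrier G" for p q
    unfolding U_def w_def H_def
    using that by (simp add: t.lift_emb iso t.hdist_emb trl_delta N_delta_diff \<phi>1)
  have ker: "p \<in> K" if p: "p \<in> carrier G" and Up: "U p = U \<one>" for p
  proof (rule ccontr)
    assume "p \<notin> K"
    \<comment> \<open>This translate of \<open>K\<close> is compact, hence closed, and omits
      \<open>\<one>\<close>. Its complement is thus a neighbourhood of \<open>\<one>\<close>, which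
      \<open>detect\<close> would force it to meet, since \<open>\<phi> p = 1\<close>.\<close>
    define C where "C = (\<lambda>k. p \<otimes> k) ` K"
    have "compactin T C" unfolding C_def by (rule image_compactin[OF compact continuous_map_mult_left[OF p]])
    then have "openin T (topspace T - C)" using compactin_imp_closedin[OF haus] by blast
    moreover have "\<one> \<notin> C"
    proof
      assume "\<one> \<in> C"
      then obtain k where "k \<in> K" "p \<otimes> k = \<one>" by (auto simp: C_def)
      then have "p = inv k" using p by (metis inv_equality mem_carrier inv_inv)
      then show False using \<open>p \<notin> K\<close> \<open>k \<in> K\<close> by simp
    qed
    then have "\<one> \<in> topspace T - C" using topspace_eq one_carrier by simp
    ultimately obtain e where e: "0 < e" "\<forall>p\<in>carrier G. 1 - \<phi> p < e \<longrightarrow> (\<exists>k\<in>K. p \<otimes> k \<in> topspace T - C)"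
      using detect by blast
    have "\<phi> p = 1"
      using Uw[OF p one_carrier] Up p H.mdist_zero[OF unitary_ops_closed[OF Uu[OF one_carrier] w]] by simp
    then have "1 - \<phi> p < e" using e(1) by simp
    then obtain k where k: "k \<in> K" "p \<otimes> k \<in> topspace T - C" using bspec[OF e(2) p] by blast
    have "p \<otimes> k \<in> C" unfolding C_def using k(1) by (rule imageI)
    then show False using k(2) by blast
  qed
  define S where "S = U ` carrier G"
  interpret uh: group_hom G "unitary_group H" U
    using hom by (intro group_hom.intro group_hom_axioms.intro is_group H.group_unitary_group)
  have S: "subgroup S (unitary_group H)" unfolding S_def by (rule uh.img_is_subgroup)
  have "group (unitary_group H \<lparr>carrier := S\<rparr>)"
    using subgroup.subgroup_is_group[OF S H.group_unitary_group] .
  then interpret us: group_hom G "unitary_group H \<lparr>carrier := S\<rparr>" U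
    using hom by (intro group_hom.intro group_hom_axioms.intro is_group) (auto simp: hom_def S_def)
  have one: "U \<one> = \<one>\<^bsub>unitary_group H\<^esub>" by (rule uh.hom_one)
  have kernel: "kernel G (unitary_group H \<lparr>carrier := S\<rparr>) U = K"
  proof (intro Set.set_eqI iffI)
    fix p assume "p \<in> kernel G (unitary_group H \<lparr>carrier := S\<rparr>) U"
    then have "p \<in> carrier G" "U p = U \<one>" by (simp_all add: kernel_def one)
    then show "p \<in> K" by (rule ker)
  next
    fix p assume p: "p \<in> K"
    then show "p \<in> kernel G (unitary_group H \<lparr>carrier := S\<rparr>) U"
      using U_K[OF p] by (simp add: kernel_def one)
  qed
  \<comment> \<open>The form in which the homomorphism theorem supplies its isomorphism;
    \<open>U\<close> is constant on each coset, so the image is a singleton.\<close>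
  define \<psi> where "\<psi> = (\<lambda>C. the_elem (U ` C))"
  have \<psi>iso: "\<psi> \<in> iso (G Mod K) (unitary_group H \<lparr>carrier := S\<rparr>)"
    using us.FactGroup_iso_set[unfolded kernel] unfolding \<psi>_def by (simp add: S_def)
  have U_left: "U (k \<otimes> x) = U x" if "k \<in> K" "x \<in> carrier G" for k x
    using U_mult[OF that(2) inv_op_closed1[OF that(2,1)]] that by (simp add: m_assoc[symmetric])
  have \<psi>q: "\<psi> (q x) = U x" if x: "x \<in> carrier G" for x
  proof -
    have "U ` q x = {U x}" using x U_left q_self[OF x] by (force simp: mem_q)
    then show ?thesis by (simp add: \<psi>_def)
  qed
  let ?S = "subtopology (strong_operator_topology H) S"
  have open_U: "open_map T ?S U"
    unfolding open_map_def
  proof (intro allI impI)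
    fix W assume W: "openin T W"
    then have WG: "W \<subseteq> carrier G" using openin_subset topspace_eq by blast
    show "openin ?S (U ` W)"
    proof (subst openin_subopen, intro ballI)
      fix A assume "A \<in> U ` W"
      then obtain p where p: "p \<in> W" "A = U p" by blast
      then have pG: "p \<in> carrier G" using WG by blast
      have "openin T {v \<in> topspace T. p \<otimes> v \<in> W}"
        by (rule openin_continuous_map_preimage[OF continuous_map_mult_left[OF pG] W])
      moreover have "\<one> \<in> {v \<in> topspace T. p \<otimes> v \<in> W}" using p pG topspace_eq by simp
      ultimately obtain e where e: "0 < e"
        "\<forall>r\<in>carrier G. 1 - \<phi> r < e \<longrightarrow> (\<exists>k\<in>K. r \<otimes> k \<in> {v \<in> topspace T. p \<otimes> v \<in> W})"
        using detect by blast
      \<comment> \<open>With this radius,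
        \<open>2 - 2 * \<phi> (inv p \<otimes> x) < r\<^sup>2\<close> says precisely
        \<open>1 - \<phi> (inv p \<otimes> x) < e\<close>.\<close>
      define r where "r = sqrt (2 * e)"
      have r: "0 < r" "r\<^sup>2 = 2 * e" using e by (simp_all add: r_def)
      let ?B = "{B \<in> topspace ?S. B w \<in> H.mball (U p w) r}"
      have "continuous_map ?S H.mtopology (\<lambda>B. B w)"
        by (intro continuous_map_from_subtopology continuous_map_strong_operator_eval H w)
      then have "openin ?S ?B" by (rule openin_continuous_map_preimage) simp
      moreover have "A \<in> ?B"
        using p pG r unitary_ops_closed[OF Uu[OF pG] w] Uu[OF pG]
        by (simp add: H S_def)
      moreover have "?B \<subseteq> U ` W"
      proof
        fix B assume B: "B \<in> ?B"
        then obtain x where x: "x \<in> carrier G" "B = U x" by (auto simp: S_def)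
        have "hdist H (U p w) (U x w) < r" using B x by simp
        then have "(hdist H (U x w) (U p w))\<^sup>2 < r\<^sup>2"
          by (subst H.commute) (intro power_strict_mono; simp)
        then have "1 - \<phi> (inv p \<otimes> x) < e" using Uw[OF x(1) pG] r by simp
        \<comment> \<open>Detection places \<open>x \<otimes> k\<close> rather than \<open>x\<close>
          in \<open>W\<close>, but both have the same image under \<open>U\<close>.\<close>
        then obtain k where k: "k \<in> K" "p \<otimes> (inv p \<otimes> x \<otimes> k) \<in> W" using e(2) pG x by auto
        then have "x \<otimes> k \<in> W" using pG x by (simp add: m_assoc[symmetric])
        then show "B \<in> U ` W" using U_mult[OF x(1) k(1)] x by (metis imageI)
      qed
      ultimately show "\<exists>B. openin ?S B \<and> A \<in> B \<and> B \<subseteq> U ` W" by blast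
    qed
  qed
  have "quotient_map T ?S U"
  proof (rule continuous_open_imp_quotient_map)
    show "continuous_map T ?S U"
      using contU by (auto simp: continuous_map_in_subtopology S_def topspace_eq)
    show "U ` topspace T = topspace ?S" using Uu by (auto simp: S_def topspace_eq H)
  qed (rule open_U)
  \<comment> \<open>Cancelling the quotient map \<open>q\<close> leaves \<open>\<psi>\<close> as a
    quotient map; an injective one is a homeomorphism.\<close>
  then have "quotient_map T ?S (\<psi> \<circ> q)"
    by (rule quotient_map_eq) (simp add: \<psi>q topspace_eq)
  then have "quotient_map Q ?S \<psi>" using quotient_map_compose_eq[OF quotient_map_q] by blast
  moreover have "inj_on \<psi> (topspace Q)"
    using \<psi>iso by (auto simp: iso_def bij_betw_def topspace_Q)
  ultimately have homeo: "homeomorphic_map Q ?S \<psi>"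
    by (simp add: homeomorphic_map_def)
  have "complex_hilbert_space H" unfolding H_def by (rule t.complex_hilbert_space_completion)
  then show ?thesis
    by (intro exI[of _ H] exI[of _ S] exI[of _ \<psi>] conjI S \<psi>iso homeo)
qed

text \<open>The given space of type \<open>'h\<close> only yields the functions \<open>b\<close>.
  The Hilbert space of the conclusion is built anew from \<open>\<phi>\<close>, so its type does not
  depend on \<open>'h\<close>.\<close>

theorem (in compact_normal_subgroup) hilbert_representable_quotient:
  assumes rep: "hilbert_representable TYPE('h) G T"
  shows "hilbert_representable TYPE(nat \<Rightarrow> complex) (G Mod K) Q"
proof -
  obtain H :: "'h inner_module" and S \<pi> where polish: "polish_group G T" and H: "complex_hilbert_space H"
    and S: "subgroup S (unitary_group H)" and \<pi>: "\<pi> \<in> iso G (unitary_group H \<lparr>carrier := S\<rparr>)"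
    and homeo: "homeomorphic_map T (subtopology (strong_operator_topology H) S) \<pi>"
    using rep by (auto simp: hilbert_representable_def)
  have H': "complex_inner_space H" using H by (simp add: complex_hilbert_space_def)
  have bij: "bij_betw \<pi> (carrier G) S" using \<pi> by (simp add: iso_def)
  have hom: "\<pi> \<in> hom G (unitary_group H)"
    using \<pi> subgroup.subset[OF S] by (auto simp: iso_def hom_def Pi_iff)
  have metrizable: "metrizable_space T"
    using polish completely_metrizable_imp_metrizable_space by (auto simp: polish_group_def)
  have "\<forall>V. openin T V \<longrightarrow> \<one> \<in> V \<longrightarrow>
      (\<exists>\<phi>. positive_definite G \<phi> \<and> continuous_map T euclideanreal \<phi> \<and>
        (\<forall>p\<in>carrier G. \<forall>k\<in>K. \<phi> (p \<otimes> k) = \<phi> p) \<and> (\<forall>p\<in>carrier G. 0 \<le> \<phi> p) \<and> \<phi> \<one> = 1 \<and>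
        (\<forall>p\<in>carrier G. (\<forall>k\<in>K. p \<otimes> k \<notin> V) \<longrightarrow> \<phi> p \<le> 1/2))"
  proof (intro allI impI)
    fix V assume V: "openin T V" "\<one> \<in> V"
    obtain b \<delta> where "positive_definite G b" "continuous_map T euclideanreal b" "0 < \<delta>" "\<delta> < b \<one>"
      "\<forall>x\<in>carrier G. 0 \<le> b x" "\<forall>x\<in>carrier G. x \<notin> V \<longrightarrow> b x \<le> b \<one> - \<delta>"
      using exists_pd_neighbourhood[OF H' hom _ _ homeo V] bij by (auto simp: bij_betw_def)
    then show "\<exists>\<phi>. positive_definite G \<phi> \<and> continuous_map T euclideanreal \<phi> \<and>
        (\<forall>p\<in>carrier G. \<forall>k\<in>K. \<phi> (p \<otimes> k) = \<phi> p) \<and> (\<forall>p\<in>carrier G. 0 \<le> \<phi> p) \<and> \<phi> \<one> = 1 \<and>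
        (\<forall>p\<in>carrier G. (\<forall>k\<in>K. p \<otimes> k \<notin> V) \<longrightarrow> \<phi> p \<le> 1/2)"
      by (intro exists_invariant_pd_neighbourhood[of b \<delta> V]) auto
  qed
  from exists_detecting_pd[OF metrizable_imp_first_countable[OF metrizable] this]
  obtain \<phi> where \<phi>: "positive_definite G \<phi>" "continuous_map T euclideanreal \<phi>"
    "\<forall>p\<in>carrier G. \<forall>k\<in>K. \<phi> (p \<otimes> k) = \<phi> p" "\<phi> \<one> = 1"
    "\<forall>V. openin T V \<longrightarrow> \<one> \<in> V \<longrightarrow> (\<exists>e>0. \<forall>p\<in>carrier G. 1 - \<phi> p < e \<longrightarrow> (\<exists>k\<in>K. p \<otimes> k \<in> V))"
    by (elim exE conjE) (rule that)
  have "\<exists>(H :: (nat \<Rightarrow> complex) inner_module) S \<psi>. complex_hilbert_space H \<and>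
        subgroup S (unitary_group H) \<and>
        \<psi> \<in> iso (G Mod K) (unitary_group H \<lparr>carrier := S\<rparr>) \<and>
        homeomorphic_map Q (subtopology (strong_operator_topology H) S) \<psi>"
  proof (rule quotient_unitary_representation[OF \<phi>(1,2) _ metrizable_imp_Hausdorff_space[OF metrizable] _ \<phi>(4)])
    show "separable_space T" using polish by (simp add: polish_group_def)
    show "\<phi> (p \<otimes> k) = \<phi> p" if "p \<in> carrier G" "k \<in> K" for p k
      using \<phi>(3) that by blast
    show "\<exists>e>0. \<forall>p\<in>carrier G. 1 - \<phi> p < e \<longrightarrow> (\<exists>k\<in>K. p \<otimes> k \<in> V)" if "openin T V" "\<one> \<in> V" for V
      using \<phi>(5) that by blast
  qed
  then show ?thesis
    using polish_group_quotient[OF polish] by (simp add: hilbert_representable_def)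
qed

text \<open>Two continuous maps into a Hausdorff space that agree on a dense set are equal. Applied
  to the two multiplications by \<open>x\<close>, this shows that an element commuting with the
  generator \<open>a\<close> commutes with everything.\<close>

lemma (in topological_group) monothetic_imp_comm_group:
  assumes haus: "Hausdorff_space T" and "monothetic G T"
  shows "comm_group G"
proof -
  obtain a where a: "a \<in> carrier G" "T closure_of (generate G {a}) = carrier G"
    using assms(2) by (auto simp: monothetic_def topspace_eq)
  have comm: "x \<otimes> y = y \<otimes> x" if x: "x \<in> carrier G" and xa: "x \<otimes> a = a \<otimes> x" and y: "y \<in> carrier G" for x y
  proof -
    have gen: "x \<otimes> z = z \<otimes> x" if "z \<in> generate G {a}" for z
      using that
    proof induction
      case one
      then show ?case using x by simp
    next
      case (incl z)
      then show ?case using xa by simp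
    next
      case (inv z)
      have "inv a \<otimes> x = inv a \<otimes> ((x \<otimes> a) \<otimes> inv a)" using x a(1) by (simp add: m_assoc)
      also have "\<dots> = inv a \<otimes> ((a \<otimes> x) \<otimes> inv a)" by (simp only: xa)
      also have "\<dots> = x \<otimes> inv a" using x a(1) by (simp add: m_assoc[symmetric])
      finally have "inv a \<otimes> x = x \<otimes> inv a" .
      then show ?case using inv by simp
    next
      case (eng z z')
      have "z \<in> carrier G" "z' \<in> carrier G"
        using eng.hyps generate_in_carrier[of "{a}"] a(1) by auto
      then show ?case using eng.IH x by (metis m_assoc)
    qed
    show ?thesis
      by (rule forall_in_closure_of_eq[of y T "generate G {a}" T "\<lambda>z. x \<otimes> z" "\<lambda>z. z \<otimes> x"])
        (use y a(2) haus gen continuous_map_mult_left[OF x] continuous_map_mult_right[OF x] in auto)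
  qed
  \<comment> \<open>\<open>comm\<close> is used twice: for \<open>a\<close> itself, which makes
    every \<open>x\<close> commute with \<open>a\<close>, and then for \<open>x\<close>.\<close>
  have "x \<otimes> y = y \<otimes> x" if "x \<in> carrier G" "y \<in> carrier G" for x y
    using comm[OF that(1) comm[OF a(1) refl that(1), symmetric] that(2)] .
  then show ?thesis by (rule group_comm_groupI)
qed

theorem corollary5p3:
  fixes P :: "('a, 'm) monoid_scheme" and T :: "'a topology" and K :: "'a set"
  assumes "polish_group P T"
    and "monothetic P T"
    and "hilbert_representable TYPE('h) P T"
    and "subgroup K P"
    and "compactin T K"
  shows "hilbert_representable TYPE(nat \<Rightarrow> complex) (P Mod K) (quotient_group_topology P T K)"
proof -
  interpret topological_group P T using assms(1) by (simp add: polish_group_def)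
  have "Hausdorff_space T"
    using assms(1) completely_metrizable_imp_metrizable_space metrizable_imp_Hausdorff_space
    by (auto simp: polish_group_def)
  then have "comm_group P" using assms(2) by (rule monothetic_imp_comm_group)
  then have "K \<lhd> P" using assms(4) by (rule comm_group.subgroup_imp_normal)
  then interpret compact_normal_subgroup P T K
    using assms(5) topological_group_axioms
    by (intro compact_normal_subgroup.intro compact_normal_subgroup_axioms.intro)
  show ?thesis using assms(3) by (rule hilbert_representable_quotient)
qed

end
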